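(* Let $G$ be a topological group which is locally compact, Hausdorff, and such that $1\in G$ is a non-degenerate basepoint, and let $q\ge1$ be an integer. 1) The natural surjection $F_n/\Gamma^{q+1}\to F_n/\Gamma^q$ induces maps of simplicial spaces $e_q:E_*(q,G)\to E_*(q+1,G)$ and $b_q:B_*(q,G)\to B_*(q+1,G)$ compatible with the simplicial maps $p_*$; that is, $p_n\circ e_q=b_q\circ p_n:E_n(q,G)\to B_n(q+1,G)$ for all $n$. 2) There are natural morphisms of principal $G$-bundles $$\bigl(E(q,G)\xrightarrow{p}B(q,G)\bigr)\longrightarrow\bigl(E(q+1,G)\xrightarrow{p}B(q+1,G)\bigr)\longrightarrow\bigl(EG\to BG\bigr),$$ the first being given by $e_q$ on total spaces and $b_q$ on base spaces. 3) The maps $e_q,b_q$ yield a natural filtration of subspaces for $EG$ and $BG$. 4) If $G$ is a nilpotent group of class $c$, then $E(c+1,G)=EG$, $B(c+1,G)=BG$ and the filtration is finite. If $G$ is finitely generated, then the filtration is finite if and only if $G$ is nilpotent.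
   Context: For a group $Q$, set $\Gamma^1(Q)=Q$, $\Gamma^{i+1}(Q)=[\Gamma^i(Q),Q]$, and $\Gamma^\infty(Q)=\{1\}$. $Q$ is nilpotent if $\Gamma^{m+1}(Q)=\{1\}$ for some integer $m$, and the least such $m$ is its nilpotency class. $F_n$ is the free group on $n$ generators and $\Gamma^q=\Gamma^q(F_n)$. $Hom(F_n/\Gamma^q,G)$ is the space of homomorphisms $F_n\to G$ trivial on $\Gamma^q$, topologized as a subspace of $G^n$ via the images of the generators. $E_n(q,G)=G\times Hom(F_n/\Gamma^q,G)\subset G^{n+1}$, with faces $d_i(g_0,\dots,g_n)=(g_0,\dots,g_ig_{i+1},\dots,g_n)$ for $0\le i<n$, $d_n(g_0,\dots,g_n)=(g_0,\dots,g_{n-1})$, and degeneracies $s_j(g_0,\dots,g_n)=(g_0,\dots,g_j,1,g_{j+1},\dots,g_n)$. $B_n(q,G)=Hom(F_n/\Gamma^q,G)$ with the same maps except that the coordinate $g_0$ is omitted and $d_0(g_1,\dots,g_n)=(g_2,\dots,g_n)$. $p_n:E_n(q,G)\to B_n(q,G)$ is projection onto the last $n$ coordinates. $E(q,G)$, $B(q,G)$ are the geometric realizations and $p:E(q,G)\to B(q,G)$ is the induced map; $G$ acts on $E(q,G)$ through left multiplication on $g_0$, and $p$ is a principal $G$-bundle. $EG=E(\infty,G)$ and $BG=B(\infty,G)$. The filtration is called finite if it reaches $BG$ (and $EG$) at a finite stage, i.e. $B(q,G)=BG$ for some finite $q$. *)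

theory Defs
  imports
    "HOL-Analysis.Analysis"
    "HOL-Algebra.Group_Action"
    "HOL-Algebra.Generated_Groups"
    "HOL-Homology.Simplices"
begin

section \<open>Topological groups with non-degenerate unit\<close>

locale topological_group = group G for G (structure) +
  fixes T :: "'a topology"
  assumes topspace_eq: "topspace T = carrier G"
    and continuous_mult: "continuous_map (prod_topology T T) T (\<lambda>(x, y). x \<otimes> y)"
    and continuous_inv: "continuous_map T T (\<lambda>x. inv x)"

text \<open>A basepoint is non-degenerate if it forms an NDR pair with the space.\<close>

definition nondegenerate_basepoint :: "'a topology \<Rightarrow> 'a \<Rightarrow> bool" where
  "nondegenerate_basepoint X a \<longleftrightarrow>
     a \<in> topspace X \<and>
     (\<exists>u k. continuous_map X (top_of_set {0..1::real}) u \<and>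
            (\<forall>x \<in> topspace X. u x = 0 \<longleftrightarrow> x = a) \<and>
            homotopic_with (\<lambda>f. f a = a) X X id k \<and>
            (\<forall>x \<in> topspace X. u x < 1 \<longrightarrow> k x = a))"

locale well_pointed_lch_group = topological_group +
  assumes locally_compact: "locally_compact_space T"
    and Hausdorff: "Hausdorff_space T"
    and nondegenerate_one: "nondegenerate_basepoint T \<one>"

definition continuous_hom ::
  "('a, 'm) monoid_scheme \<Rightarrow> 'a topology \<Rightarrow> ('b, 'n) monoid_scheme \<Rightarrow> 'b topology \<Rightarrow> ('a \<Rightarrow> 'b) set"
  where "continuous_hom G T H S = {\<phi> \<in> hom G H. continuous_map T S \<phi>}"


section \<open>Lower central series\<close>

text \<open>The value at \<open>0\<close> is a dummy: the series starts at \<open>1\<close>.\<close>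

primrec lower_central_fin :: "('a, 'm) monoid_scheme \<Rightarrow> nat \<Rightarrow> 'a set" where
  "lower_central_fin Q 0 = carrier Q"
| "lower_central_fin Q (Suc i) =
     (if i = 0 then carrier Q
      else generate Q {x \<otimes>\<^bsub>Q\<^esub> y \<otimes>\<^bsub>Q\<^esub> inv\<^bsub>Q\<^esub> x \<otimes>\<^bsub>Q\<^esub> inv\<^bsub>Q\<^esub> y | x y.
                         x \<in> lower_central_fin Q i \<and> y \<in> carrier Q})"

definition lower_central :: "('a, 'm) monoid_scheme \<Rightarrow> enat \<Rightarrow> 'a set" where
  "lower_central Q q = (case q of enat i \<Rightarrow> lower_central_fin Q i | \<infinity> \<Rightarrow> {\<one>\<^bsub>Q\<^esub>})"

definition nilpotent_group :: "('a, 'm) monoid_scheme \<Rightarrow> bool" where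
  "nilpotent_group Q \<longleftrightarrow> (\<exists>m::nat. lower_central Q (enat (m + 1)) = {\<one>\<^bsub>Q\<^esub>})"

definition nilpotency_class :: "('a, 'm) monoid_scheme \<Rightarrow> nat" where
  "nilpotency_class Q = (LEAST m. lower_central Q (enat (m + 1)) = {\<one>\<^bsub>Q\<^esub>})"

definition finitely_generated_group :: "('a, 'm) monoid_scheme \<Rightarrow> bool" where
  "finitely_generated_group Q \<longleftrightarrow> (\<exists>S. finite S \<and> S \<subseteq> carrier Q \<and> generate Q S = carrier Q)"


section \<open>Free groups\<close>

text \<open>
  The free group on the generators \<open>1, \<dots>, n\<close> as the group of freely reduced words.
  The letter \<open>(i, True)\<close> is the \<open>i\<close>-th generator, \<open>(i, False)\<close> its inverse.
\<close>

type_synonym word = "(nat \<times> bool) list"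

fun cons_reduce :: "nat \<times> bool \<Rightarrow> word \<Rightarrow> word" where
  "cons_reduce a [] = [a]"
| "cons_reduce a (b # w) = (if b = (fst a, \<not> snd a) then w else a # b # w)"

definition free_reduce :: "word \<Rightarrow> word" where
  "free_reduce w = foldr cons_reduce w []"

definition free_group :: "nat \<Rightarrow> word monoid" where
  "free_group n =
     \<lparr>carrier = {w. fst ` set w \<subseteq> {1..n} \<and> free_reduce w = w},
      mult = (\<lambda>v w. free_reduce (v @ w)),
      one = []\<rparr>"

abbreviation free_gamma :: "nat \<Rightarrow> enat \<Rightarrow> word set" where
  "free_gamma n q \<equiv> lower_central (free_group n) q"

abbreviation free_quotient :: "nat \<Rightarrow> enat \<Rightarrow> word set monoid" where
  "free_quotient n q \<equiv> free_group n Mod free_gamma n q"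

definition free_proj :: "nat \<Rightarrow> enat \<Rightarrow> word \<Rightarrow> word set" where
  "free_proj n q w = free_gamma n q #>\<^bsub>free_group n\<^esub> w"

text \<open>For \<open>q \<le> r\<close>: the natural surjection from the quotient by the \<open>r\<close>-th term of the lower
  central series to the quotient by the \<open>q\<close>-th term, sending a coset to the larger coset
  containing it.\<close>

definition free_surj :: "nat \<Rightarrow> enat \<Rightarrow> enat \<Rightarrow> word set \<Rightarrow> word set" where
  "free_surj n r q C = free_gamma n q <#>\<^bsub>free_group n\<^esub> C"

definition gen_images :: "nat \<Rightarrow> (word \<Rightarrow> 'a) \<Rightarrow> (nat \<Rightarrow> 'a)" where
  "gen_images n f = (\<lambda>i\<in>{1..n}. f [(i, True)])"

text \<open>The homomorphisms from the free group that are trivial on the \<open>q\<close>-th term of the lower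
  central series, recorded by the tuple of images of the generators.\<close>

definition hom_tuples :: "('a, 'm) monoid_scheme \<Rightarrow> enat \<Rightarrow> nat \<Rightarrow> (nat \<Rightarrow> 'a) set" where
  "hom_tuples G q n =
     {gen_images n f | f. f \<in> hom (free_group n) G \<and> (\<forall>w \<in> free_gamma n q. f w = \<one>\<^bsub>G\<^esub>)}"


section \<open>Simplicial spaces and geometric realization\<close>

text \<open>\<open>face X n i\<close> is the map \<open>d\<^sub>i\<close> from level \<open>n\<close> to level \<open>n - 1\<close> (for \<open>1 \<le> n\<close>, \<open>i \<le> n\<close>), and
  \<open>degen X n j\<close> is the map \<open>s\<^sub>j\<close> from level \<open>n\<close> to level \<open>n + 1\<close> (for \<open>j \<le> n\<close>).\<close>

record 'x simplicial_data =
  level :: "nat \<Rightarrow> 'x topology"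
  face :: "nat \<Rightarrow> nat \<Rightarrow> 'x \<Rightarrow> 'x"
  degen :: "nat \<Rightarrow> nat \<Rightarrow> 'x \<Rightarrow> 'x"

definition simplicial_space :: "'x simplicial_data \<Rightarrow> bool" where
  "simplicial_space X \<longleftrightarrow>
     (\<forall>n i. 1 \<le> n \<and> i \<le> n \<longrightarrow> continuous_map (level X n) (level X (n - 1)) (face X n i)) \<and>
     (\<forall>n j. j \<le> n \<longrightarrow> continuous_map (level X n) (level X (n + 1)) (degen X n j)) \<and>
     (\<forall>n. \<forall>x \<in> topspace (level X n).
        (\<forall>i j. 2 \<le> n \<and> i < j \<and> j \<le> n \<longrightarrow>
           face X (n - 1) i (face X n j x) = face X (n - 1) (j - 1) (face X n i x)) \<and>
        (\<forall>i j. i \<le> j \<and> j \<le> n \<longrightarrow>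
           degen X (n + 1) i (degen X n j x) = degen X (n + 1) (j + 1) (degen X n i x)) \<and>
        (\<forall>i j. i < j \<and> j \<le> n \<longrightarrow>
           face X (n + 1) i (degen X n j x) = degen X (n - 1) (j - 1) (face X n i x)) \<and>
        (\<forall>i j. j \<le> n \<and> (i = j \<or> i = j + 1) \<longrightarrow>
           face X (n + 1) i (degen X n j x) = x) \<and>
        (\<forall>i j. j + 1 < i \<and> i \<le> n + 1 \<longrightarrow>
           face X (n + 1) i (degen X n j x) = degen X (n - 1) j (face X n (i - 1) x)))"

definition simplicial_map ::
  "'x simplicial_data \<Rightarrow> 'y simplicial_data \<Rightarrow> (nat \<Rightarrow> 'x \<Rightarrow> 'y) \<Rightarrow> bool" where
  "simplicial_map X Y f \<longleftrightarrow>
     simplicial_space X \<and> simplicial_space Y \<and>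
     (\<forall>n. continuous_map (level X n) (level Y n) (f n)) \<and>
     (\<forall>n i. \<forall>x \<in> topspace (level X n). 1 \<le> n \<and> i \<le> n \<longrightarrow>
        f (n - 1) (face X n i x) = face Y n i (f n x)) \<and>
     (\<forall>n j. \<forall>x \<in> topspace (level X n). j \<le> n \<longrightarrow>
        f (n + 1) (degen X n j x) = degen Y n j (f n x))"

text \<open>The codegeneracy of standard simplices, dual to the coface \<open>simplical_face\<close> of the library.\<close>

definition simplex_codegen :: "nat \<Rightarrow> (nat \<Rightarrow> real) \<Rightarrow> (nat \<Rightarrow> real)" where
  "simplex_codegen j t =
     (\<lambda>i. if i < j then t i else if i = j then t j + t (Suc j) else t (Suc i))"

type_synonym 'x simplex_point = "nat \<times> 'x \<times> (nat \<Rightarrow> real)"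

definition prerealization :: "'x simplicial_data \<Rightarrow> 'x simplex_point topology" where
  "prerealization X =
     sum_topology
       (\<lambda>n. prod_topology (level X n) (subtopology (powertop_real UNIV) (standard_simplex n)))
       UNIV"

inductive glue :: "'x simplicial_data \<Rightarrow> 'x simplex_point \<Rightarrow> 'x simplex_point \<Rightarrow> bool"
  for X where
  face: "\<lbrakk>1 \<le> n; i \<le> n; x \<in> topspace (level X n); t \<in> standard_simplex (n - 1)\<rbrakk>
         \<Longrightarrow> glue X (n - 1, face X n i x, t) (n, x, simplical_face i t)"
| degen: "\<lbrakk>j \<le> n; x \<in> topspace (level X n); t \<in> standard_simplex (n + 1)\<rbrakk>
         \<Longrightarrow> glue X (n + 1, degen X n j x, t) (n, x, simplex_codegen j t)"

definition glue_rel :: "'x simplicial_data \<Rightarrow> ('x simplex_point \<times> 'x simplex_point) set" where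
  "glue_rel X =
     {(a, b). a \<in> topspace (prerealization X) \<and> b \<in> topspace (prerealization X) \<and>
              equivclp (glue X) a b}"

text \<open>The set of equivalence classes with the quotient topology.\<close>

definition realization :: "'x simplicial_data \<Rightarrow> 'x simplex_point set topology" where
  "realization X =
     topology (\<lambda>U. U \<subseteq> topspace (prerealization X) // glue_rel X \<and>
       openin (prerealization X) {a \<in> topspace (prerealization X). glue_rel X `` {a} \<in> U})"

text \<open>The map of realizations induced by a simplicial map: the class of \<open>(n, x, t)\<close> is sent
  to the class of \<open>(n, f n x, t)\<close>. (All members of the union below coincide.)\<close>

definition realization_map ::
  "'x simplicial_data \<Rightarrow> 'y simplicial_data \<Rightarrow> (nat \<Rightarrow> 'x \<Rightarrow> 'y) \<Rightarrow>
     'x simplex_point set \<Rightarrow> 'y simplex_point set" where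
  "realization_map X Y f =
     (\<lambda>c \<in> topspace (realization X). \<Union>(n, x, t) \<in> c. glue_rel Y `` {(n, f n x, t)})"


section \<open>Principal bundles\<close>

record ('g, 'e, 'b) bundle_data =
  total :: "'e topology"
  base :: "'b topology"
  proj :: "'e \<Rightarrow> 'b"
  act :: "'g \<Rightarrow> 'e \<Rightarrow> 'e"

definition principal_bundle ::
  "('g, 'm) monoid_scheme \<Rightarrow> 'g topology \<Rightarrow> ('g, 'e, 'b) bundle_data \<Rightarrow> bool" where
  "principal_bundle G T P \<longleftrightarrow>
     group_action G (topspace (total P)) (act P) \<and>
     continuous_map (prod_topology T (total P)) (total P) (\<lambda>(g, x). act P g x) \<and>
     continuous_map (total P) (base P) (proj P) \<and>
     (\<forall>g \<in> carrier G. \<forall>x \<in> topspace (total P). proj P (act P g x) = proj P x) \<and>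
     (\<forall>b \<in> topspace (base P). \<exists>U \<theta>. openin (base P) U \<and> b \<in> U \<and>
        homeomorphic_map (subtopology (total P) {x \<in> topspace (total P). proj P x \<in> U})
                         (prod_topology T (subtopology (base P) U)) \<theta> \<and>
        (\<forall>x \<in> topspace (total P). proj P x \<in> U \<longrightarrow>
           snd (\<theta> x) = proj P x \<and>
           (\<forall>g \<in> carrier G. fst (\<theta> (act P g x)) = g \<otimes>\<^bsub>G\<^esub> fst (\<theta> x))))"

definition principal_bundle_morphism ::
  "('g, 'm) monoid_scheme \<Rightarrow> 'g topology \<Rightarrow> ('g, 'e, 'b) bundle_data \<Rightarrow>
     ('g, 'f, 'c) bundle_data \<Rightarrow> ('e \<Rightarrow> 'f) \<Rightarrow> ('b \<Rightarrow> 'c) \<Rightarrow> bool" where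
  "principal_bundle_morphism G T P Q F f \<longleftrightarrow>
     principal_bundle G T P \<and> principal_bundle G T Q \<and>
     continuous_map (total P) (total Q) F \<and>
     continuous_map (base P) (base Q) f \<and>
     (\<forall>x \<in> topspace (total P). proj Q (F x) = f (proj P x)) \<and>
     (\<forall>g \<in> carrier G. \<forall>x \<in> topspace (total P). F (act P g x) = act Q g (F x))"


section \<open>The simplicial spaces E and B\<close>

text \<open>Level \<open>n\<close> of E consists of tuples indexed by \<open>{0..n}\<close>, level \<open>n\<close> of B of tuples indexed by
  \<open>{1..n}\<close>. With the lower index \<open>l\<close> being \<open>0\<close> or \<open>1\<close>, the same formulas give the faces and
  degeneracies of both: for \<open>l = 1\<close> the face number \<open>0\<close> is \<open>(g\<^sub>1, \<dots>, g\<^sub>n) \<mapsto> (g\<^sub>2, \<dots>, g\<^sub>n)\<close>, and in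
  either case face number \<open>n\<close> drops the last entry.\<close>

definition bar_face ::
  "('a, 'm) monoid_scheme \<Rightarrow> nat \<Rightarrow> nat \<Rightarrow> nat \<Rightarrow> (nat \<Rightarrow> 'a) \<Rightarrow> (nat \<Rightarrow> 'a)" where
  "bar_face G l n i x =
     (\<lambda>k\<in>{l..<n}. if k < i then x k else if k = i then x i \<otimes>\<^bsub>G\<^esub> x (i + 1) else x (k + 1))"

definition bar_degen ::
  "('a, 'm) monoid_scheme \<Rightarrow> nat \<Rightarrow> nat \<Rightarrow> nat \<Rightarrow> (nat \<Rightarrow> 'a) \<Rightarrow> (nat \<Rightarrow> 'a)" where
  "bar_degen G l n j x =
     (\<lambda>k\<in>{l..n + 1}. if k \<le> j then x k else if k = j + 1 then \<one>\<^bsub>G\<^esub> else x (k - 1))"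

definition B_simp ::
  "('a, 'm) monoid_scheme \<Rightarrow> 'a topology \<Rightarrow> enat \<Rightarrow> (nat \<Rightarrow> 'a) simplicial_data" where
  "B_simp G T q =
     \<lparr>level = (\<lambda>n. subtopology (product_topology (\<lambda>_. T) {1..n}) (hom_tuples G q n)),
      face = bar_face G 1,
      degen = bar_degen G 1\<rparr>"

definition E_simp ::
  "('a, 'm) monoid_scheme \<Rightarrow> 'a topology \<Rightarrow> enat \<Rightarrow> (nat \<Rightarrow> 'a) simplicial_data" where
  "E_simp G T q =
     \<lparr>level = (\<lambda>n. subtopology (product_topology (\<lambda>_. T) {0..n})
                    {x \<in> {0..n} \<rightarrow>\<^sub>E carrier G. restrict x {1..n} \<in> hom_tuples G q n}),
      face = bar_face G 0,
      degen = bar_degen G 0\<rparr>"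

definition p_simp :: "nat \<Rightarrow> (nat \<Rightarrow> 'a) \<Rightarrow> (nat \<Rightarrow> 'a)" where
  "p_simp n x = restrict x {1..n}"

text \<open>For \<open>q \<le> r\<close>: the maps of Hom spaces given by precomposition with \<open>free_surj n r q\<close>, and
  the maps on E that they induce. The choice is immaterial since a homomorphism on the
  quotient is determined by the images of the generators.\<close>

definition b_simp ::
  "('a, 'm) monoid_scheme \<Rightarrow> enat \<Rightarrow> enat \<Rightarrow> nat \<Rightarrow> (nat \<Rightarrow> 'a) \<Rightarrow> (nat \<Rightarrow> 'a)" where
  "b_simp G q r n x =
     (let f = (SOME f. f \<in> hom (free_quotient n q) G \<and> gen_images n (f \<circ> free_proj n q) = x)
      in gen_images n (f \<circ> free_surj n r q \<circ> free_proj n r))"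

definition e_simp ::
  "('a, 'm) monoid_scheme \<Rightarrow> enat \<Rightarrow> enat \<Rightarrow> nat \<Rightarrow> (nat \<Rightarrow> 'a) \<Rightarrow> (nat \<Rightarrow> 'a)" where
  "e_simp G q r n x =
     (\<lambda>k\<in>{0..n}. if k = 0 then x 0 else b_simp G q r n (restrict x {1..n}) k)"

abbreviation E_space where "E_space G T q \<equiv> realization (E_simp G T q)"
abbreviation B_space where "B_space G T q \<equiv> realization (B_simp G T q)"

abbreviation EG where "EG G T \<equiv> E_space G T \<infinity>"
abbreviation BG where "BG G T \<equiv> B_space G T \<infinity>"

abbreviation e_map where
  "e_map G T q r \<equiv> realization_map (E_simp G T q) (E_simp G T r) (e_simp G q r)"
abbreviation b_map where
  "b_map G T q r \<equiv> realization_map (B_simp G T q) (B_simp G T r) (b_simp G q r)"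

definition EB_bundle ::
  "('a, 'm) monoid_scheme \<Rightarrow> 'a topology \<Rightarrow> enat \<Rightarrow>
     ('a, (nat \<Rightarrow> 'a) simplex_point set, (nat \<Rightarrow> 'a) simplex_point set) bundle_data" where
  "EB_bundle G T q =
     \<lparr>total = E_space G T q,
      base = B_space G T q,
      proj = realization_map (E_simp G T q) (B_simp G T q) p_simp,
      act = (\<lambda>g. realization_map (E_simp G T q) (E_simp G T q) (\<lambda>n x. x(0 := g \<otimes>\<^bsub>G\<^esub> x 0)))\<rparr>"

text \<open>The maps on E and B induced by a homomorphism of groups.\<close>

definition E_ind where
  "E_ind \<phi> n x = (\<lambda>k\<in>{0..n::nat}. \<phi> (x k))"
definition B_ind where
  "B_ind \<phi> n x = (\<lambda>k\<in>{1..n::nat}. \<phi> (x k))"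

abbreviation E_ind_map where
  "E_ind_map G T H S \<phi> q \<equiv> realization_map (E_simp G T q) (E_simp H S q) (E_ind \<phi>)"
abbreviation B_ind_map where
  "B_ind_map G T H S \<phi> q \<equiv> realization_map (B_simp G T q) (B_simp H S q) (B_ind \<phi>)"


section \<open>The filtrations of EG and BG\<close>

definition subspace_filtration :: "'x topology \<Rightarrow> (nat \<Rightarrow> 'x set) \<Rightarrow> bool" where
  "subspace_filtration X A \<longleftrightarrow> (\<forall>q\<ge>1. A q \<subseteq> A (q + 1) \<and> A q \<subseteq> topspace X)"

definition E_stage ::
  "('a, 'm) monoid_scheme \<Rightarrow> 'a topology \<Rightarrow> nat \<Rightarrow> (nat \<Rightarrow> 'a) simplex_point set set" where
  "E_stage G T q = e_map G T (enat q) \<infinity> ` topspace (E_space G T (enat q))"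

definition B_stage ::
  "('a, 'm) monoid_scheme \<Rightarrow> 'a topology \<Rightarrow> nat \<Rightarrow> (nat \<Rightarrow> 'a) simplex_point set set" where
  "B_stage G T q = b_map G T (enat q) \<infinity> ` topspace (B_space G T (enat q))"

definition filtration_finite :: "('a, 'm) monoid_scheme \<Rightarrow> 'a topology \<Rightarrow> bool" where
  "filtration_finite G T \<longleftrightarrow>
     (\<exists>q\<ge>1. E_stage G T q = topspace (EG G T) \<and> B_stage G T q = topspace (BG G T))"

end

theory Submission
  imports Defs
begin

text \<open>
  A point \<open>(g\<^sub>0, \<dots>, g\<^sub>n; t)\<close> of \<open>E\<^sub>n \<times> \<Delta>\<^sup>n\<close> is a step function on the half-open unit interval, with values the
  partial products \<open>g\<^sub>0\<cdots>g\<^sub>i\<close> on intervals of length \<open>t\<^sub>i\<close>. The gluing relation of the realization of E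
  is equality of step functions, and B is obtained by dividing out left translation
  (\<open>equivclp_glue_E_iff\<close>, \<open>glue_class_B_eqD\<close>). On the other hand a tuple belongs to
  \<open>Hom(F\<^sub>n/\<Gamma>\<^sup>q, G)\<close> if and only if the subgroup \<open>K\<close> that it generates satisfies \<open>\<Gamma>\<^sup>q(K) = 1\<close>
  (\<open>hom_tuples_iff\<close>). As faces, degeneracies and homomorphisms produce entries in the subgroup that is
  already there, everything in sight is simplicial, and \<open>e\<^sub>q\<close> and \<open>b\<^sub>q\<close> are inclusions of tuples.

  The two descriptions fit together: if all \<open>t\<^sub>i\<close> are positive, the subgroup generated by
  \<open>g\<^sub>1, \<dots>, g\<^sub>n\<close> is generated by the quotients of the values of the step function. So whether an interior
  point of a simplex lies in a stage of the filtration can be read off from its tuple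
  (\<open>interior_point_in_tuples\<close>). This gives that the stages are closed subspaces
  (\<open>closedin_image_cells\<close>, by induction over the dimension of the simplex), and that a generating
  tuple of \<open>G\<close> forces \<open>\<Gamma>\<^sup>q(G) = 1\<close> if the filtration stops at \<open>q\<close>
  (\<open>filtration_finite_imp_nilpotent\<close>). Statements about B are deduced from those about E,
  because the projection is the quotient map of a group action.

  A local trivialization amounts to a continuous \<open>G\<close>-equivariant map to \<open>G\<close> on an invariant open
  set. For EG it is built skeleton by skeleton: the value \<open>g\<^sub>0\<close> serves on an open simplex, and since the
  unit of \<open>G\<close> is non-degenerate, the degenerate points and the boundary of \<open>E\<^sub>n \<times> \<Delta>\<^sup>n\<close> are an equivariant
  neighbourhood retract, which allows the map to be extended to the next skeleton
  (\<open>degenerate_part_retraction\<close>, \<open>partial_trivialization_extend\<close>). The retraction does not preserve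
  the homomorphism spaces, so for finite \<open>q\<close> the equivariant map is pulled back along
  \<open>E(q, G) \<rightarrow> EG\<close>.
\<close>

section \<open>The free group of reduced words\<close>

definition reduced_word :: "word \<Rightarrow> bool" where
  "reduced_word = successively (\<lambda>a b. b \<noteq> (fst a, \<not> snd a))"

lemma reduced_word_simps [simp]:
  "reduced_word []"
  "reduced_word [a]"
  "reduced_word (a # b # w) \<longleftrightarrow> b \<noteq> (fst a, \<not> snd a) \<and> reduced_word (b # w)"
  by (simp_all add: reduced_word_def)

lemma reduced_word_tl: "reduced_word (a # w) \<Longrightarrow> reduced_word w"
  by (cases w) auto

lemma reduced_cons_reduce: "reduced_word w \<Longrightarrow> reduced_word (cons_reduce a w)"
  by (cases w) (auto dest: reduced_word_tl)

lemma free_reduce_Nil [simp]: "free_reduce [] = []"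
  and free_reduce_Cons: "free_reduce (a # w) = cons_reduce a (free_reduce w)"
  by (simp_all add: free_reduce_def)

lemma reduced_free_reduce: "reduced_word (free_reduce w)"
  by (induction w) (auto simp: free_reduce_Cons reduced_cons_reduce)

lemma free_reduce_reduced: "reduced_word w \<Longrightarrow> free_reduce w = w"
proof (induction w)
  case (Cons a w)
  then show ?case
    by (cases w) (auto simp: free_reduce_Cons)
qed simp

lemma free_reduce_fixed_iff: "free_reduce w = w \<longleftrightarrow> reduced_word w"
  using free_reduce_reduced reduced_free_reduce by metis

lemma cons_reduce_cancel:
  assumes "reduced_word w"
  shows "cons_reduce (i, \<not> b) (cons_reduce (i, b) w) = w"
  using assms
proof (cases w)
  case (Cons c w')
  with assms show ?thesis by (cases w') auto
qed auto

lemma foldr_cons_reduce_reduced: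
  "reduced_word u \<Longrightarrow> reduced_word (foldr cons_reduce v u)"
  by (induction v) (auto simp: reduced_cons_reduce)

text \<open>
  Pushing letters one by one onto a reduced word undoes itself for adjacent inverse letters, so
  the letters of a word may be reduced before they are pushed. This is what makes the
  multiplication of reduced words associative.
\<close>

lemma foldr_cons_reduce_free_reduce:
  assumes "reduced_word u"
  shows "foldr cons_reduce (free_reduce v) u = foldr cons_reduce v u"
proof (induction v)
  case (Cons a v)
  show ?case
  proof (cases "\<exists>w. free_reduce v = (fst a, \<not> snd a) # w")
    case True
    then obtain w where w: "free_reduce v = (fst a, \<not> snd a) # w" by blast
    have "foldr cons_reduce v u = cons_reduce (fst a, \<not> snd a) (foldr cons_reduce w u)"
      using Cons.IH w by simp
    then have "foldr cons_reduce (a # v) u = foldr cons_reduce w u"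
      using cons_reduce_cancel[OF foldr_cons_reduce_reduced[OF assms, of w], of "fst a" "\<not> snd a"]
      by simp
    then show ?thesis using w by (simp add: free_reduce_Cons)
  next
    case False
    then have "free_reduce (a # v) = a # free_reduce v"
      by (cases "free_reduce v") (auto simp: free_reduce_Cons)
    then show ?thesis using Cons.IH by simp
  qed
qed simp

lemma free_reduce_append: "free_reduce (v @ w) = foldr cons_reduce v (free_reduce w)"
  by (simp add: free_reduce_def)

lemma free_reduce_append_reduced:
  "free_reduce (free_reduce v @ w) = free_reduce (v @ w)"
  "free_reduce (v @ free_reduce w) = free_reduce (v @ w)"
  by (simp_all add: free_reduce_append foldr_cons_reduce_free_reduce reduced_free_reduce
      free_reduce_reduced)

lemma set_cons_reduce: "set (cons_reduce a w) \<subseteq> insert a (set w)"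
  by (cases w) auto

lemma set_free_reduce: "set (free_reduce w) \<subseteq> set w"
proof (induction w)
  case (Cons a w)
  then show ?case using set_cons_reduce[of a "free_reduce w"] by (auto simp: free_reduce_Cons)
qed simp

lemma carrier_free_group:
  "carrier (free_group n) = {w. fst ` set w \<subseteq> {1..n} \<and> reduced_word w}"
  by (simp add: free_group_def free_reduce_fixed_iff)

lemma mult_free_group [simp]: "v \<otimes>\<^bsub>free_group n\<^esub> w = free_reduce (v @ w)"
  and one_free_group [simp]: "\<one>\<^bsub>free_group n\<^esub> = []"
  by (simp_all add: free_group_def)

lemma free_reduce_in_carrier:
  assumes "fst ` set w \<subseteq> {1..n}"
  shows "free_reduce w \<in> carrier (free_group n)"
proof -
  have "fst ` set (free_reduce w) \<subseteq> {1..n}"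
    using assms set_free_reduce[of w] by blast
  then show ?thesis by (simp add: carrier_free_group reduced_free_reduce)
qed

definition inverse_word :: "word \<Rightarrow> word" where
  "inverse_word w = rev (map (\<lambda>(i, b). (i, \<not> b)) w)"

lemma free_reduce_inverse_word: "free_reduce (inverse_word w @ w) = []"
proof (induction w)
  case (Cons a w)
  obtain i b where a: "a = (i, b)" by force
  have "free_reduce (inverse_word (a # w) @ a # w) =
        foldr cons_reduce (inverse_word w) (cons_reduce (i, \<not> b) (cons_reduce (i, b) (free_reduce w)))"
    by (simp add: inverse_word_def a free_reduce_append free_reduce_Cons)
  also have "\<dots> = free_reduce (inverse_word w @ w)"
    by (simp add: cons_reduce_cancel reduced_free_reduce free_reduce_append)
  finally show ?case using Cons.IH by simp
qed (simp add: inverse_word_def)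

lemma group_free_group: "group (free_group n)"
proof (rule groupI)
  fix v w assume "v \<in> carrier (free_group n)" "w \<in> carrier (free_group n)"
  then have "fst ` set (v @ w) \<subseteq> {1..n}"
    by (auto simp: carrier_free_group)
  then show "v \<otimes>\<^bsub>free_group n\<^esub> w \<in> carrier (free_group n)"
    using free_reduce_in_carrier by simp
next
  fix w assume w: "w \<in> carrier (free_group n)"
  have "fst ` set (inverse_word w) \<subseteq> {1..n}"
    using w by (auto simp: carrier_free_group inverse_word_def image_iff)
  then have "free_reduce (inverse_word w) \<in> carrier (free_group n)"
    by (rule free_reduce_in_carrier)
  moreover have "free_reduce (inverse_word w) \<otimes>\<^bsub>free_group n\<^esub> w = \<one>\<^bsub>free_group n\<^esub>"
    by (simp add: free_reduce_append_reduced free_reduce_inverse_word)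
  ultimately show "\<exists>v\<in>carrier (free_group n). v \<otimes>\<^bsub>free_group n\<^esub> w = \<one>\<^bsub>free_group n\<^esub>"
    by blast
next
  show "\<one>\<^bsub>free_group n\<^esub> \<in> carrier (free_group n)" by (simp add: carrier_free_group)
next
  fix w assume "w \<in> carrier (free_group n)"
  then show "\<one>\<^bsub>free_group n\<^esub> \<otimes>\<^bsub>free_group n\<^esub> w = w"
    by (simp add: carrier_free_group free_reduce_reduced)
next
  fix u v w
  show "u \<otimes>\<^bsub>free_group n\<^esub> v \<otimes>\<^bsub>free_group n\<^esub> w = u \<otimes>\<^bsub>free_group n\<^esub> (v \<otimes>\<^bsub>free_group n\<^esub> w)"
    by (simp add: free_reduce_append_reduced)
qed

lemma generator_in_free_group: "i \<in> {1..n} \<Longrightarrow> [(i, b)] \<in> carrier (free_group n)"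
  by (simp add: carrier_free_group)

lemma free_group_Cons:
  assumes "a # w \<in> carrier (free_group n)"
  shows "a # w = [a] \<otimes>\<^bsub>free_group n\<^esub> w" "[a] \<in> carrier (free_group n)" "w \<in> carrier (free_group n)"
  using assms reduced_word_tl[of a w] by (auto simp: carrier_free_group free_reduce_reduced)

lemma inv_generator_free_group:
  assumes "i \<in> {1..n}"
  shows "inv\<^bsub>free_group n\<^esub> [(i, True)] = [(i, False)]"
  using assms
  by (intro group.inv_equality[OF group_free_group] generator_in_free_group)
     (simp_all add: free_reduce_Cons)


section \<open>Evaluation of words\<close>

definition letter_value :: "('a, 'm) monoid_scheme \<Rightarrow> (nat \<Rightarrow> 'a) \<Rightarrow> nat \<times> bool \<Rightarrow> 'a" where
  "letter_value G x a = (if snd a then x (fst a) else inv\<^bsub>G\<^esub> x (fst a))"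

definition word_value :: "('a, 'm) monoid_scheme \<Rightarrow> (nat \<Rightarrow> 'a) \<Rightarrow> word \<Rightarrow> 'a" where
  "word_value G x w = foldr (\<lambda>a g. letter_value G x a \<otimes>\<^bsub>G\<^esub> g) w \<one>\<^bsub>G\<^esub>"

lemma word_value_simps [simp]:
  "word_value G x [] = \<one>\<^bsub>G\<^esub>"
  "word_value G x (a # w) = letter_value G x a \<otimes>\<^bsub>G\<^esub> word_value G x w"
  by (simp_all add: word_value_def)

context group
begin

lemma letter_value_closed [intro]:
  "\<lbrakk>fst a \<in> I; x \<in> I \<rightarrow> carrier G\<rbrakk> \<Longrightarrow> letter_value G x a \<in> carrier G"
  by (auto simp: letter_value_def)

lemma word_value_closed [intro]:
  "\<lbrakk>fst ` set w \<subseteq> I; x \<in> I \<rightarrow> carrier G\<rbrakk> \<Longrightarrow> word_value G x w \<in> carrier G"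
  by (induction w) auto

lemma word_value_append:
  "\<lbrakk>fst ` set v \<subseteq> I; fst ` set w \<subseteq> I; x \<in> I \<rightarrow> carrier G\<rbrakk>
    \<Longrightarrow> word_value G x (v @ w) = word_value G x v \<otimes> word_value G x w"
proof (induction v)
  case (Cons a v)
  then show ?case
    using letter_value_closed[of a I x] word_value_closed[of v I x] word_value_closed[of w I x]
    by (simp add: m_assoc)
qed (auto simp: word_value_closed)

lemma word_value_cons_reduce:
  assumes "fst a \<in> I" "fst ` set w \<subseteq> I" "x \<in> I \<rightarrow> carrier G"
  shows "word_value G x (cons_reduce a w) = letter_value G x a \<otimes> word_value G x w"
proof (cases "\<exists>v. w = (fst a, \<not> snd a) # v")
  case True
  then obtain v where v: "w = (fst a, \<not> snd a) # v" by blast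
  have "x (fst a) \<in> carrier G" using assms by blast
  then have "letter_value G x a \<otimes> letter_value G x (fst a, \<not> snd a) = \<one>"
    by (simp add: letter_value_def)
  moreover have "word_value G x v \<in> carrier G"
    using assms v by (intro word_value_closed[of v I x]) auto
  ultimately show ?thesis
    using assms v letter_value_closed[of a I x] letter_value_closed[of "(fst a, \<not> snd a)" I x]
    by (simp flip: m_assoc)
next
  case False
  then show ?thesis by (cases w) auto
qed

lemma word_value_free_reduce:
  "\<lbrakk>fst ` set w \<subseteq> I; x \<in> I \<rightarrow> carrier G\<rbrakk> \<Longrightarrow> word_value G x (free_reduce w) = word_value G x w"
proof (induction w)
  case (Cons a w)
  have "fst ` set (free_reduce w) \<subseteq> I"
    using Cons.prems set_free_reduce[of w] by auto
  then show ?case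
    using Cons word_value_cons_reduce[of a I "free_reduce w" x] by (simp add: free_reduce_Cons)
qed simp

lemma word_value_hom:
  assumes "x \<in> {1..n} \<rightarrow> carrier G"
  shows "word_value G x \<in> hom (free_group n) G"
proof (rule homI)
  fix w assume "w \<in> carrier (free_group n)"
  then show "word_value G x w \<in> carrier G"
    using assms by (auto simp: carrier_free_group intro!: word_value_closed[where I = "{1..n}"])
next
  fix v w assume "v \<in> carrier (free_group n)" "w \<in> carrier (free_group n)"
  then have vw: "fst ` set v \<subseteq> {1..n}" "fst ` set w \<subseteq> {1..n}" "fst ` set (v @ w) \<subseteq> {1..n}"
    by (auto simp: carrier_free_group)
  show "word_value G x (v \<otimes>\<^bsub>free_group n\<^esub> w) = word_value G x v \<otimes> word_value G x w"
    using word_value_free_reduce[OF vw(3) assms] word_value_append[OF vw(1,2) assms] by simp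
qed

lemma gen_images_word_value:
  assumes "x \<in> {1..n} \<rightarrow>\<^sub>E carrier G"
  shows "gen_images n (word_value G x) = x"
proof
  fix i
  show "gen_images n (word_value G x) i = x i"
  proof (cases "i \<in> {1..n}")
    case True
    then have "x i \<in> carrier G" using assms by blast
    with True show ?thesis by (simp add: gen_images_def letter_value_def)
  next
    case False
    then show ?thesis using PiE_arb[OF assms, of i] by (auto simp: gen_images_def)
  qed
qed

lemma gen_images_in_PiE:
  assumes "f \<in> hom (free_group n) G"
  shows "gen_images n f \<in> {1..n} \<rightarrow>\<^sub>E carrier G"
  using assms generator_in_free_group by (fastforce simp: gen_images_def hom_def)

text \<open>The free group is free: a homomorphism on it is evaluation at the images of the generators.\<close>

lemma hom_free_group_eq_word_value:
  assumes f: "f \<in> hom (free_group n) G" and w: "w \<in> carrier (free_group n)"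
  shows "f w = word_value G (gen_images n f) w"
proof -
  interpret f: group_hom "free_group n" G f
    using f group_free_group by (simp add: group_hom_def group_hom_axioms_def is_group)
  show ?thesis using w
  proof (induction w)
    case Nil
    then show ?case using f.hom_one by simp
  next
    case (Cons a w)
    note d = free_group_Cons[OF Cons.prems]
    obtain i b where a: "a = (i, b)" by force
    have i: "i \<in> {1..n}" using d(2) a by (simp add: carrier_free_group)
    have "f [a] = letter_value G (gen_images n f) a"
    proof (cases b)
      case True
      then show ?thesis using a i by (simp add: letter_value_def gen_images_def)
    next
      case False
      then have "f [a] = inv f [(i, True)]"
        using f.hom_inv[OF generator_in_free_group[OF i, of True]] a inv_generator_free_group[OF i]
        by simp
      then show ?thesis using a i False by (simp add: letter_value_def gen_images_def)
    qed
    moreover have "f (a # w) = f [a] \<otimes> f w"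
      using d f.hom_mult by metis
    ultimately show ?case using Cons.IH d(3) by simp
  qed
qed

lemma word_value_image:
  assumes "x \<in> {1..n} \<rightarrow> carrier G"
  shows "word_value G x ` carrier (free_group n) = generate G (x ` {1..n})"
proof
  show "word_value G x ` carrier (free_group n) \<subseteq> generate G (x ` {1..n})"
  proof clarify
    fix w assume "w \<in> carrier (free_group n)"
    then show "word_value G x w \<in> generate G (x ` {1..n})"
    proof (induction w)
      case (Cons a w)
      note d = free_group_Cons[OF Cons.prems]
      have "fst a \<in> {1..n}" using d(2) by (auto simp: carrier_free_group)
      then have "letter_value G x a \<in> generate G (x ` {1..n})"
        by (auto simp: letter_value_def intro: generate.incl generate.inv)
      then show ?case using Cons.IH[OF d(3)] by (auto intro: generate.eng)
    qed (simp add: generate.one)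
  qed
next
  interpret f: group_hom "free_group n" G "word_value G x"
    using word_value_hom[OF assms] group_free_group
    by (simp add: group_hom_def group_hom_axioms_def is_group)
  have "subgroup (word_value G x ` carrier (free_group n)) G"
    by (rule f.img_is_subgroup)
  moreover have "x ` {1..n} \<subseteq> word_value G x ` carrier (free_group n)"
  proof clarify
    fix i assume i: "i \<in> {1..n}"
    then have "x i \<in> carrier G" using assms by blast
    then have "x i = word_value G x [(i, True)]" by (simp add: letter_value_def)
    then show "x i \<in> word_value G x ` carrier (free_group n)"
      using generator_in_free_group[OF i] by blast
  qed
  ultimately show "generate G (x ` {1..n}) \<subseteq> word_value G x ` carrier (free_group n)"
    by (rule generate_subgroup_incl[rotated])
qed

end


section \<open>Lower central series and tuples killed by it\<close>

lemma lower_central_enat [simp]: "lower_central Q (enat i) = lower_central_fin Q i"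
  and lower_central_infinity [simp]: "lower_central Q \<infinity> = {\<one>\<^bsub>Q\<^esub>}"
  by (simp_all add: lower_central_def)

lemma one_le_enat_cases:
  assumes "1 \<le> (q :: enat)"
  obtains i where "q = enat (Suc i)" | "q = \<infinity>"
proof (cases q)
  case (enat m)
  with assms have "m \<noteq> 0" by (auto simp: one_enat_def)
  then show ?thesis using enat that by (cases m) auto
qed (use that in auto)

lemma (in group) conjugate_mult:
  assumes "g \<in> carrier G" "a \<in> carrier G" "b \<in> carrier G"
  shows "g \<otimes> (a \<otimes> b) \<otimes> inv g = (g \<otimes> a \<otimes> inv g) \<otimes> (g \<otimes> b \<otimes> inv g)"
proof -
  have "(g \<otimes> a \<otimes> inv g) \<otimes> (g \<otimes> b \<otimes> inv g) = g \<otimes> a \<otimes> (inv g \<otimes> g) \<otimes> b \<otimes> inv g"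
    using assms by (simp only: m_assoc m_closed inv_closed)
  then show ?thesis using assms by (simp add: m_assoc)
qed

lemma (in group) conjugate_inv:
  assumes "g \<in> carrier G" "a \<in> carrier G"
  shows "inv (g \<otimes> a \<otimes> inv g) = g \<otimes> inv a \<otimes> inv g"
  using assms by (simp add: inv_mult_group m_assoc)

lemma (in group) lower_central_fin_normal: "lower_central_fin G (Suc i) \<lhd> G"
proof (induction i)
  case 0
  show ?case by (simp add: normal_self)
next
  case (Suc i)
  let ?N = "lower_central_fin G (Suc i)"
  interpret N: normal ?N G by (rule Suc)
  have "generate G {x \<otimes> y \<otimes> inv x \<otimes> inv y | x y. x \<in> ?N \<and> y \<in> carrier G} \<lhd> G"
  proof (rule normal_generateI)
    show "{x \<otimes> y \<otimes> inv x \<otimes> inv y | x y. x \<in> ?N \<and> y \<in> carrier G} \<subseteq> carrier G"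
      using N.subset by blast
  next
    fix h g assume "h \<in> {x \<otimes> y \<otimes> inv x \<otimes> inv y | x y. x \<in> ?N \<and> y \<in> carrier G}" and g: "g \<in> carrier G"
    then obtain x y where xy: "x \<in> ?N" "y \<in> carrier G" "h = x \<otimes> y \<otimes> inv x \<otimes> inv y" by blast
    have x: "x \<in> carrier G" using xy(1) N.subset by blast
    have "g \<otimes> h \<otimes> inv g = (g \<otimes> x \<otimes> inv g) \<otimes> (g \<otimes> y \<otimes> inv g) \<otimes> inv (g \<otimes> x \<otimes> inv g) \<otimes> inv (g \<otimes> y \<otimes> inv g)"
      using x xy(2) g unfolding xy(3) by (simp add: conjugate_mult conjugate_inv)
    moreover have "g \<otimes> x \<otimes> inv g \<in> ?N" using xy(1) g by (rule N.inv_op_closed2[rotated])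
    ultimately show "g \<otimes> h \<otimes> inv g \<in> {x \<otimes> y \<otimes> inv x \<otimes> inv y | x y. x \<in> ?N \<and> y \<in> carrier G}"
      using g xy(2) by blast
  qed
  then show ?case by simp
qed

lemma (in group) lower_central_normal: "1 \<le> q \<Longrightarrow> lower_central G q \<lhd> G"
  by (erule one_le_enat_cases) (auto simp: one_is_normal intro: lower_central_fin_normal simp del: lower_central_fin.simps)

lemma (in group) lower_central_fin_Suc_subset:
  "lower_central_fin G (Suc (Suc i)) \<subseteq> lower_central_fin G (Suc i)"
proof -
  define N where "N = lower_central_fin G (Suc i)"
  interpret N: normal N G unfolding N_def by (rule lower_central_fin_normal)
  have "x \<otimes> y \<otimes> inv x \<otimes> inv y \<in> N" if "x \<in> N" "y \<in> carrier G" for x y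
  proof -
    have x: "x \<in> carrier G" using that(1) N.subset by blast
    have "x \<otimes> y \<otimes> inv x \<otimes> inv y = x \<otimes> (y \<otimes> inv x \<otimes> inv y)"
      using x that(2) by (simp add: m_assoc)
    moreover have "y \<otimes> inv x \<otimes> inv y \<in> N"
      using that by (intro N.inv_op_closed2 N.m_inv_closed)
    ultimately show ?thesis using that(1) N.m_closed by metis
  qed
  then have "{x \<otimes> y \<otimes> inv x \<otimes> inv y | x y. x \<in> N \<and> y \<in> carrier G} \<subseteq> N" by blast
  then have "generate G {x \<otimes> y \<otimes> inv x \<otimes> inv y | x y. x \<in> N \<and> y \<in> carrier G} \<subseteq> N"
    by (rule generate_subgroup_incl) (rule N.subgroup_axioms)
  then show ?thesis by (simp add: N_def)
qed

lemma (in group) lower_central_antimono: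
  assumes "1 \<le> q" "q \<le> r"
  shows "lower_central G r \<subseteq> lower_central G q"
proof -
  have 1: "1 \<le> r" using assms by order
  show ?thesis
  proof (cases r)
    case (enat m)
    then obtain k where k: "q = enat k" using assms(2) by (cases q) auto
    have km: "k \<le> m" "1 \<le> k" using assms k enat by (auto simp: one_enat_def)
    have "lower_central_fin G (Suc j) \<subseteq> lower_central_fin G (Suc i)" if "i \<le> j" for i j
      using that by (induction rule: dec_induct) (use lower_central_fin_Suc_subset in blast)+
    from this[of "k - 1" "m - 1"] show ?thesis using km k enat by (simp del: lower_central_fin.simps)
  next
    case infinity
    then show ?thesis
      using normal_imp_subgroup[OF lower_central_normal[OF assms(1)]] subgroup.one_closed by fastforce
  qed
qed

text \<open>
  Homomorphisms map commutators to commutators. Equality requires surjectivity, because the second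
  entry of a commutator ranges over the whole target group.
\<close>

lemma (in group_hom) lower_central_fin_image:
  "h ` lower_central_fin G i \<subseteq> lower_central_fin H i"
  "h ` carrier G = carrier H \<Longrightarrow> h ` lower_central_fin G i = lower_central_fin H i"
proof (induction i)
  case 0
  { case 1 show ?case by auto next case 2 then show ?case by simp }
next
  case (Suc i)
  let ?S = "\<lambda>i. {x \<otimes> y \<otimes> inv x \<otimes> inv y | x y. x \<in> lower_central_fin G i \<and> y \<in> carrier G}"
  let ?S' = "\<lambda>i. {x \<otimes>\<^bsub>H\<^esub> y \<otimes>\<^bsub>H\<^esub> inv\<^bsub>H\<^esub> x \<otimes>\<^bsub>H\<^esub> inv\<^bsub>H\<^esub> y | x y. x \<in> lower_central_fin H i \<and> y \<in> carrier H}"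
  have sub: "lower_central_fin G i \<subseteq> carrier G"
  proof (cases i)
    case (Suc j)
    then show ?thesis
      using normal_imp_subgroup[OF G.lower_central_fin_normal[of j]] subgroup.subset by blast
  qed simp
  then have S: "?S i \<subseteq> carrier G" by blast
  have comm: "h (x \<otimes> y \<otimes> inv x \<otimes> inv y) = h x \<otimes>\<^bsub>H\<^esub> h y \<otimes>\<^bsub>H\<^esub> inv\<^bsub>H\<^esub> h x \<otimes>\<^bsub>H\<^esub> inv\<^bsub>H\<^esub> h y"
    if "x \<in> lower_central_fin G i" "y \<in> carrier G" for x y
    using that sub by (simp add: subset_iff)
  have le: "h ` ?S i \<subseteq> ?S' i"
  proof clarify
    fix x y assume xy: "x \<in> lower_central_fin G i" "y \<in> carrier G"
    then show "\<exists>x' y'. h (x \<otimes> y \<otimes> inv x \<otimes> inv y) = x' \<otimes>\<^bsub>H\<^esub> y' \<otimes>\<^bsub>H\<^esub> inv\<^bsub>H\<^esub> x' \<otimes>\<^bsub>H\<^esub> inv\<^bsub>H\<^esub> y'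
        \<and> x' \<in> lower_central_fin H i \<and> y' \<in> carrier H"
      using Suc.IH(1) comm by (intro exI[of _ "h x"] exI[of _ "h y"]) auto
  qed
  show "h ` lower_central_fin G (Suc i) \<subseteq> lower_central_fin H (Suc i)"
    using H.mono_generate[OF le] generate_img[OF S] by auto
  assume surj: "h ` carrier G = carrier H"
  have "?S' i \<subseteq> h ` ?S i"
  proof clarify
    fix x' y' assume "x' \<in> lower_central_fin H i" "y' \<in> carrier H"
    then obtain x y where xy: "x \<in> lower_central_fin G i" "x' = h x" "y \<in> carrier G" "y' = h y"
      using Suc.IH(2)[OF surj] surj by blast
    then show "x' \<otimes>\<^bsub>H\<^esub> y' \<otimes>\<^bsub>H\<^esub> inv\<^bsub>H\<^esub> x' \<otimes>\<^bsub>H\<^esub> inv\<^bsub>H\<^esub> y' \<in> h ` ?S i"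
      using comm[OF xy(1,3)] by (intro image_eqI[of _ _ "x \<otimes> y \<otimes> inv x \<otimes> inv y"]) auto
  qed
  with le have "h ` ?S i = ?S' i" by blast
  then show "h ` lower_central_fin G (Suc i) = lower_central_fin H (Suc i)"
    using generate_img[OF S] surj by auto
qed

lemma (in group_hom) lower_central_image:
  "h ` lower_central G q \<subseteq> lower_central H q"
  "h ` carrier G = carrier H \<Longrightarrow> h ` lower_central G q = lower_central H q"
  using lower_central_fin_image by (cases q; simp)+

lemma group_homI: "\<lbrakk>group G; group H; h \<in> hom G H\<rbrakk> \<Longrightarrow> group_hom G H h"
  by (simp add: group_hom_def group_hom_axioms_def)

context group
begin

text \<open>
  In this form the space of homomorphisms is cut out by equations, which makes it closed.
\<close>

lemma hom_tuples_iff_word_value: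
  assumes "1 \<le> q"
  shows "x \<in> hom_tuples G q n \<longleftrightarrow>
    x \<in> {1..n} \<rightarrow>\<^sub>E carrier G \<and> (\<forall>w \<in> free_gamma n q. word_value G x w = \<one>)"
proof
  assume "x \<in> hom_tuples G q n"
  then obtain f where f: "f \<in> hom (free_group n) G" "\<forall>w\<in>free_gamma n q. f w = \<one>" "x = gen_images n f"
    by (auto simp: hom_tuples_def)
  have "free_gamma n q \<subseteq> carrier (free_group n)"
    using subgroup.subset[OF normal_imp_subgroup[OF group.lower_central_normal[OF group_free_group assms]]] .
  then show "x \<in> {1..n} \<rightarrow>\<^sub>E carrier G \<and> (\<forall>w \<in> free_gamma n q. word_value G x w = \<one>)"
    using f gen_images_in_PiE hom_free_group_eq_word_value[OF f(1)] by (metis subsetD)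
next
  assume x: "x \<in> {1..n} \<rightarrow>\<^sub>E carrier G \<and> (\<forall>w \<in> free_gamma n q. word_value G x w = \<one>)"
  then have x': "x \<in> {1..n} \<rightarrow> carrier G" by (auto simp: PiE_def)
  then show "x \<in> hom_tuples G q n"
    unfolding hom_tuples_def mem_Collect_eq
    using word_value_hom[OF x'] gen_images_word_value[of x n] x
    by (intro exI[of _ "word_value G x"]) auto
qed

text \<open>
  A homomorphism from the free group maps the lower central series onto that of its image, so
  being trivial on the \<open>q\<close>-th term is a condition on the subgroup generated by the tuple alone.
  All closure properties of the spaces of homomorphisms follow from this description.
\<close>

lemma hom_tuples_iff:
  assumes "1 \<le> q"
  shows "x \<in> hom_tuples G q n \<longleftrightarrow>
    x \<in> {1..n} \<rightarrow>\<^sub>E carrier G \<and> lower_central (subgroup_generated G (x ` {1..n})) q = {\<one>}"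
proof (cases "x \<in> {1..n} \<rightarrow>\<^sub>E carrier G")
  case True
  then have x: "x \<in> {1..n} \<rightarrow> carrier G" by (simp add: PiE_def)
  let ?K = "subgroup_generated G (x ` {1..n})"
  have K: "carrier ?K = generate G (x ` {1..n})"
    using x by (simp add: carrier_subgroup_generated Int_absorb1 image_subset_iff Pi_iff)
  have "word_value G x \<in> hom (free_group n) ?K"
    using word_value_hom[OF x] word_value_image[OF x] K by (auto simp: hom_def)
  then interpret f: group_hom "free_group n" ?K "word_value G x"
    by (intro group_homI group_free_group group_subgroup_generated)
  have "word_value G x ` free_gamma n q = lower_central ?K q"
    by (rule f.lower_central_image(2)) (use K word_value_image[OF x] in simp)
  moreover have "[] \<in> free_gamma n q"
    using subgroup.one_closed[OF normal_imp_subgroup[OF group.lower_central_normal[OF group_free_group assms]]]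
    by simp
  then have "(\<forall>w \<in> free_gamma n q. word_value G x w = \<one>) \<longleftrightarrow> word_value G x ` free_gamma n q = {\<one>}"
    by force
  ultimately show ?thesis using True hom_tuples_iff_word_value[OF assms] by simp
next
  case False
  then show ?thesis using hom_tuples_iff_word_value[OF assms] by blast
qed

lemma generate_into_generated:
  assumes "S \<subseteq> carrier G" "S' \<subseteq> generate G S" 
  shows "S' \<subseteq> carrier G" "generate G S' \<subseteq> generate G S"
  using assms generate_in_carrier[OF assms(1)]
  by (blast, intro generate_subgroup_incl generate_is_subgroup) 

lemma hom_tuples_subgroup:
  assumes "1 \<le> q" and x: "x \<in> hom_tuples G q n"
    and y: "y \<in> {1..m} \<rightarrow>\<^sub>E carrier G" "y ` {1..m} \<subseteq> generate G (x ` {1..n})"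
  shows "y \<in> hom_tuples G q m"
proof -
  let ?K = "subgroup_generated G (x ` {1..n})" and ?L = "subgroup_generated G (y ` {1..m})"
  have x': "x ` {1..n} \<subseteq> carrier G" and K: "lower_central ?K q = {\<one>}"
    using x hom_tuples_iff[OF assms(1)] by auto
  have y': "y ` {1..m} \<subseteq> carrier G" using y by auto
  have cs: "carrier ?L \<subseteq> carrier ?K"
    using generate_into_generated(2)[OF x' y(2)] x' y'
    by (simp add: carrier_subgroup_generated Int_absorb1)
  have "id \<in> hom ?L ?K" using cs by (auto simp: hom_def)
  then interpret i: group_hom ?L ?K id
    by (intro group_homI group_subgroup_generated)
  have "lower_central ?L q \<subseteq> {\<one>}" using i.lower_central_image(1)[of q] K by simp
  moreover have "\<one> \<in> lower_central ?L q"
    using subgroup.one_closed[OF normal_imp_subgroup[OF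
        group.lower_central_normal[OF group_subgroup_generated assms(1)]]] by simp
  ultimately show ?thesis using hom_tuples_iff[OF assms(1)] y(1) by blast
qed

lemma hom_tuples_mono:
  assumes "1 \<le> q" "q \<le> r"
  shows "hom_tuples G q n \<subseteq> hom_tuples G r n"
  using group.lower_central_antimono[OF group_free_group assms, of n] unfolding hom_tuples_def by blast

lemma hom_tuples_subset: "hom_tuples G q n \<subseteq> {1..n} \<rightarrow>\<^sub>E carrier G"
  unfolding hom_tuples_def using gen_images_in_PiE by blast

lemma hom_tuples_infinity: "hom_tuples G \<infinity> n = {1..n} \<rightarrow>\<^sub>E carrier G"
  using hom_tuples_iff[of \<infinity>] by auto

lemma hom_tuples_hom_image:
  assumes "1 \<le> q" "group H" "\<phi> \<in> hom G H" "x \<in> hom_tuples G q n"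
  shows "(\<lambda>k\<in>{1..n}. \<phi> (x k)) \<in> hom_tuples H q n"
proof -
  obtain f where f: "f \<in> hom (free_group n) G" "\<forall>w\<in>free_gamma n q. f w = \<one>" "x = gen_images n f"
    using assms(4) by (auto simp: hom_tuples_def)
  interpret \<phi>: group_hom G H \<phi> using assms by (intro group_homI is_group)
  have "(\<lambda>k\<in>{1..n}. \<phi> (x k)) = gen_images n (\<phi> \<circ> f)"
    by (auto simp: f(3) gen_images_def)
  moreover have "\<phi> \<circ> f \<in> hom (free_group n) H"
    using f(1) assms(3) by (auto simp: hom_def Pi_iff)
  moreover have "\<forall>w\<in>free_gamma n q. (\<phi> \<circ> f) w = \<one>\<^bsub>H\<^esub>"
    using f(2) by simp
  ultimately show ?thesis unfolding hom_tuples_def by blast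
qed

end


section \<open>Quotients of the free group\<close>

lemma (in group) r_coset_absorb:
  assumes "H \<lhd> G" "K \<lhd> G" "K \<subseteq> H" "w \<in> carrier G"
  shows "H <#> (K #> w) = H #> w"
proof -
  interpret H: normal H G by fact
  interpret K: normal K G by fact
  have "h \<otimes> (k \<otimes> w) \<in> H #> w" if "h \<in> H" "k \<in> K" for h k
  proof -
    have "h \<otimes> (k \<otimes> w) = (h \<otimes> k) \<otimes> w"
      using that assms(4) H.mem_carrier K.mem_carrier by (simp add: m_assoc)
    moreover have "h \<otimes> k \<in> H" using that assms(3) by (auto intro: H.m_closed)
    ultimately show ?thesis unfolding r_coset_def by blast
  qed
  then have "H <#> (K #> w) \<subseteq> H #> w"
    by (auto simp: set_mult_def r_coset_def[of _ K])
  moreover have "h \<otimes> w \<in> H <#> (K #> w)" if "h \<in> H" for h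
  proof -
    have "w \<in> K #> w" using rcos_self[OF assms(4) K.subgroup_axioms] .
    then show ?thesis using that unfolding set_mult_def by blast
  qed
  then have "H #> w \<subseteq> H <#> (K #> w)"
    by (auto simp: r_coset_def[of _ H])
  ultimately show ?thesis by (rule subset_antisym)
qed

lemma free_surj_proj:
  assumes "1 \<le> q" "q \<le> r" "w \<in> carrier (free_group n)"
  shows "free_surj n r q (free_proj n r w) = free_proj n q w"
proof -
  interpret F: group "free_group n" by (rule group_free_group)
  have "1 \<le> r" using assms by order
  then show ?thesis
    unfolding free_surj_def free_proj_def using assms
    by (intro F.r_coset_absorb F.lower_central_normal F.lower_central_antimono)
qed

lemma free_surj_epi:
  assumes "1 \<le> q" "q \<le> r"
  shows "free_surj n r q \<in> epi (free_quotient n r) (free_quotient n q)"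
proof -
  interpret F: group "free_group n" by (rule group_free_group)
  have r: "1 \<le> r" using assms by order
  interpret R: normal "free_gamma n r" "free_group n" by (rule F.lower_central_normal[OF r])
  interpret Q: normal "free_gamma n q" "free_group n" by (rule F.lower_central_normal[OF assms(1)])
  have c: "carrier (free_quotient n s) = free_proj n s ` carrier (free_group n)" for s
    by (auto simp: carrier_FactGroup free_proj_def)
  have "free_surj n r q \<in> hom (free_quotient n r) (free_quotient n q)"
  proof (rule homI)
    fix C assume "C \<in> carrier (free_quotient n r)"
    then show "free_surj n r q C \<in> carrier (free_quotient n q)"
      using free_surj_proj[OF assms] c by auto
  next
    fix C D assume "C \<in> carrier (free_quotient n r)" "D \<in> carrier (free_quotient n r)"
    then obtain v w where vw: "v \<in> carrier (free_group n)" "w \<in> carrier (free_group n)"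
        "C = free_proj n r v" "D = free_proj n r w"
      using c by auto
    have "C \<otimes>\<^bsub>free_quotient n r\<^esub> D = free_proj n r (v \<otimes>\<^bsub>free_group n\<^esub> w)"
      using R.rcos_sum[OF vw(1,2)] vw by (simp add: free_proj_def)
    then have "free_surj n r q (C \<otimes>\<^bsub>free_quotient n r\<^esub> D) = free_proj n q (v \<otimes>\<^bsub>free_group n\<^esub> w)"
      using free_surj_proj[OF assms F.m_closed[OF vw(1,2)]] by simp
    also have "\<dots> = free_proj n q v \<otimes>\<^bsub>free_quotient n q\<^esub> free_proj n q w"
      using Q.rcos_sum[OF vw(1,2)] by (simp add: free_proj_def)
    finally show "free_surj n r q (C \<otimes>\<^bsub>free_quotient n r\<^esub> D) =
        free_surj n r q C \<otimes>\<^bsub>free_quotient n q\<^esub> free_surj n r q D"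
      using free_surj_proj[OF assms] vw by simp
  qed
  moreover have "free_surj n r q ` carrier (free_quotient n r) = carrier (free_quotient n q)"
    using free_surj_proj[OF assms] unfolding c by (force simp: image_iff)
  ultimately show ?thesis by (simp add: epi_def)
qed

lemma (in group) hom_tuples_factor:
  assumes "1 \<le> q" "x \<in> hom_tuples G q n"
  shows "\<exists>f \<in> hom (free_quotient n q) G. gen_images n (f \<circ> free_proj n q) = x"
proof -
  interpret F: group "free_group n" by (rule group_free_group)
  obtain h where h: "h \<in> hom (free_group n) G" "\<forall>w\<in>free_gamma n q. h w = \<one>" "x = gen_images n h"
    using assms(2) by (auto simp: hom_tuples_def)
  interpret h: group_hom "free_group n" G h by (intro group_homI h F.is_group is_group)
  have N: "free_gamma n q \<lhd> free_group n" by (rule F.lower_central_normal[OF assms(1)])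
  have "h v = h w" if vw: "v \<in> carrier (free_group n)" "w \<in> carrier (free_group n)"
    "free_gamma n q #>\<^bsub>free_group n\<^esub> v = free_gamma n q #>\<^bsub>free_group n\<^esub> w" for v w
  proof -
    have "v \<in> free_gamma n q #>\<^bsub>free_group n\<^esub> w"
      using vw F.rcos_self[OF vw(1) normal_imp_subgroup[OF N]] by simp
    then obtain k where k: "k \<in> free_gamma n q" "v = k \<otimes>\<^bsub>free_group n\<^esub> w"
      by (auto simp: r_coset_def)
    then have "h v = h k \<otimes> h w"
      using vw(2) subgroup.subset[OF normal_imp_subgroup[OF N]] h.hom_mult by blast
    then show ?thesis using h(2) k(1) vw(2) by simp
  qed
  from FactGroup_universal[OF h(1) N this]
  obtain g where g: "g \<in> hom (free_quotient n q) G"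
    "\<And>w. w \<in> carrier (free_group n) \<Longrightarrow> g (free_gamma n q #>\<^bsub>free_group n\<^esub> w) = h w"
    by blast
  have "gen_images n (g \<circ> free_proj n q) = x"
    using g(2) generator_in_free_group by (auto simp: gen_images_def h(3) free_proj_def)
  with g(1) show ?thesis by blast
qed

lemma gen_images_free_surj:
  assumes "1 \<le> q" "q \<le> r"
  shows "gen_images n (f \<circ> free_surj n r q \<circ> free_proj n r) = gen_images n (f \<circ> free_proj n q)"
  using free_surj_proj[OF assms generator_in_free_group, of _ n True]
  by (auto simp: gen_images_def)

text \<open>
  A homomorphism and its composite with the natural surjection have the same values on generators,
  so in coordinates the maps of the filtration are inclusions.
\<close>

lemma (in group) b_simp_eq:
  assumes "1 \<le> q" "q \<le> r" "x \<in> hom_tuples G q n"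
  shows "b_simp G q r n x = x"
proof -
  define f where "f = (SOME f. f \<in> hom (free_quotient n q) G \<and> gen_images n (f \<circ> free_proj n q) = x)"
  have "f \<in> hom (free_quotient n q) G \<and> gen_images n (f \<circ> free_proj n q) = x"
    using someI_ex[OF hom_tuples_factor[OF assms(1,3), unfolded Bex_def]] unfolding f_def .
  then have "gen_images n (f \<circ> free_surj n r q \<circ> free_proj n r) = x"
    unfolding gen_images_free_surj[OF assms(1,2)] by (rule conjunct2)
  then show ?thesis unfolding b_simp_def Let_def f_def[symmetric] .
qed

section \<open>Geometric realization as a quotient\<close>

abbreviation simplex_space :: "nat \<Rightarrow> (nat \<Rightarrow> real) topology" where
  "simplex_space n \<equiv> subtopology (powertop_real UNIV) (standard_simplex n)"

abbreviation cell :: "'x simplicial_data \<Rightarrow> nat \<Rightarrow> ('x \<times> (nat \<Rightarrow> real)) topology" where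
  "cell X n \<equiv> prod_topology (level X n) (simplex_space n)"

abbreviation glue_class :: "'x simplicial_data \<Rightarrow> 'x simplex_point \<Rightarrow> 'x simplex_point set" where
  "glue_class X a \<equiv> glue_rel X `` {a}"

abbreviation map_point :: "(nat \<Rightarrow> 'x \<Rightarrow> 'y) \<Rightarrow> 'x simplex_point \<Rightarrow> 'y simplex_point" where
  "map_point f \<equiv> \<lambda>(n, x, t). (n, f n x, t)"

lemma topspace_prerealization:
  "topspace (prerealization X) = {(n, x, t). x \<in> topspace (level X n) \<and> t \<in> standard_simplex n}"
  by (auto simp: prerealization_def)

lemma openin_prerealization:
  "openin (prerealization X) U \<longleftrightarrow>
    U \<subseteq> topspace (prerealization X) \<and> (\<forall>n. openin (cell X n) {y. (n, y) \<in> U})"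
  unfolding prerealization_def openin_sum_topology by simp

lemma closedin_prerealization:
  "closedin (prerealization X) U \<longleftrightarrow>
    U \<subseteq> topspace (prerealization X) \<and> (\<forall>n. closedin (cell X n) {y. (n, y) \<in> U})"
  unfolding prerealization_def closedin_sum_topology by simp

lemma continuous_map_prerealization:
  "continuous_map (prerealization X) Z f \<longleftrightarrow> (\<forall>n. continuous_map (cell X n) Z (\<lambda>y. f (n, y)))"
proof
  assume f: "continuous_map (prerealization X) Z f"
  show "\<forall>n. continuous_map (cell X n) Z (\<lambda>y. f (n, y))"
  proof
    fix n
    have "continuous_map (cell X n) (prerealization X) (\<lambda>y. (n, y))"
      unfolding prerealization_def by (rule continuous_map_component_injection) simp
    from continuous_map_compose[OF this f] show "continuous_map (cell X n) Z (\<lambda>y. f (n, y))"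
      by (simp add: o_def)
  qed
next
  assume f: "\<forall>n. continuous_map (cell X n) Z (\<lambda>y. f (n, y))"
  show "continuous_map (prerealization X) Z f"
    unfolding continuous_map_def
  proof (intro conjI allI impI)
    show "f \<in> topspace (prerealization X) \<rightarrow> topspace Z"
      using f by (force simp: topspace_prerealization continuous_map_def)
  next
    fix U assume U: "openin Z U"
    have "openin (cell X n) {y. (n, y) \<in> {a \<in> topspace (prerealization X). f a \<in> U}}" for n
    proof -
      have "openin (cell X n) {y \<in> topspace (cell X n). f (n, y) \<in> U}"
        using f U openin_continuous_map_preimage by blast
      also have "{y \<in> topspace (cell X n). f (n, y) \<in> U} =
          {y. (n, y) \<in> {a \<in> topspace (prerealization X). f a \<in> U}}"
        by (auto simp: topspace_prerealization)
      finally show ?thesis .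
    qed
    then show "openin (prerealization X) {a \<in> topspace (prerealization X). f a \<in> U}"
      unfolding openin_prerealization by blast
  qed
qed

lemma equiv_glue_rel: "equiv (topspace (prerealization X)) (glue_rel X)"
proof (rule equivI)
  show "glue_rel X \<subseteq> topspace (prerealization X) \<times> topspace (prerealization X)"
    by (auto simp: glue_rel_def)
  show "refl_on (topspace (prerealization X)) (glue_rel X)"
    by (auto simp: refl_on_def glue_rel_def)
  show "sym (glue_rel X)"
    by (auto simp: sym_def glue_rel_def intro: equivclp_sym)
  show "trans (glue_rel X)"
    by (auto simp: trans_def glue_rel_def intro: equivclp_trans)
qed

lemma glue_class_eq_iff:
  assumes "a \<in> topspace (prerealization X)" "b \<in> topspace (prerealization X)"
  shows "glue_class X a = glue_class X b \<longleftrightarrow> equivclp (glue X) a b"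
  using eq_equiv_class_iff[OF equiv_glue_rel assms] assms by (simp add: glue_rel_def)

lemma openin_realization:
  "openin (realization X) U \<longleftrightarrow>
    U \<subseteq> topspace (prerealization X) // glue_rel X \<and>
    openin (prerealization X) {a \<in> topspace (prerealization X). glue_class X a \<in> U}"
proof -
  have "istopology (\<lambda>U. U \<subseteq> topspace (prerealization X) // glue_rel X \<and>
    openin (prerealization X) {a \<in> topspace (prerealization X). glue_class X a \<in> U})"
    (is "istopology ?L")
    unfolding istopology_def
  proof (intro conjI allI impI)
    fix S T assume S: "?L S" and T: "?L T"
    show "S \<inter> T \<subseteq> topspace (prerealization X) // glue_rel X"
      using S by (rule le_infI1[OF conjunct1])
    have eq: "{a \<in> topspace (prerealization X). glue_class X a \<in> S \<inter> T} =
      {a \<in> topspace (prerealization X). glue_class X a \<in> S} \<inter>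
      {a \<in> topspace (prerealization X). glue_class X a \<in> T}" by blast
    show "openin (prerealization X) {a \<in> topspace (prerealization X). glue_class X a \<in> S \<inter> T}"
      unfolding eq by (rule openin_Int[OF conjunct2[OF S] conjunct2[OF T]])
  next
    fix K assume K: "\<forall>S\<in>K. ?L S"
    show "\<Union>K \<subseteq> topspace (prerealization X) // glue_rel X"
      by (rule Union_least) (rule conjunct1[OF K[rule_format]])
    have "{a \<in> topspace (prerealization X). glue_class X a \<in> \<Union>K} =
      (\<Union>S\<in>K. {a \<in> topspace (prerealization X). glue_class X a \<in> S})" by auto
    moreover have "openin (prerealization X) (\<Union>S\<in>K. {a \<in> topspace (prerealization X). glue_class X a \<in> S})"
    proof (rule openin_Union)
      fix V assume "V \<in> (\<lambda>S. {a \<in> topspace (prerealization X). glue_class X a \<in> S}) ` K"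
      then obtain S where S: "S \<in> K"
        "V = {a \<in> topspace (prerealization X). glue_class X a \<in> S}" by (rule imageE)
      show "openin (prerealization X) V"
        unfolding S(2) by (rule conjunct2[OF K[rule_format, OF S(1)]])
    qed
    ultimately show "openin (prerealization X) {a \<in> topspace (prerealization X). glue_class X a \<in> \<Union>K}"
      by simp
  qed
  then show ?thesis by (simp add: realization_def)
qed

lemma quotient_glue_rel:
  "topspace (prerealization X) // glue_rel X = glue_class X ` topspace (prerealization X)"
  unfolding quotient_def by (rule UNION_singleton_eq_range)

lemma topspace_realization:
  "topspace (realization X) = glue_class X ` topspace (prerealization X)"
proof -
  note q = quotient_glue_rel[of X]
  have "{a \<in> topspace (prerealization X). glue_class X a \<in> topspace (prerealization X) // glue_rel X} =
      topspace (prerealization X)" using q by blast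
  then have "openin (realization X) (topspace (prerealization X) // glue_rel X)"
    unfolding openin_realization by simp
  then have "topspace (prerealization X) // glue_rel X \<subseteq> topspace (realization X)"
    by (rule openin_subset)
  moreover have "topspace (realization X) \<subseteq> topspace (prerealization X) // glue_rel X"
    using openin_realization openin_topspace by blast
  ultimately show ?thesis using q by simp
qed

lemma quotient_map_glue_class: "quotient_map (prerealization X) (realization X) (glue_class X)"
  unfolding quotient_map_def
proof (intro conjI allI impI)
  show "glue_class X ` topspace (prerealization X) = topspace (realization X)"
    by (simp add: topspace_realization)
next
  fix U assume "U \<subseteq> topspace (realization X)"
  then show "openin (prerealization X) {a \<in> topspace (prerealization X). glue_class X a \<in> U} =
      openin (realization X) U"
    by (simp add: openin_realization topspace_realization quotient_glue_rel)
qed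

lemma glue_class_in_realization:
  "a \<in> topspace (prerealization X) \<Longrightarrow> glue_class X a \<in> topspace (realization X)"
  by (simp add: topspace_realization)

lemma realization_cases:
  assumes "c \<in> topspace (realization X)"
  obtains n x t where "x \<in> topspace (level X n)" "t \<in> standard_simplex n" "c = glue_class X (n, x, t)"
  using assms by (auto simp: topspace_realization topspace_prerealization)

lemma openin_realization_cells:
  assumes "U \<subseteq> topspace (realization X)"
  shows "openin (realization X) U \<longleftrightarrow>
    (\<forall>n. openin (cell X n) {y \<in> topspace (cell X n). glue_class X (n, y) \<in> U})"
proof -
  have eq: "{y. (n, y) \<in> {a \<in> topspace (prerealization X). glue_class X a \<in> U}} =
      {y \<in> topspace (cell X n). glue_class X (n, y) \<in> U}" for n
    by (auto simp: topspace_prerealization)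
  have "openin (realization X) U \<longleftrightarrow>
    openin (prerealization X) {a \<in> topspace (prerealization X). glue_class X a \<in> U}"
    using quotient_map_glue_class[of X] assms by (simp add: quotient_map_def)
  also have "\<dots> \<longleftrightarrow> (\<forall>n. openin (cell X n) {y \<in> topspace (cell X n). glue_class X (n, y) \<in> U})"
    unfolding openin_prerealization eq by blast
  finally show ?thesis .
qed

lemma closedin_realization_cells:
  assumes "U \<subseteq> topspace (realization X)"
  shows "closedin (realization X) U \<longleftrightarrow>
    (\<forall>n. closedin (cell X n) {y \<in> topspace (cell X n). glue_class X (n, y) \<in> U})"
proof -
  have eq: "{y. (n, y) \<in> {a \<in> topspace (prerealization X). glue_class X a \<in> U}} =
      {y \<in> topspace (cell X n). glue_class X (n, y) \<in> U}" for n
    by (auto simp: topspace_prerealization)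
  have "closedin (realization X) U \<longleftrightarrow>
    closedin (prerealization X) {a \<in> topspace (prerealization X). glue_class X a \<in> U}"
    using quotient_map_glue_class[of X] assms by (simp add: quotient_map_closedin)
  also have "\<dots> \<longleftrightarrow> (\<forall>n. closedin (cell X n) {y \<in> topspace (cell X n). glue_class X (n, y) \<in> U})"
    unfolding closedin_prerealization eq by blast
  finally show ?thesis .
qed

lemma continuous_map_glue_class_cell:
  "continuous_map (cell X n) (realization X) (\<lambda>y. glue_class X (n, y))"
  using quotient_imp_continuous_map[OF quotient_map_glue_class[of X]]
  unfolding continuous_map_prerealization by blast

lemma continuous_map_realization:
  "continuous_map (realization X) Z g \<longleftrightarrow>
    (\<forall>n. continuous_map (cell X n) Z (\<lambda>y. g (glue_class X (n, y))))"
  using continuous_compose_quotient_map_eq[OF quotient_map_glue_class[of X], of Z g]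
  by (simp add: continuous_map_prerealization o_def)

lemma simplicial_mapD:
  assumes "simplicial_map X Y f"
  shows "simplicial_space X" "simplicial_space Y" "continuous_map (level X n) (level Y n) (f n)"
    "\<lbrakk>1 \<le> n; i \<le> n; x \<in> topspace (level X n)\<rbrakk> \<Longrightarrow> f (n - 1) (face X n i x) = face Y n i (f n x)"
    "\<lbrakk>i \<le> n; x \<in> topspace (level X n)\<rbrakk> \<Longrightarrow> f (n + 1) (degen X n i x) = degen Y n i (f n x)"
    "x \<in> topspace (level X n) \<Longrightarrow> f n x \<in> topspace (level Y n)"
proof -
  show "continuous_map (level X n) (level Y n) (f n)" 
    using assms unfolding simplicial_map_def by blast
  then show "x \<in> topspace (level X n) \<Longrightarrow> f n x \<in> topspace (level Y n)"
    by (auto simp: continuous_map_def)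
qed (use assms in \<open>unfold simplicial_map_def, blast+\<close>)

lemma map_point_in_prerealization:
  "\<lbrakk>simplicial_map X Y f; a \<in> topspace (prerealization X)\<rbrakk>
    \<Longrightarrow> map_point f a \<in> topspace (prerealization Y)"
  using simplicial_mapD(6) by (fastforce simp: topspace_prerealization)

lemma glue_map_point:
  assumes f: "simplicial_map X Y f" and "glue X a b"
  shows "glue Y (map_point f a) (map_point f b)"
  using assms(2)
proof cases
  case (face n i x t)
  show ?thesis
    using glue.face[OF face(3,4) simplicial_mapD(6)[OF f face(5)] face(6)] simplicial_mapD(4)[OF f face(3-5)]
    by (simp add: face(1,2))
next
  case (degen j n x t)
  show ?thesis
    using glue.degen[OF degen(3) simplicial_mapD(6)[OF f degen(4)] degen(5)] simplicial_mapD(5)[OF f degen(3,4)]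
    by (simp add: degen(1,2))
qed

lemma equivclp_map:
  assumes "\<And>a b. r a b \<Longrightarrow> s (F a) (F b)" "equivclp r a b"
  shows "equivclp s (F a) (F b)"
  using assms(2) unfolding equivclp_def
proof (induction rule: rtranclp_induct)
  case (step b c)
  then have "symclp s (F b) (F c)" using assms(1) by (auto simp: symclp_def)
  then show ?case using step.IH by (rule rtranclp.rtrancl_into_rtrancl[rotated])
qed simp

lemma equivclp_invariant:
  assumes "\<And>a b. r a b \<Longrightarrow> F a = F b" "equivclp r a b"
  shows "F a = F b"
proof -
  have "equivclp (=) (F a) (F b)" using assms by (intro equivclp_map[of r "(=)"])
  then show ?thesis unfolding equivclp_def
    by (induction rule: rtranclp_induct) (auto simp: symclp_def)
qed

lemma realization_map_glue_class:
  assumes f: "simplicial_map X Y f" and a: "a \<in> topspace (prerealization X)"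
  shows "realization_map X Y f (glue_class X a) = glue_class Y (map_point f a)"
proof -
  have "glue_class Y (map_point f b) = glue_class Y (map_point f a)" if "b \<in> glue_class X a" for b
  proof -
    have b: "b \<in> topspace (prerealization X)" "equivclp (glue X) a b"
      using that by (auto simp: glue_rel_def)
    have "equivclp (glue Y) (map_point f a) (map_point f b)"
      using b(2) by (rule equivclp_map[where F = "map_point f", rotated]) (rule glue_map_point[OF f])
    then show ?thesis
      using glue_class_eq_iff[OF map_point_in_prerealization[OF f a] map_point_in_prerealization[OF f b(1)]]
      by simp
  qed
  moreover have "a \<in> glue_class X a" using a by (simp add: glue_rel_def)
  ultimately have "(\<Union>b\<in>glue_class X a. glue_class Y (map_point f b)) = glue_class Y (map_point f a)"
    by blast
  moreover have "(\<Union>(n, x, t)\<in>glue_class X a. glue_class Y (n, f n x, t)) =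
      (\<Union>b\<in>glue_class X a. glue_class Y (map_point f b))"
    by (simp add: case_prod_unfold)
  ultimately show ?thesis
    using glue_class_in_realization[OF a] by (simp add: realization_map_def)
qed

lemma realization_map_glue_class':
  assumes "simplicial_map X Y f" "x \<in> topspace (level X n)" "t \<in> standard_simplex n"
  shows "realization_map X Y f (glue_class X (n, x, t)) = glue_class Y (n, f n x, t)"
  using realization_map_glue_class[OF assms(1), of "(n, x, t)"] assms(2,3)
  by (simp add: topspace_prerealization)

lemma continuous_realization_map:
  assumes f: "simplicial_map X Y f"
  shows "continuous_map (realization X) (realization Y) (realization_map X Y f)"
  unfolding continuous_map_realization
proof
  fix n
  have "continuous_map (cell X n) (cell Y n) (\<lambda>y. (f n (fst y), snd y))"
    by (intro continuous_map_pairedI continuous_map_snd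
          continuous_map_compose[OF continuous_map_fst simplicial_mapD(3)[OF f], unfolded o_def])
  from continuous_map_compose[OF this continuous_map_glue_class_cell[of Y n]]
  have "continuous_map (cell X n) (realization Y) (\<lambda>y. glue_class Y (n, f n (fst y), snd y))"
    by (simp add: o_def)
  then show "continuous_map (cell X n) (realization Y) (\<lambda>y. realization_map X Y f (glue_class X (n, y)))"
    by (rule continuous_map_eq) (auto simp: realization_map_glue_class'[OF f])
qed

lemma realization_map_in:
  "\<lbrakk>simplicial_map X Y f; c \<in> topspace (realization X)\<rbrakk>
    \<Longrightarrow> realization_map X Y f c \<in> topspace (realization Y)"
  using continuous_realization_map by (fastforce simp: continuous_map_def)

lemma realization_map_compose:
  assumes "simplicial_map X Y f" "simplicial_map Y Z g" "simplicial_map X Z h"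
    "\<And>n x. x \<in> topspace (level X n) \<Longrightarrow> h n x = g n (f n x)" "c \<in> topspace (realization X)"
  shows "realization_map Y Z g (realization_map X Y f c) = realization_map X Z h c"
  using assms(5)
  by (rule realization_cases)
     (simp add: realization_map_glue_class'[OF assms(1)] realization_map_glue_class'[OF assms(2)]
        realization_map_glue_class'[OF assms(3)] simplicial_mapD(6)[OF assms(1)] assms(4))

text \<open>
  All compatibilities between the maps of realizations come in this way from identities of tuples.
\<close>

lemma realization_map_square:
  assumes "simplicial_map X Y f" "simplicial_map Y Z g" "simplicial_map X Y' f'" "simplicial_map Y' Z g'"
    "\<And>n x. x \<in> topspace (level X n) \<Longrightarrow> g n (f n x) = g' n (f' n x)" "c \<in> topspace (realization X)"
  shows "realization_map Y Z g (realization_map X Y f c) = realization_map Y' Z g' (realization_map X Y' f' c)"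
  using assms(6)
  by (rule realization_cases)
     (simp add: realization_map_glue_class'[OF assms(1)] realization_map_glue_class'[OF assms(2)]
        realization_map_glue_class'[OF assms(3)] realization_map_glue_class'[OF assms(4)]
        simplicial_mapD(6)[OF assms(1)] simplicial_mapD(6)[OF assms(3)] assms(5))

lemma realization_map_ident:
  assumes "simplicial_map X X f" "\<And>n x. x \<in> topspace (level X n) \<Longrightarrow> f n x = x"
    "c \<in> topspace (realization X)"
  shows "realization_map X X f c = c"
  using assms(3)
  by (rule realization_cases) (simp add: realization_map_glue_class'[OF assms(1)] assms(2))

lemma simplical_face_in_simplex:
  "\<lbrakk>1 \<le> n; i \<le> n; t \<in> standard_simplex (n - 1)\<rbrakk> \<Longrightarrow> simplical_face i t \<in> standard_simplex n"
  using simplical_face_in_standard_simplex[of n i t] by simp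

section \<open>The bar constructions\<close>

text \<open>
  The spaces E and B are the cases \<open>l = 0\<close> and \<open>l = 1\<close> of one simplicial space, of tuples indexed by
  \<open>{l..n}\<close> whose entries with positive index form a homomorphism.
\<close>

definition bar_tuples :: "('a, 'm) monoid_scheme \<Rightarrow> nat \<Rightarrow> enat \<Rightarrow> nat \<Rightarrow> (nat \<Rightarrow> 'a) set" where
  "bar_tuples G l q n = {x \<in> {l..n} \<rightarrow>\<^sub>E carrier G. restrict x {1..n} \<in> hom_tuples G q n}"

definition bar_simp ::
  "('a, 'm) monoid_scheme \<Rightarrow> 'a topology \<Rightarrow> nat \<Rightarrow> enat \<Rightarrow> (nat \<Rightarrow> 'a) simplicial_data" where
  "bar_simp G T l q =
     \<lparr>level = (\<lambda>n. subtopology (product_topology (\<lambda>_. T) {l..n}) (bar_tuples G l q n)),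
      face = bar_face G l, degen = bar_degen G l\<rparr>"

lemma bar_simp_simps [simp]:
  "level (bar_simp G T l q) n = subtopology (product_topology (\<lambda>_. T) {l..n}) (bar_tuples G l q n)"
  "face (bar_simp G T l q) = bar_face G l"
  "degen (bar_simp G T l q) = bar_degen G l"
  by (simp_all add: bar_simp_def)

lemma E_simp_eq_bar_simp: "E_simp G T q = bar_simp G T 0 q"
  by (simp add: E_simp_def bar_simp_def bar_tuples_def)

lemma (in group) bar_tuples_one: "bar_tuples G 1 q n = hom_tuples G q n"
proof -
  have "restrict x {1..n} = x" if "x \<in> {1..n} \<rightarrow>\<^sub>E carrier G" for x
    using that by (simp add: PiE_def extensional_restrict)
  then show ?thesis
    using hom_tuples_subset[of q n] unfolding bar_tuples_def by (auto simp del: One_nat_def)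
qed

lemma (in group) B_simp_eq_bar_simp: "B_simp G T q = bar_simp G T 1 q"
  by (simp only: B_simp_def bar_simp_def bar_tuples_one)

lemma bar_tuples_closed: "\<lbrakk>x \<in> bar_tuples G l q n; l \<le> k; k \<le> n\<rbrakk> \<Longrightarrow> x k \<in> carrier G"
  by (auto simp: bar_tuples_def)

lemma bar_tuples_arb: "\<lbrakk>x \<in> bar_tuples G l q n; \<not> (l \<le> k \<and> k \<le> n)\<rbrakk> \<Longrightarrow> x k = undefined"
  by (auto simp: bar_tuples_def PiE_def extensional_def)

lemma bar_tuples_eqI:
  assumes "x \<in> bar_tuples G l q n" "y \<in> bar_tuples G l r n" "\<And>k. \<lbrakk>l \<le> k; k \<le> n\<rbrakk> \<Longrightarrow> x k = y k"
  shows "x = y"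
  using assms bar_tuples_arb[OF assms(1)] bar_tuples_arb[OF assms(2)] by (metis ext)

lemma (in group) bar_tuples_subgroup:
  assumes "1 \<le> q" "l \<le> 1" "x \<in> bar_tuples G l q n"
    "y \<in> {l'..m} \<rightarrow>\<^sub>E carrier G" "y ` {1..m} \<subseteq> generate G (x ` {1..n})" "l' \<le> 1"
  shows "y \<in> bar_tuples G l' q m"
proof -
  have "restrict y {1..m} \<in> hom_tuples G q m"
  proof (rule hom_tuples_subgroup[OF assms(1)])
    show "restrict x {1..n} \<in> hom_tuples G q n" using assms(3) by (simp add: bar_tuples_def)
    show "restrict y {1..m} \<in> {1..m} \<rightarrow>\<^sub>E carrier G"
      using PiE_mem[OF assms(4)] assms(6) by (auto simp: restrict_PiE_iff)
    show "restrict y {1..m} ` {1..m} \<subseteq> generate G (restrict x {1..n} ` {1..n})"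
      using assms(5) by (simp add: image_restrict_eq)
  qed
  then show ?thesis using assms(4) by (simp add: bar_tuples_def)
qed

lemma (in group) bar_tuples_mono:
  assumes "1 \<le> q" "q \<le> r"
  shows "bar_tuples G l q n \<subseteq> bar_tuples G l r n"
  using hom_tuples_mono[OF assms] by (auto simp: bar_tuples_def)

lemma (in group) bar_tuples_infinity:
  assumes "l \<le> 1" shows "bar_tuples G l \<infinity> n = {l..n} \<rightarrow>\<^sub>E carrier G"
proof -
  have "restrict x {1..n} \<in> {1..n} \<rightarrow>\<^sub>E carrier G" if "x \<in> {l..n} \<rightarrow>\<^sub>E carrier G" for x
    using PiE_mem[OF that] assms by (auto simp: restrict_PiE_iff)
  then show ?thesis by (auto simp: bar_tuples_def hom_tuples_infinity)
qed

context topological_group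
begin

lemma topspace_bar [simp]:
  "topspace (subtopology (product_topology (\<lambda>_. T) {l..n}) (bar_tuples G l q n)) = bar_tuples G l q n"
  by (auto simp: topspace_eq bar_tuples_def)

lemma bar_face_in_tuples:
  assumes q: "1 \<le> q" and l: "l \<le> 1" and n: "1 \<le> n" "i \<le> n" and x: "x \<in> bar_tuples G l q n"
  shows "bar_face G l n i x \<in> bar_tuples G l q (n - 1)"
proof (rule bar_tuples_subgroup[OF q l x _ _ l])
  have e: "{l..<n} = {l..n - 1}" using n by auto
  have c: "x k \<in> carrier G" if "l \<le> k" "k \<le> n" for k using bar_tuples_closed[OF x that] .
  show "bar_face G l n i x \<in> {l..n - 1} \<rightarrow>\<^sub>E carrier G"
    unfolding bar_face_def e[symmetric] using n by (auto simp: restrict_PiE_iff intro!: c m_closed)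
  have g: "x k \<in> generate G (x ` {1..n})" if "1 \<le> k" "k \<le> n" for k
    using that by (intro generate.incl) auto
  have "bar_face G l n i x k \<in> generate G (x ` {1..n})" if "k \<in> {1..n - 1}" for k
    using g[of k] g[of "k + 1"] that n l generate.eng[of "x k" G "x ` {1..n}" "x (k + 1)"]
    by (auto simp: bar_face_def)
  then show "bar_face G l n i x ` {1..n - 1} \<subseteq> generate G (x ` {1..n})" by blast
qed

lemma bar_degen_in_tuples:
  assumes q: "1 \<le> q" and l: "l \<le> 1" and n: "j \<le> n" and x: "x \<in> bar_tuples G l q n"
  shows "bar_degen G l n j x \<in> bar_tuples G l q (n + 1)"
proof (rule bar_tuples_subgroup[OF q l x _ _ l])
  have c: "x k \<in> carrier G" if "l \<le> k" "k \<le> n" for k using bar_tuples_closed[OF x that] .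
  show "bar_degen G l n j x \<in> {l..n + 1} \<rightarrow>\<^sub>E carrier G"
    unfolding bar_degen_def using n l by (auto simp: restrict_PiE_iff intro!: c)
  have g: "x k \<in> generate G (x ` {1..n})" if "1 \<le> k" "k \<le> n" for k
    using that by (intro generate.incl) auto
  have "bar_degen G l n j x k \<in> generate G (x ` {1..n})" if "k \<in> {1..n + 1}" for k
    using g[of k] g[of "k - 1"] that n l generate.one by (auto simp: bar_degen_def)
  then show "bar_degen G l n j x ` {1..n + 1} \<subseteq> generate G (x ` {1..n})" by blast
qed

lemma continuous_map_mult_pointwise:
  "\<lbrakk>continuous_map X T f; continuous_map X T g\<rbrakk> \<Longrightarrow> continuous_map X T (\<lambda>x. f x \<otimes> g x)"
  using continuous_map_compose[OF continuous_map_pairedI continuous_mult, of X f g]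
  by (simp add: o_def)

lemma continuous_map_inv_pointwise:
  "continuous_map X T f \<Longrightarrow> continuous_map X T (\<lambda>x. inv f x)"
  using continuous_map_compose[OF _ continuous_inv, of X f] by (simp add: o_def)

lemma continuous_map_coordinate:
  "\<lbrakk>l \<le> k; k \<le> n\<rbrakk> \<Longrightarrow>
    continuous_map (subtopology (product_topology (\<lambda>_. T) {l..n}) S) T (\<lambda>x. x k)"
  by (intro continuous_map_from_subtopology continuous_map_product_projection) auto

lemma continuous_map_into_bar:
  assumes "\<And>y. y \<in> topspace X \<Longrightarrow> f y \<in> bar_tuples G l q n"
    "\<And>k. \<lbrakk>l \<le> k; k \<le> n\<rbrakk> \<Longrightarrow> continuous_map X T (\<lambda>y. f y k)"
  shows "continuous_map X (subtopology (product_topology (\<lambda>_. T) {l..n}) (bar_tuples G l q n)) f"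
  using assms unfolding continuous_map_in_subtopology continuous_map_componentwise
  by (auto simp: bar_tuples_def PiE_def)

lemma continuous_bar_face:
  assumes "1 \<le> q" "l \<le> 1" "1 \<le> n" "i \<le> n"
  shows "continuous_map (level (bar_simp G T l q) n) (level (bar_simp G T l q) (n - 1)) (bar_face G l n i)"
proof (simp, rule continuous_map_into_bar)
  fix k assume k: "l \<le> k" "k \<le> n - Suc 0"
  then have k': "k \<in> {l..<n}" using assms(3) by auto
  show "continuous_map (subtopology (product_topology (\<lambda>_. T) {l..n}) (bar_tuples G l q n)) T
          (\<lambda>y. bar_face G l n i y k)"
    unfolding bar_face_def restrict_apply'[OF k']
    using k' by (cases "k < i"; cases "k = i")
      (auto intro!: continuous_map_coordinate continuous_map_mult_pointwise)
qed (use assms bar_face_in_tuples in auto)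

lemma continuous_bar_degen:
  assumes "1 \<le> q" "l \<le> 1" "j \<le> n"
  shows "continuous_map (level (bar_simp G T l q) n) (level (bar_simp G T l q) (n + 1)) (bar_degen G l n j)"
proof (simp, rule continuous_map_into_bar)
  fix k assume k: "l \<le> k" "k \<le> Suc n"
  then have k': "k \<in> {l..n + 1}" by auto
  show "continuous_map (subtopology (product_topology (\<lambda>_. T) {l..n}) (bar_tuples G l q n)) T
          (\<lambda>y. bar_degen G l n j y k)"
    unfolding bar_degen_def restrict_apply'[OF k']
    using k' assms by (cases "k \<le> j"; cases "k = j + 1")
      (auto intro!: continuous_map_coordinate simp: topspace_eq)
qed (use assms bar_degen_in_tuples in auto)

lemma bar_face_face:
  assumes x: "x \<in> bar_tuples G l q n" and n: "2 \<le> n" "i < j" "j \<le> n"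
  shows "bar_face G l (n - 1) i (bar_face G l n j x) = bar_face G l (n - 1) (j - 1) (bar_face G l n i x)"
proof
  fix k
  have c: "x k \<in> carrier G" "x (Suc k) \<in> carrier G" "x (Suc (Suc k)) \<in> carrier G" if "l \<le> k" "k < n - 1"
    using that bar_tuples_closed[OF x] by auto
  obtain j' where j: "j = Suc j'" using n by (cases j) auto
  obtain n' where n': "n = Suc n'" using n by (cases n) auto
  \<comment> \<open>Associativity is used for \<open>k = i = j'\<close>, where three entries are multiplied.\<close>
  consider "\<not> (l \<le> k \<and> k < n')" | "l \<le> k" "k < n'" "k < i" | "l \<le> k" "k < n'" "k = i" "i < j'"
    | "l \<le> k" "k < n'" "k = i" "i = j'" | "l \<le> k" "k < n'" "i < k" "k < j'"
    | "l \<le> k" "k < n'" "i < k" "k = j'" | "l \<le> k" "k < n'" "i < k" "j' < k"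
    using n(2) j by linarith
  then show "bar_face G l (n - 1) i (bar_face G l n j x) k =
      bar_face G l (n - 1) (j - 1) (bar_face G l n i x) k"
    by cases (use n j n' c in \<open>auto simp: bar_face_def m_assoc\<close>)
qed

lemma bar_degen_degen:
  assumes "i \<le> j" "j \<le> n" "l \<le> 1"
  shows "bar_degen G l (n + 1) i (bar_degen G l n j x) = bar_degen G l (n + 1) (j + 1) (bar_degen G l n i x)"
  using assms by (intro ext) (auto simp: bar_degen_def)

lemma bar_face_degen_less:
  assumes n: "i < j" "j \<le> n" "l \<le> 1"
  shows "bar_face G l (n + 1) i (bar_degen G l n j x) = bar_degen G l (n - 1) (j - 1) (bar_face G l n i x)"
proof
  fix k
  obtain j' where j: "j = Suc j'" using n by (cases j) auto
  obtain n' where n': "n = Suc n'" using n by (cases n) auto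
  obtain k' where k': "k = Suc k' \<or> k = 0" by (cases k) auto
  consider "\<not> (l \<le> k \<and> k \<le> n)" | "l \<le> k" "k \<le> n" "k < i" | "l \<le> k" "k \<le> n" "k = i"
    | "l \<le> k" "k \<le> n" "i < k" "k \<le> j'" | "l \<le> k" "k \<le> n" "k = j"
    | "l \<le> k" "k \<le> n" "j < k" "k = Suc k'"
    using n(1) j k' by linarith
  then show "bar_face G l (n + 1) i (bar_degen G l n j x) k =
      bar_degen G l (n - 1) (j - 1) (bar_face G l n i x) k"
    by cases (use n j n' k' in \<open>auto simp: bar_face_def bar_degen_def\<close>)
qed

lemma bar_face_degen_same:
  assumes x: "x \<in> bar_tuples G l q n" and n: "j \<le> n" "i = j \<or> i = j + 1"
  shows "bar_face G l (n + 1) i (bar_degen G l n j x) = x"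
proof
  fix k
  have "x k \<in> carrier G" if "l \<le> k" "k \<le> n"
    using that bar_tuples_closed[OF x] by auto
  then show "bar_face G l (n + 1) i (bar_degen G l n j x) k = x k"
    using n bar_tuples_arb[OF x, of k] by (auto simp: bar_face_def bar_degen_def)
qed

lemma bar_face_degen_greater:
  assumes n: "j + 1 < i" "i \<le> n + 1" "l \<le> 1"
  shows "bar_face G l (n + 1) i (bar_degen G l n j x) = bar_degen G l (n - 1) j (bar_face G l n (i - 1) x)"
proof
  fix k
  obtain i' where i: "i = Suc i'" using n(1) by (cases i) auto
  obtain n' where n': "n = Suc n'" using n by (cases n) auto
  consider "k \<le> j" | "k = j + 1" | k' where "k = Suc k'" "j < k'" "k' < i'" | "k = i" | k' where "k = Suc k'" "i' < k'"
    using i by (cases k) (auto, linarith)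
  then show "bar_face G l (n + 1) i (bar_degen G l n j x) k =
      bar_degen G l (n - 1) j (bar_face G l n (i - 1) x) k"
    by cases (use n i n' in \<open>simp_all add: bar_face_def bar_degen_def\<close>)
qed

lemma simplicial_space_bar:
  assumes "1 \<le> q" "l \<le> 1"
  shows "simplicial_space (bar_simp G T l q)"
  unfolding simplicial_space_def
proof (intro conjI allI ballI impI)
  fix n x assume "x \<in> topspace (level (bar_simp G T l q) n)"
  then have x: "x \<in> bar_tuples G l q n" by simp
  show "face (bar_simp G T l q) (n - 1) i (face (bar_simp G T l q) n j x) =
        face (bar_simp G T l q) (n - 1) (j - 1) (face (bar_simp G T l q) n i x)"
    if "2 \<le> n \<and> i < j \<and> j \<le> n" for i j
    unfolding bar_simp_simps using bar_face_face[OF x] that by blast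
  show "degen (bar_simp G T l q) (n + 1) i (degen (bar_simp G T l q) n j x) =
        degen (bar_simp G T l q) (n + 1) (j + 1) (degen (bar_simp G T l q) n i x)"
    if "i \<le> j \<and> j \<le> n" for i j
    unfolding bar_simp_simps using bar_degen_degen that assms(2) by blast
  show "face (bar_simp G T l q) (n + 1) i (degen (bar_simp G T l q) n j x) =
        degen (bar_simp G T l q) (n - 1) (j - 1) (face (bar_simp G T l q) n i x)"
    if "i < j \<and> j \<le> n" for i j
    unfolding bar_simp_simps using bar_face_degen_less that assms by blast
  show "face (bar_simp G T l q) (n + 1) i (degen (bar_simp G T l q) n j x) = x"
    if "j \<le> n \<and> (i = j \<or> i = j + 1)" for i j
    unfolding bar_simp_simps using bar_face_degen_same[OF x] that by blast
  show "face (bar_simp G T l q) (n + 1) i (degen (bar_simp G T l q) n j x) =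
        degen (bar_simp G T l q) (n - 1) j (face (bar_simp G T l q) n (i - 1) x)"
    if "j + 1 < i \<and> i \<le> n + 1" for i j
    unfolding bar_simp_simps using bar_face_degen_greater that assms(2) by blast
next
  fix n i :: nat assume "1 \<le> n \<and> i \<le> n"
  then show "continuous_map (level (bar_simp G T l q) n) (level (bar_simp G T l q) (n - 1))
      (face (bar_simp G T l q) n i)"
    using continuous_bar_face[OF assms] by simp
next
  fix n j :: nat assume "j \<le> n"
  then show "continuous_map (level (bar_simp G T l q) n) (level (bar_simp G T l q) (n + 1))
      (degen (bar_simp G T l q) n j)"
    using continuous_bar_degen[OF assms] by simp
qed

lemma simplicial_map_inclusion:
  assumes "1 \<le> q" "q \<le> r" "l \<le> 1"
    and f: "\<And>n x. x \<in> bar_tuples G l q n \<Longrightarrow> f n x = x"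
  shows "simplicial_map (bar_simp G T l q) (bar_simp G T l r) f"
proof -
  have r: "1 \<le> r" using assms by order
  have "continuous_map (level (bar_simp G T l q) n) (level (bar_simp G T l r) n) (f n)" for n
  proof -
    have "continuous_map (level (bar_simp G T l q) n) (level (bar_simp G T l r) n) (\<lambda>x. x)"
      unfolding bar_simp_simps
    proof (rule continuous_map_into_bar)
      fix k assume "l \<le> k" "k \<le> n"
      then show "continuous_map (subtopology (product_topology (\<lambda>_. T) {l..n}) (bar_tuples G l q n)) T (\<lambda>x. x k)"
        by (rule continuous_map_coordinate)
    qed (use bar_tuples_mono[OF assms(1,2)] in auto)
    then show ?thesis by (rule continuous_map_eq) (simp add: f)
  qed
  then show ?thesis
    unfolding simplicial_map_def using simplicial_space_bar[OF assms(1,3)] simplicial_space_bar[OF r assms(3)]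
    using f bar_face_in_tuples[OF assms(1,3)] bar_degen_in_tuples[OF assms(1,3)] by simp
qed

lemma e_simp_eq:
  assumes "1 \<le> q" "q \<le> r" "x \<in> bar_tuples G 0 q n"
  shows "e_simp G q r n x = x"
proof
  fix k
  have "b_simp G q r n (restrict x {1..n}) = restrict x {1..n}"
    using b_simp_eq[OF assms(1,2)] assms(3) unfolding bar_tuples_def by blast
  then show "e_simp G q r n x k = x k"
    using bar_tuples_arb[OF assms(3), of k] unfolding e_simp_def by (simp add: restrict_def)
qed

lemma simplicial_map_e:
  assumes "1 \<le> q" "q \<le> r"
  shows "simplicial_map (E_simp G T q) (E_simp G T r) (e_simp G q r)"
  unfolding E_simp_eq_bar_simp
  by (rule simplicial_map_inclusion[OF assms zero_le e_simp_eq[OF assms]])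

lemma simplicial_map_b:
  assumes "1 \<le> q" "q \<le> r"
  shows "simplicial_map (B_simp G T q) (B_simp G T r) (b_simp G q r)"
  unfolding B_simp_eq_bar_simp
  by (rule simplicial_map_inclusion[OF assms le_refl b_simp_eq[OF assms]]) (simp only: bar_tuples_one)

lemma p_simp_in_tuples:
  assumes "x \<in> bar_tuples G 0 q n" shows "p_simp n x \<in> bar_tuples G 1 q n"
  unfolding bar_tuples_one p_simp_def using assms unfolding bar_tuples_def by blast

lemma simplicial_map_p:
  assumes q: "1 \<le> q"
  shows "simplicial_map (E_simp G T q) (B_simp G T q) p_simp"
proof -
  have "continuous_map (level (bar_simp G T 0 q) n) (level (bar_simp G T 1 q) n) (p_simp n)" for n
    unfolding bar_simp_simps
  proof (rule continuous_map_into_bar)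
    fix k assume k: "1 \<le> k" "k \<le> n"
    then show "continuous_map (subtopology (product_topology (\<lambda>_. T) {0..n}) (bar_tuples G 0 q n)) T (\<lambda>y. p_simp n y k)"
      unfolding p_simp_def by (simp add: continuous_map_coordinate)
  qed (simp add: p_simp_in_tuples[simplified])
  moreover have "p_simp (n - 1) (bar_face G 0 n i x) = bar_face G 1 n i (p_simp n x)" if "1 \<le> n" "i \<le> n" for n i x
    using that by (intro ext) (auto simp: p_simp_def bar_face_def)
  moreover have "p_simp (n + 1) (bar_degen G 0 n j x) = bar_degen G 1 n j (p_simp n x)" if "j \<le> n" for n j x
    using that by (intro ext) (auto simp: p_simp_def bar_degen_def)
  ultimately show ?thesis
    unfolding simplicial_map_def E_simp_eq_bar_simp B_simp_eq_bar_simp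
    using simplicial_space_bar[OF q, of 0] simplicial_space_bar[OF q, of 1] by simp
qed

definition act_simp :: "'a \<Rightarrow> nat \<Rightarrow> (nat \<Rightarrow> 'a) \<Rightarrow> (nat \<Rightarrow> 'a)" where
  "act_simp g n x = x(0 := g \<otimes> x 0)"

lemma act_simp_in_tuples:
  assumes "g \<in> carrier G" "x \<in> bar_tuples G 0 q n"
  shows "act_simp g n x \<in> bar_tuples G 0 q n"
proof -
  have "restrict (act_simp g n x) {1..n} = restrict x {1..n}"
    by (auto simp: act_simp_def)
  moreover have "act_simp g n x \<in> {0..n} \<rightarrow>\<^sub>E carrier G"
    using assms by (auto simp: act_simp_def bar_tuples_def PiE_def extensional_def Pi_iff)
  ultimately show ?thesis using assms(2) by (simp add: bar_tuples_def)
qed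

lemma simplicial_map_act:
  assumes q: "1 \<le> q" and g: "g \<in> carrier G"
  shows "simplicial_map (E_simp G T q) (E_simp G T q) (act_simp g)"
proof -
  have "continuous_map (level (bar_simp G T 0 q) n) (level (bar_simp G T 0 q) n) (act_simp g n)" for n
    unfolding bar_simp_simps
  proof (rule continuous_map_into_bar)
    fix k assume k: "0 \<le> k" "k \<le> n"
    show "continuous_map (subtopology (product_topology (\<lambda>_. T) {0..n}) (bar_tuples G 0 q n)) T (\<lambda>y. act_simp g n y k)"
      unfolding act_simp_def using k g
      by (cases "k = 0") (auto intro!: continuous_map_coordinate continuous_map_mult_pointwise simp: topspace_eq)
  qed (simp add: act_simp_in_tuples g)
  moreover have "act_simp g (n - 1) (bar_face G 0 n i x) = bar_face G 0 n i (act_simp g n x)"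
    if "1 \<le> n" "i \<le> n" "x \<in> bar_tuples G 0 q n" for n i x
    using that g bar_tuples_closed[OF that(3)]
    by (intro ext) (auto simp: act_simp_def bar_face_def m_assoc)
  moreover have "act_simp g (n + 1) (bar_degen G 0 n j x) = bar_degen G 0 n j (act_simp g n x)" if "j \<le> n" for n j x
    using that by (intro ext) (auto simp: act_simp_def bar_degen_def)
  ultimately show ?thesis
    unfolding simplicial_map_def E_simp_eq_bar_simp
    using simplicial_space_bar[OF q, of 0] by simp
qed

end

lemma bar_ind_in_tuples:
  assumes "group G" "group H" "\<phi> \<in> hom G H" "1 \<le> q" "l \<le> 1" "x \<in> bar_tuples G l q n"
  shows "(\<lambda>k\<in>{l..n}. \<phi> (x k)) \<in> bar_tuples H l q n"
proof -
  have "restrict (\<lambda>k\<in>{l..n}. \<phi> (x k)) {1..n} = (\<lambda>k\<in>{1..n}. \<phi> (restrict x {1..n} k))"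
    using assms(5) by auto
  moreover have "(\<lambda>k\<in>{1..n}. \<phi> (restrict x {1..n} k)) \<in> hom_tuples H q n"
    by (rule group.hom_tuples_hom_image[OF assms(1,4,2,3)]) (use assms(6) in \<open>unfold bar_tuples_def, blast\<close>)
  moreover have "(\<lambda>k\<in>{l..n}. \<phi> (x k)) \<in> {l..n} \<rightarrow>\<^sub>E carrier H"
    using assms(3) bar_tuples_closed[OF assms(6)] by (auto simp: restrict_PiE_iff hom_def)
  ultimately show ?thesis by (simp add: bar_tuples_def)
qed

lemma simplicial_map_bar_ind:
  assumes G: "topological_group G T" and H: "topological_group H S"
    and \<phi>: "\<phi> \<in> continuous_hom G T H S" and q: "1 \<le> q" and l: "l \<le> 1"
  shows "simplicial_map (bar_simp G T l q) (bar_simp H S l q) (\<lambda>n x. \<lambda>k\<in>{l..n}. \<phi> (x k))"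
proof -
  interpret G: topological_group G T by fact
  interpret H: topological_group H S by fact
  have hom: "\<phi> \<in> hom G H" and cont: "continuous_map T S \<phi>" using \<phi> by (auto simp: continuous_hom_def)
  interpret \<phi>: group_hom G H \<phi> by (intro group_homI hom G.is_group H.is_group)
  note mem = bar_ind_in_tuples[OF G.is_group H.is_group hom q l]
  have "continuous_map (level (bar_simp G T l q) n) (level (bar_simp H S l q) n) (\<lambda>x. \<lambda>k\<in>{l..n}. \<phi> (x k))" for n
    unfolding bar_simp_simps
  proof (rule H.continuous_map_into_bar)
    fix k assume k: "l \<le> k" "k \<le> n"
    show "continuous_map (subtopology (product_topology (\<lambda>_. T) {l..n}) (bar_tuples G l q n)) S
            (\<lambda>x. (\<lambda>k\<in>{l..n}. \<phi> (x k)) k)"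
      using continuous_map_compose[OF G.continuous_map_coordinate[OF k] cont] k by (simp add: o_def)
  qed (use mem in simp)
  moreover have "(\<lambda>k\<in>{l..n - 1}. \<phi> (bar_face G l n i x k)) = bar_face H l n i (\<lambda>k\<in>{l..n}. \<phi> (x k))"
    if "1 \<le> n" "i \<le> n" "x \<in> bar_tuples G l q n" for n i x
    using that bar_tuples_closed[OF that(3)] by (intro ext) (auto simp: bar_face_def)
  moreover have "(\<lambda>k\<in>{l..n + 1}. \<phi> (bar_degen G l n j x k)) = bar_degen H l n j (\<lambda>k\<in>{l..n}. \<phi> (x k))"
    if "j \<le> n" "x \<in> bar_tuples G l q n" for n j x
    using that l by (intro ext) (auto simp: bar_degen_def)
  ultimately show ?thesis
    unfolding simplicial_map_def
    using G.simplicial_space_bar[OF q l] H.simplicial_space_bar[OF q l] by simp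
qed

section \<open>Points of E as step functions\<close>

primrec partial_prod :: "('a, 'm) monoid_scheme \<Rightarrow> (nat \<Rightarrow> 'a) \<Rightarrow> nat \<Rightarrow> 'a" where
  "partial_prod G x 0 = x 0"
| "partial_prod G x (Suc i) = partial_prod G x i \<otimes>\<^bsub>G\<^esub> x (Suc i)"

definition step_index :: "(nat \<Rightarrow> real) \<Rightarrow> real \<Rightarrow> nat" where
  "step_index t s = (LEAST i. s < sum t {..i})"

text \<open>
  A point \<open>(n, x, t)\<close> of the prerealization of E is read as the step function on the half-open unit
  interval that takes the values \<open>x\<^sub>0\<close>, \<open>x\<^sub>0x\<^sub>1\<close>, \<open>\<dots>\<close>, \<open>x\<^sub>0\<cdots>x\<^sub>n\<close> on consecutive intervals of lengths
  \<open>t\<^sub>0, \<dots>, t\<^sub>n\<close>. The faces and degeneracies are made for this reading: an interval of length zero may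
  be dropped, and a factor \<open>1\<close> merges two intervals.
\<close>

definition step_function :: "('a, 'm) monoid_scheme \<Rightarrow> (nat \<Rightarrow> 'a) simplex_point \<Rightarrow> real \<Rightarrow> 'a" where
  "step_function G = (\<lambda>(n, x, t). \<lambda>s\<in>{0..<1}. partial_prod G x (step_index t s))"

lemma simplex_nonneg: "t \<in> standard_simplex n \<Longrightarrow> 0 \<le> t i"
  and simplex_sum: "t \<in> standard_simplex n \<Longrightarrow> sum t {..n} = 1"
  and simplex_zero: "t \<in> standard_simplex n \<Longrightarrow> n < i \<Longrightarrow> t i = 0"
  by (auto simp: standard_simplex_def)

lemma simplexI:
  assumes "\<And>i. 0 \<le> t i" "\<And>i. n < i \<Longrightarrow> t i = 0" "sum t {..n} = 1"
  shows "t \<in> standard_simplex n"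
proof -
  have "t i \<le> 1" for i
  proof (cases "i \<le> n")
    case True
    then have "t i \<le> sum t {..n}" using assms(1) by (intro member_le_sum) auto
    then show ?thesis using assms(3) by simp
  next
    case False
    then show ?thesis using assms(2)[of i] by simp
  qed
  then show ?thesis using assms by (simp add: standard_simplex_def)
qed

lemma cumulative_mono:
  assumes "t \<in> standard_simplex n" "i \<le> j"
  shows "sum t {..i} \<le> sum t {..j}"
  using assms simplex_nonneg[OF assms(1)] by (intro sum_mono2) auto

lemma cumulative_strict_mono:
  assumes "t \<in> standard_simplex n" "i < j" "0 < t j"
  shows "sum t {..i} < sum t {..j}"
proof -
  obtain k where k: "j = Suc k" using assms(2) by (cases j) auto
  then have "sum t {..i} \<le> sum t {..k}" using assms(2) by (intro cumulative_mono[OF assms(1)]) auto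
  also have "\<dots> < sum t {..j}" using assms(3) k by simp
  finally show ?thesis .
qed

lemma cumulative_le_one:
  assumes "t \<in> standard_simplex n"
  shows "sum t {..i} \<le> 1" "n \<le> i \<Longrightarrow> sum t {..i} = 1"
proof -
  have 1: "sum t {..i} = 1" if "n \<le> i" for i
    using that
  proof (induction rule: dec_induct)
    case base
    show ?case by (rule simplex_sum[OF assms])
  next
    case (step m)
    then show ?case using simplex_zero[OF assms, of "Suc m"] by simp
  qed
  then show "n \<le> i \<Longrightarrow> sum t {..i} = 1" .
  show "sum t {..i} \<le> 1"
    using cumulative_mono[OF assms, of i "max i n"] 1[of "max i n"] by simp
qed

lemma step_index_eqI:
  assumes "t \<in> standard_simplex n" "s < sum t {..m}" "\<And>k. m = Suc k \<Longrightarrow> sum t {..k} \<le> s"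
  shows "step_index t s = m"
  unfolding step_index_def
proof (rule Least_equality)
  fix y assume y: "s < sum t {..y}"
  show "m \<le> y"
  proof (rule ccontr)
    assume "\<not> m \<le> y"
    then obtain k where "m = Suc k" "y \<le> k" by (cases m) auto
    then show False using y assms(3) cumulative_mono[OF assms(1), of y k] by simp
  qed
qed (rule assms(2))

lemma step_index:
  assumes "t \<in> standard_simplex n" "s < 1"
  shows "s < sum t {..step_index t s}" "step_index t s \<le> n"
    "step_index t s = Suc k \<Longrightarrow> sum t {..k} \<le> s"
proof -
  have n: "s < sum t {..n}" using simplex_sum[OF assms(1)] assms(2) by simp
  show "s < sum t {..step_index t s}" unfolding step_index_def by (rule LeastI[of _ n]) (rule n)
  show "step_index t s \<le> n" unfolding step_index_def by (rule Least_le) (rule n)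
  show "sum t {..k} \<le> s" if "step_index t s = Suc k"
    using not_less_Least[of k "\<lambda>i. s < sum t {..i}"] that unfolding step_index_def by linarith
qed

lemma cumulative_simplical_face:
  "sum (simplical_face i t) {..k} = (if k < i then sum t {..k} else sum t {..<k})" for t :: "nat \<Rightarrow> real"
proof (induction k)
  case (Suc k)
  have "sum t {..k} = sum t {..<k} + t k"
    using sum.lessThan_Suc[of t k] by (simp only: lessThan_Suc_atMost)
  then show ?case using Suc
    by (auto simp: simplical_face_def lessThan_Suc_atMost not_less le_Suc_eq)
qed (simp add: simplical_face_def)

lemma cumulative_simplex_codegen:
  "sum (simplex_codegen j t) {..k} = (if k < j then sum t {..k} else sum t {..Suc k})"
proof (induction k)
  case (Suc k)
  then show ?case by (auto simp: simplex_codegen_def less_Suc_eq not_less)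
qed (simp add: simplex_codegen_def)

lemma simplex_codegen_in_simplex:
  assumes "t \<in> standard_simplex (n + 1)" "j \<le> n"
  shows "simplex_codegen j t \<in> standard_simplex n"
proof (rule simplexI)
  show "0 \<le> simplex_codegen j t i" for i
    using simplex_nonneg[OF assms(1)] by (auto simp: simplex_codegen_def)
  show "simplex_codegen j t i = 0" if "n < i" for i
    using simplex_zero[OF assms(1)] that assms(2) by (auto simp: simplex_codegen_def)
  show "sum (simplex_codegen j t) {..n} = 1"
    using cumulative_le_one(2)[OF assms(1), of "Suc n"] assms(2) by (simp add: cumulative_simplex_codegen)
qed

definition simplex_drop :: "nat \<Rightarrow> (nat \<Rightarrow> real) \<Rightarrow> (nat \<Rightarrow> real)" where
  "simplex_drop i t = (\<lambda>k. if k < i then t k else t (Suc k))"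

lemma simplical_face_drop:
  assumes "t i = 0"
  shows "simplical_face i (simplex_drop i t) = t"
proof
  fix k
  show "simplical_face i (simplex_drop i t) k = t k"
    using assms by (cases k) (auto simp: simplical_face_def simplex_drop_def)
qed

lemma simplex_drop_in_simplex:
  assumes t: "t \<in> standard_simplex n" and n: "1 \<le> n" "i \<le> n" "t i = 0"
  shows "simplex_drop i t \<in> standard_simplex (n - 1)"
proof (rule simplexI)
  show "0 \<le> simplex_drop i t k" for k
    using simplex_nonneg[OF t] by (simp add: simplex_drop_def)
  show "simplex_drop i t k = 0" if "n - 1 < k" for k
    using simplex_zero[OF t] that n by (simp add: simplex_drop_def)
  have "sum t {..n} = sum (simplical_face i (simplex_drop i t)) {..n}"
    using simplical_face_drop[of t i] n by simp
  also have "\<dots> = sum (simplex_drop i t) {..<n}"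
    using n by (simp add: cumulative_simplical_face)
  also have "{..<n} = {..n - 1}" using n by auto
  finally show "sum (simplex_drop i t) {..n - 1} = 1" using simplex_sum[OF t] by simp
qed

text \<open>
  An interval of length zero is inserted at position \<open>i\<close>.
\<close>

lemma step_index_simplical_face:
  assumes t: "t \<in> standard_simplex (n - 1)" and n: "1 \<le> n" "i \<le> n" and s: "0 \<le> s" "s < 1"
  shows "step_index (simplical_face i t) s = (if step_index t s < i then step_index t s else Suc (step_index t s))"
proof (rule step_index_eqI[OF simplical_face_in_simplex[OF n t]])
  note m = step_index[OF t s(2)]
  show "s < sum (simplical_face i t) {..if step_index t s < i then step_index t s else Suc (step_index t s)}"
    using m(1) by (simp add: cumulative_simplical_face lessThan_Suc_atMost)
  fix k assume k: "(if step_index t s < i then step_index t s else Suc (step_index t s)) = Suc k"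
  show "sum (simplical_face i t) {..k} \<le> s"
  proof (cases "step_index t s < i")
    case True
    then show ?thesis using k m(3)[of k] by (simp add: cumulative_simplical_face)
  next
    case False
    then have ks: "k = step_index t s" using k by simp
    show ?thesis
    proof (cases k)
      case 0
      then show ?thesis using False ks s by (simp add: simplical_face_def)
    next
      case (Suc k')
      then show ?thesis using m(3)[of k'] ks False
        by (simp add: cumulative_simplical_face lessThan_Suc_atMost del: sum.atMost_Suc)
    qed
  qed
qed

text \<open>
  The intervals \<open>j\<close> and \<open>j + 1\<close> are merged.
\<close>

lemma step_index_simplex_codegen:
  assumes t: "t \<in> standard_simplex (n + 1)" and j: "j \<le> n" and s: "0 \<le> s" "s < 1"
  shows "step_index (simplex_codegen j t) s = (if step_index t s \<le> j then step_index t s else step_index t s - 1)"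
proof (rule step_index_eqI[OF simplex_codegen_in_simplex[OF t j]])
  note m = step_index[OF t s(2)]
  let ?m = "step_index t s"
  have Sm: "s < sum t {..Suc ?m}"
    using m(1) simplex_nonneg[OF t, of "Suc ?m"] by simp
  show "s < sum (simplex_codegen j t) {..if ?m \<le> j then ?m else ?m - 1}"
  proof (cases "?m \<le> j")
    case True
    then show ?thesis using m(1) Sm
      by (cases "?m = j") (simp_all add: cumulative_simplex_codegen del: sum.atMost_Suc)
  next
    case False
    then obtain k where "?m = Suc k" "j \<le> k" by (cases ?m) auto
    then show ?thesis using m(1) by (simp add: cumulative_simplex_codegen del: sum.atMost_Suc)
  qed
  fix k assume k: "(if ?m \<le> j then ?m else ?m - 1) = Suc k"
  show "sum (simplex_codegen j t) {..k} \<le> s"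
  proof (cases "?m \<le> j")
    case True
    then show ?thesis using k m(3)[of k] by (simp add: cumulative_simplex_codegen)
  next
    case False
    then have "?m = Suc (Suc k)" using k by simp
    then show ?thesis
      using m(3)[of "Suc k"] False cumulative_mono[OF t, of k "Suc k"]
      by (simp add: cumulative_simplex_codegen del: sum.atMost_Suc)
  qed
qed

context topological_group
begin

lemma partial_prod_closed: "\<lbrakk>x \<in> bar_tuples G 0 q n; i \<le> n\<rbrakk> \<Longrightarrow> partial_prod G x i \<in> carrier G"
  by (induction i) (auto simp: bar_tuples_closed)

lemma partial_prod_bar_face:
  assumes x: "x \<in> bar_tuples G 0 q n" and "i \<le> n"
  shows "m < n \<Longrightarrow> partial_prod G (bar_face G 0 n i x) m = (if m < i then partial_prod G x m else partial_prod G x (Suc m))"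
proof (induction m)
  case 0
  then show ?case using assms by (auto simp: bar_face_def)
next
  case (Suc m)
  have c: "partial_prod G x m \<in> carrier G" "x (Suc m) \<in> carrier G" "x (Suc (Suc m)) \<in> carrier G"
    using Suc.prems partial_prod_closed[OF x] bar_tuples_closed[OF x] by auto
  consider "Suc m < i" | "Suc m = i" | "i \<le> m" by linarith
  then show ?case using Suc c by cases (auto simp: bar_face_def m_assoc)
qed

lemma partial_prod_bar_degen:
  assumes x: "x \<in> bar_tuples G 0 q n" and "j \<le> n"
  shows "m \<le> n + 1 \<Longrightarrow> partial_prod G (bar_degen G 0 n j x) m = (if m \<le> j then partial_prod G x m else partial_prod G x (m - 1))"
proof (induction m)
  case 0
  then show ?case using assms by (auto simp: bar_degen_def)
next
  case (Suc m)
  show ?case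
  proof (cases m)
    case 0
    then show ?thesis using Suc assms bar_tuples_closed[OF x, of 0] by (auto simp: bar_degen_def)
  next
    case m: (Suc m')
    have c: "partial_prod G x m \<in> carrier G" using Suc.prems partial_prod_closed[OF x] by auto
    consider "Suc m \<le> j" | "m = j" | "j < m" by linarith
    then show ?thesis using Suc c m by cases (auto simp: bar_degen_def)
  qed
qed

lemma topspace_level_E: "topspace (level (E_simp G T q) n) = bar_tuples G 0 q n"
  unfolding E_simp_eq_bar_simp bar_simp_simps by (rule topspace_bar)

lemma topspace_level_B: "topspace (level (B_simp G T q) n) = bar_tuples G 1 q n"
  unfolding B_simp_eq_bar_simp bar_simp_simps by (rule topspace_bar)

lemma continuous_map_into_level_E:
  assumes "\<And>y. y \<in> topspace X \<Longrightarrow> f y \<in> bar_tuples G 0 q n" "\<And>k. k \<le> n \<Longrightarrow> continuous_map X T (\<lambda>y. f y k)"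
  shows "continuous_map X (level (E_simp G T q) n) f"
  unfolding E_simp_eq_bar_simp bar_simp_simps by (rule continuous_map_into_bar[OF assms])

lemma continuous_entry_E: "k \<le> n \<Longrightarrow> continuous_map (level (E_simp G T q) n) T (\<lambda>x. x k)"
  unfolding E_simp_eq_bar_simp bar_simp_simps by (rule continuous_map_coordinate[OF zero_le])

lemma continuous_entry_B: "\<lbrakk>1 \<le> k; k \<le> n\<rbrakk> \<Longrightarrow> continuous_map (level (B_simp G T q) n) T (\<lambda>x. x k)"
  unfolding B_simp_eq_bar_simp bar_simp_simps by (rule continuous_map_coordinate)

lemma topspace_prerealization_E:
  "(n, x, t) \<in> topspace (prerealization (E_simp G T q)) \<longleftrightarrow> x \<in> bar_tuples G 0 q n \<and> t \<in> standard_simplex n"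
  by (simp add: topspace_prerealization topspace_level_E)

lemma topspace_prerealization_B:
  "(n, x, t) \<in> topspace (prerealization (B_simp G T q)) \<longleftrightarrow> x \<in> bar_tuples G 1 q n \<and> t \<in> standard_simplex n"
  by (simp add: topspace_prerealization topspace_level_B)

lemma step_function_glue:
  assumes "glue (E_simp G T q) a b"
  shows "step_function G a = step_function G b"
  using assms
proof cases
  case (face n i x t)
  then have x: "x \<in> bar_tuples G 0 q n" by (simp add: topspace_level_E)
  have "partial_prod G (bar_face G 0 n i x) (step_index t s) =
        partial_prod G x (step_index (simplical_face i t) s)" if "s \<in> {0..<1}" for s
    using that step_index(2)[OF face(6), of s] face(3,4)
    by (simp add: step_index_simplical_face[OF face(6,3,4)] partial_prod_bar_face[OF x])
  then show ?thesis
    unfolding face(1,2) step_function_def by (auto simp: E_simp_eq_bar_simp)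
next
  case (degen j n x t)
  then have x: "x \<in> bar_tuples G 0 q n" by (simp add: topspace_level_E)
  have "partial_prod G (bar_degen G 0 n j x) (step_index t s) =
        partial_prod G x (step_index (simplex_codegen j t) s)" if "s \<in> {0..<1}" for s
    using that step_index(2)[OF degen(5), of s] degen(3)
    by (simp add: step_index_simplex_codegen[OF degen(5,3)] partial_prod_bar_degen[OF x])
  then show ?thesis
    unfolding degen(1,2) step_function_def by (auto simp: E_simp_eq_bar_simp)
qed

lemma equivclp_step_function:
  assumes "equivclp (glue (E_simp G T q)) a b"
  shows "step_function G a = step_function G b"
  using assms by (rule equivclp_invariant[where F = "step_function G", rotated]) (rule step_function_glue)

definition nondegenerate :: "(nat \<Rightarrow> 'a) simplex_point \<Rightarrow> bool" where
  "nondegenerate = (\<lambda>(n, x, t). (\<forall>i\<le>n. 0 < t i) \<and> (\<forall>i. 1 \<le> i \<and> i \<le> n \<longrightarrow> x i \<noteq> \<one>))"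

lemma bar_degen_face_one:
  assumes x: "x \<in> bar_tuples G 0 q (Suc m)" and i: "1 \<le> i" "i \<le> Suc m" "x i = \<one>"
  shows "bar_degen G 0 m (i - 1) (bar_face G 0 (Suc m) i x) = x"
proof
  fix k
  have c: "x k \<in> carrier G" if "k \<le> Suc m" for k using that bar_tuples_closed[OF x] by simp
  consider "k < i" | "k = i" | "k = Suc i" | k' where "k = Suc k'" "i < k'"
    by (metis Suc_lessI linorder_neqE_nat old.nat.exhaust less_Suc_eq not_less_zero)
  then show "bar_degen G 0 m (i - 1) (bar_face G 0 (Suc m) i x) k = x k"
    using i c bar_tuples_arb[OF x, of k] by cases (auto simp: bar_degen_def bar_face_def)
qed

text \<open>
  A vanishing barycentric coordinate is removed by a face, an entry \<open>1\<close> by a degeneracy. The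
  homomorphism condition survives, so the reduction takes place inside E for the same \<open>q\<close>.
\<close>

lemma degenerate_step:
  assumes q: "1 \<le> q" and a: "(n, x, t) \<in> topspace (prerealization (E_simp G T q))"
    and d: "\<not> nondegenerate (n, x, t)"
  obtains m y u where "n = Suc m" "(m, y, u) \<in> topspace (prerealization (E_simp G T q))"
    "equivclp (glue (E_simp G T q)) (n, x, t) (m, y, u)"
proof -
  let ?E = "E_simp G T q"
  have x: "x \<in> bar_tuples G 0 q n" and t: "t \<in> standard_simplex n"
    using a by (simp_all add: topspace_prerealization_E)
  have xl: "x \<in> topspace (level ?E n)" using x by (simp add: topspace_level_E)
  have fd: "face ?E = bar_face G 0" "degen ?E = bar_degen G 0" by (simp_all add: E_simp_def)
  consider i where "i \<le> n" "t i = 0" | i where "1 \<le> i" "i \<le> n" "x i = \<one>"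
    using d simplex_nonneg[OF t] unfolding nondegenerate_def by (auto simp: less_le)
  then show thesis
  proof cases
    case (1 i)
    have n: "1 \<le> n"
    proof (rule ccontr)
      assume "\<not> 1 \<le> n"
      then have "n = 0" by simp
      then show False using 1 simplex_sum[OF t] by simp
    qed
    have u: "simplex_drop i t \<in> standard_simplex (n - 1)" by (rule simplex_drop_in_simplex[OF t n 1])
    have "glue ?E (n - 1, bar_face G 0 n i x, simplex_drop i t) (n, x, t)"
      using glue.face[OF n 1(1) xl u] unfolding simplical_face_drop[of t i, OF 1(2)] fd .
    then have "equivclp (glue ?E) (n, x, t) (n - 1, bar_face G 0 n i x, simplex_drop i t)"
      by (intro equivclp_sym[OF r_into_equivclp])
    then show thesis
      using that[of "n - 1"] n u bar_face_in_tuples[OF q zero_le n 1(1) x]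
      by (simp add: topspace_prerealization_E)
  next
    case (2 i)
    then obtain m where m: "n = Suc m" by (cases n) auto
    let ?y = "bar_face G 0 n i x"
    have y: "?y \<in> bar_tuples G 0 q m"
      using bar_face_in_tuples[OF q zero_le _ 2(2) x] m by simp
    have xy: "bar_degen G 0 m (i - 1) ?y = x"
      using bar_degen_face_one[of x q m i] x 2 m by simp
    have yl: "?y \<in> topspace (level ?E m)" using y by (simp add: topspace_level_E)
    have im: "i - 1 \<le> m" using 2 m by simp
    have tm: "t \<in> standard_simplex (m + 1)" using t m by simp
    have "glue ?E (n, x, t) (m, ?y, simplex_codegen (i - 1) t)"
      using glue.degen[OF im yl tm] m xy unfolding fd by simp
    then have "equivclp (glue ?E) (n, x, t) (m, ?y, simplex_codegen (i - 1) t)"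
      by (rule r_into_equivclp)
    then show thesis
      using that[OF m] y simplex_codegen_in_simplex[OF tm im] by (simp add: topspace_prerealization_E)
  qed
qed

lemma normal_form_exists:
  assumes q: "1 \<le> q" and a: "a \<in> topspace (prerealization (E_simp G T q))"
  shows "\<exists>b \<in> topspace (prerealization (E_simp G T q)). nondegenerate b \<and>
    equivclp (glue (E_simp G T q)) a b \<and> (fst b < fst a \<or> b = a)"
  using a
proof (induction "fst a" arbitrary: a rule: less_induct)
  case less
  obtain n x t where a: "a = (n, x, t)" by (cases a)
  show ?case
  proof (cases "nondegenerate a")
    case False
    from degenerate_step[OF q less.prems[unfolded a] False[unfolded a]]
    obtain m y u where m: "n = Suc m" "(m, y, u) \<in> topspace (prerealization (E_simp G T q))"
      "equivclp (glue (E_simp G T q)) (n, x, t) (m, y, u)" .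
    from less.hyps[of "(m, y, u)"] obtain b where b: "b \<in> topspace (prerealization (E_simp G T q))"
      "nondegenerate b" "equivclp (glue (E_simp G T q)) (m, y, u) b" "fst b < m \<or> b = (m, y, u)"
      using a m by auto
    have "equivclp (glue (E_simp G T q)) a b"
      using equivclp_trans[OF m(3) b(3)] a by simp
    moreover have "fst b < fst a" using b(4) a m by auto
    ultimately show ?thesis using b(1,2) by blast
  qed (use less.prems in auto)
qed

text \<open>
  If the \<open>i\<close>-th interval of the first function ended before that of the second, the first function
  would jump there, by an entry different from \<open>1\<close>, while the second is still constant.
\<close>

lemma nondegenerate_cumulative_not_less:
  assumes x: "x \<in> bar_tuples G 0 q n" and t: "t \<in> standard_simplex n" and nd: "nondegenerate (n, x, t)"
    and x': "x' \<in> bar_tuples G 0 r n'" and t': "t' \<in> standard_simplex n'" and nd': "nondegenerate (n', x', t')"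
    and eq: "step_function G (n, x, t) = step_function G (n', x', t')"
    and i: "i \<le> n" "i \<le> n'" and prev: "\<And>k. i = Suc k \<Longrightarrow> sum t {..k} = sum t' {..k}"
  shows "\<not> sum t {..i} < sum t' {..i}" "partial_prod G x i = partial_prod G x' i"
proof -
  define a where "a = (case i of 0 \<Rightarrow> 0 | Suc k \<Rightarrow> sum t {..k})"
  have pos: "0 < t i" "0 < t' i" using nd nd' i by (auto simp: nondegenerate_def)
  have a: "a < sum t {..i}" "a < sum t' {..i}" "0 \<le> a"
    using pos prev simplex_nonneg[OF t] simplex_nonneg[OF t'] by (auto simp: a_def sum_nonneg split: nat.split)
  have a1: "a < 1" using a(1) cumulative_le_one(1)[OF t, of i] by linarith
  have val: "step_function G (n, x, t) s = partial_prod G x i" if "a \<le> s" "s < sum t {..i}" for s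
  proof -
    have "step_index t s = i"
      using that by (intro step_index_eqI[OF t]) (auto simp: a_def)
    moreover have "0 \<le> s" "s < 1" using that a(3) cumulative_le_one(1)[OF t, of i] by linarith+
    ultimately show ?thesis by (simp add: step_function_def)
  qed
  have val': "step_function G (n', x', t') s = partial_prod G x' i" if "a \<le> s" "s < sum t' {..i}" for s
  proof -
    have "step_index t' s = i"
      using that prev by (intro step_index_eqI[OF t']) (auto simp: a_def)
    moreover have "0 \<le> s" "s < 1" using that a(3) cumulative_le_one(1)[OF t', of i] by linarith+
    ultimately show ?thesis by (simp add: step_function_def)
  qed
  show eqi: "partial_prod G x i = partial_prod G x' i"
    using val[of a] val'[of a] a eq by simp
  show "\<not> sum t {..i} < sum t' {..i}"
  proof
    let ?b = "sum t {..i}"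
    assume less: "?b < sum t' {..i}"
    then have b1: "?b < 1" using cumulative_le_one(1)[OF t', of i] by linarith
    then have "i < n" using cumulative_le_one(2)[OF t, of i] by (cases "n \<le> i") auto
    then have nx: "0 < t (Suc i)" "x (Suc i) \<noteq> \<one>" using nd by (auto simp: nondegenerate_def)
    have "step_index t ?b = Suc i"
      using nx(1) by (intro step_index_eqI[OF t]) auto
    then have "step_function G (n, x, t) ?b = partial_prod G x (Suc i)"
      using b1 a by (simp add: step_function_def)
    moreover have "step_function G (n', x', t') ?b = partial_prod G x' i"
      using val'[of ?b] less a(1) by simp
    ultimately have "partial_prod G x i \<otimes> x (Suc i) = partial_prod G x i" using eq eqi by simp
    then have "x (Suc i) = \<one>"
      using partial_prod_closed[OF x, of i] bar_tuples_closed[OF x, of "Suc i"] \<open>i < n\<close>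
      by (simp add: r_cancel_one')
    then show False using nx by blast
  qed
qed

text \<open>
  The end points and values of the intervals are recovered from left to right.
\<close>

lemma normal_form_unique:
  assumes a: "a \<in> topspace (prerealization (E_simp G T q))" "nondegenerate a"
    and b: "b \<in> topspace (prerealization (E_simp G T r))" "nondegenerate b"
    and eq: "step_function G a = step_function G b"
  shows "a = b"
proof -
  obtain n x t where a': "a = (n, x, t)" by (cases a)
  obtain n' x' t' where b': "b = (n', x', t')" by (cases b)
  have x: "x \<in> bar_tuples G 0 q n" and t: "t \<in> standard_simplex n"
    using a by (simp_all add: a' topspace_prerealization_E)
  have x': "x' \<in> bar_tuples G 0 r n'" and t': "t' \<in> standard_simplex n'"
    using b by (simp_all add: b' topspace_prerealization_E)
  note nd = a(2)[unfolded a'] and nd' = b(2)[unfolded b']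
  note eq1 = eq[unfolded a' b']
  have main: "i \<le> n \<Longrightarrow> i \<le> n' \<Longrightarrow> sum t {..i} = sum t' {..i} \<and> partial_prod G x i = partial_prod G x' i" for i
  proof (induction i rule: less_induct)
    case (less i)
    have prev: "sum t {..k} = sum t' {..k}" if "i = Suc k" for k using less that by auto
    from nondegenerate_cumulative_not_less[OF x t nd x' t' nd' eq1 less.prems prev]
      nondegenerate_cumulative_not_less(1)[OF x' t' nd' x t nd eq1[symmetric] less.prems(2,1) prev[symmetric]]
    show ?case by (simp add: not_less)
  qed
  have last: False if "n < n'" "sum t {..n} = sum t' {..n}" "t \<in> standard_simplex n" "t' \<in> standard_simplex n'"
    "\<forall>i\<le>n'. 0 < t' i" for n n' and t t' :: "nat \<Rightarrow> real"
    using cumulative_strict_mono[OF that(4,1)] that(2,5) simplex_sum[OF that(3)] simplex_sum[OF that(4)] by simp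
  have n: "n = n'"
  proof (rule linorder_cases)
    assume "n < n'"
    then show ?thesis using last[OF _ _ t t'] main[of n] nd' by (auto simp: nondegenerate_def)
  next
    assume "n' < n"
    then show ?thesis using last[of n' n, OF _ _ t' t] main[of n'] nd by (auto simp: nondegenerate_def)
  qed
  have "t i = t' i" for i
  proof (cases "i \<le> n")
    case True
    show ?thesis
    proof (cases i)
      case 0
      then show ?thesis using main[of 0] by simp
    next
      case (Suc k)
      then show ?thesis using main[of i] main[of k] True n by simp
    qed
  next
    case False
    then show ?thesis using simplex_zero[OF t, of i] simplex_zero[OF t', of i] n by simp
  qed
  moreover have "x = x'"
  proof (rule bar_tuples_eqI[OF x])
    show "x' \<in> bar_tuples G 0 r n" using x' n by simp
    fix i assume i: "i \<le> n"
    show "x i = x' i"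
    proof (cases i)
      case 0
      then show ?thesis using main[of 0] by simp
    next
      case (Suc k)
      then have "partial_prod G x k \<otimes> x i = partial_prod G x k \<otimes> x' i"
        using main[of i] main[of k] i n by simp
      then show ?thesis
        using Suc i n bar_tuples_closed[OF x, of i] bar_tuples_closed[OF x', of i] partial_prod_closed[OF x, of k]
        by simp
    qed
  qed
  ultimately show ?thesis using a' b' n by auto
qed

text \<open>
  The step function determines the nondegenerate point to which a point can be reduced, hence its
  class.
\<close>

lemma equivclp_glue_E_iff:
  assumes q: "1 \<le> q" and a: "a \<in> topspace (prerealization (E_simp G T q))"
    and b: "b \<in> topspace (prerealization (E_simp G T q))"
  shows "equivclp (glue (E_simp G T q)) a b \<longleftrightarrow> step_function G a = step_function G b"
proof
  assume "equivclp (glue (E_simp G T q)) a b"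
  then show "step_function G a = step_function G b"
    by (rule equivclp_step_function)
next
  assume eq: "step_function G a = step_function G b"
  obtain a' where a': "a' \<in> topspace (prerealization (E_simp G T q))" "nondegenerate a'"
    "equivclp (glue (E_simp G T q)) a a'" using normal_form_exists[OF q a] by blast
  obtain b' where b': "b' \<in> topspace (prerealization (E_simp G T q))" "nondegenerate b'"
    "equivclp (glue (E_simp G T q)) b b'" using normal_form_exists[OF q b] by blast
  have "step_function G a' = step_function G b'"
    using equivclp_step_function[OF a'(3)] equivclp_step_function[OF b'(3)] eq
    by simp
  then have "a' = b'" by (rule normal_form_unique[OF a'(1,2) b'(1,2)])
  then show "equivclp (glue (E_simp G T q)) a b"
    using equivclp_trans[OF a'(3) equivclp_sym] b'(3) by simp
qed

lemma glue_class_E_eq_iff: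
  assumes "1 \<le> q" "a \<in> topspace (prerealization (E_simp G T q))" "b \<in> topspace (prerealization (E_simp G T q))"
  shows "glue_class (E_simp G T q) a = glue_class (E_simp G T q) b \<longleftrightarrow> step_function G a = step_function G b"
  using glue_class_eq_iff[OF assms(2,3)] equivclp_glue_E_iff[OF assms] by simp

text \<open>
  Reducing a degenerate point lowers its dimension strictly.
\<close>

lemma nondegenerate_minimal:
  assumes q: "1 \<le> q" and a: "a \<in> topspace (prerealization (E_simp G T q))"
    and b: "b \<in> topspace (prerealization (E_simp G T q))" and "fst a \<le> fst b" "nondegenerate b"
    and eq: "step_function G a = step_function G b"
  shows "a = b"
proof -
  obtain a' where a': "a' \<in> topspace (prerealization (E_simp G T q))" "nondegenerate a'"
    "equivclp (glue (E_simp G T q)) a a'" "fst a' < fst a \<or> a' = a" using normal_form_exists[OF q a] by blast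
  have "step_function G a' = step_function G b"
    using equivclp_step_function[OF a'(3)] eq by simp
  then have "a' = b" by (rule normal_form_unique[OF a'(1,2) b assms(5)])
  then show ?thesis using a'(4) assms(4) by auto
qed

end

section \<open>The projection from E to B\<close>

context topological_group
begin

lemma step_function_closed:
  assumes "a \<in> topspace (prerealization (E_simp G T q))" "s \<in> {0..<1}"
  shows "step_function G a s \<in> carrier G"
proof -
  obtain n x t where a: "a = (n, x, t)" by (cases a)
  have x: "x \<in> bar_tuples G 0 q n" and t: "t \<in> standard_simplex n"
    using assms(1) by (simp_all add: a topspace_prerealization_E)
  show ?thesis
    using step_index(2)[OF t, of s] partial_prod_closed[OF x] assms(2) by (simp add: a step_function_def)
qed

lemma partial_prod_act:
  assumes "g \<in> carrier G" "x \<in> bar_tuples G 0 q n"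
  shows "i \<le> n \<Longrightarrow> partial_prod G (act_simp g n x) i = g \<otimes> partial_prod G x i"
proof (induction i)
  case (Suc i)
  then show ?case
    using assms partial_prod_closed[OF assms(2), of i] bar_tuples_closed[OF assms(2), of "Suc i"]
    by (simp add: act_simp_def m_assoc)
qed (simp add: act_simp_def)

lemma step_function_act:
  assumes "g \<in> carrier G" "a \<in> topspace (prerealization (E_simp G T q))"
  shows "step_function G (map_point (act_simp g) a) = (\<lambda>s\<in>{0..<1}. g \<otimes> step_function G a s)"
proof -
  obtain n x t where a: "a = (n, x, t)" by (cases a)
  have x: "x \<in> bar_tuples G 0 q n" and t: "t \<in> standard_simplex n"
    using assms(2) by (simp_all add: a topspace_prerealization_E)
  show ?thesis
    using step_index(2)[OF t] partial_prod_act[OF assms(1) x] by (auto simp: a step_function_def)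
qed

definition unit_lift :: "(nat \<Rightarrow> 'a) simplex_point \<Rightarrow> (nat \<Rightarrow> 'a) simplex_point" where
  "unit_lift = (\<lambda>(n, y, t). (n, y(0 := \<one>), t))"

lemma unit_lift_in_tuples:
  assumes "y \<in> bar_tuples G 1 q n"
  shows "y(0 := \<one>) \<in> bar_tuples G 0 q n"
proof -
  have "restrict (y(0 := \<one>)) {1..n} = restrict y {1..n}" by auto
  moreover have "y(0 := \<one>) \<in> {0..n} \<rightarrow>\<^sub>E carrier G"
  proof (rule PiE_I)
    fix k assume "k \<in> {0..n}"
    then show "(y(0 := \<one>)) k \<in> carrier G"
      using bar_tuples_closed[OF assms, of k] by (cases "k = 0") auto
  next
    fix k assume "k \<notin> {0..n}"
    then show "(y(0 := \<one>)) k = undefined" using bar_tuples_arb[OF assms, of k] by auto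
  qed
  ultimately show ?thesis using assms by (simp add: bar_tuples_def)
qed

lemma unit_lift_in:
  assumes "b \<in> topspace (prerealization (B_simp G T q))"
  shows "unit_lift b \<in> topspace (prerealization (E_simp G T q))"
proof -
  obtain n y t where b: "b = (n, y, t)" by (cases b)
  then show ?thesis
    using assms unit_lift_in_tuples unfolding b unit_lift_def prod.case
    by (simp only: topspace_prerealization_E topspace_prerealization_B)
qed

text \<open>
  Points of B are step functions up to left translation. Dividing by the value at \<open>0\<close> picks a
  representative.
\<close>

definition ratio_function :: "(nat \<Rightarrow> 'a) simplex_point \<Rightarrow> real \<Rightarrow> 'a" where
  "ratio_function b =
     (\<lambda>s\<in>{0..<1}. inv (step_function G (unit_lift b) 0) \<otimes> step_function G (unit_lift b) s)"

lemma inv_mult_cancel_left: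
  "\<lbrakk>h \<in> carrier G; u \<in> carrier G; v \<in> carrier G\<rbrakk> \<Longrightarrow> inv (h \<otimes> u) \<otimes> (h \<otimes> v) = inv u \<otimes> v"
  by (metis inv_closed inv_mult_group inv_solve_left m_assoc m_closed)

lemma ratio_function_translate:
  assumes "h \<in> carrier G" "a \<in> topspace (prerealization (E_simp G T q))"
    "step_function G (unit_lift b) = (\<lambda>s\<in>{0..<1}. h \<otimes> step_function G a s)"
  shows "ratio_function b = (\<lambda>s\<in>{0..<1}. inv (step_function G a 0) \<otimes> step_function G a s)"
  unfolding ratio_function_def assms(3)
  using step_function_closed[OF assms(2)] assms(1) by (auto simp: inv_mult_cancel_left)

text \<open>
  Among the faces of B only the one with number \<open>0\<close> is not the restriction of the corresponding face of
  E to tuples starting with \<open>1\<close>: it leaves the value \<open>y\<^sub>1\<close> in front, which is lost in the ratio.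
\<close>

lemma ratio_function_glue:
  assumes q: "1 \<le> q" and "glue (B_simp G T q) u v"
  shows "ratio_function u = ratio_function v"
  using assms(2)
proof cases
  case (face n i y t)
  then have y: "y \<in> bar_tuples G 1 q n" by (simp add: topspace_level_B)
  have fd: "face (B_simp G T q) = bar_face G 1" "face (E_simp G T q) = bar_face G 0"
    by (simp_all add: B_simp_def E_simp_def)
  define h where "h = (if i = 0 then y 1 else \<one>)"
  have h: "h \<in> carrier G" using bar_tuples_closed[OF y, of 1] face(3) by (simp add: h_def)
  have y': "bar_face G 1 n i y \<in> bar_tuples G 1 q (n - 1)"
    by (rule bar_face_in_tuples[OF q le_refl face(3,4) y])
  have u: "unit_lift u = (n - 1, (bar_face G 1 n i y)(0 := \<one>), t)"
    by (simp add: face(1) unit_lift_def fd)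
  have v: "unit_lift v = (n, y(0 := \<one>), simplical_face i t)" by (simp add: face(2) unit_lift_def)
  have u': "unit_lift u \<in> topspace (prerealization (E_simp G T q))"
    unfolding u topspace_prerealization_E using unit_lift_in_tuples[OF y'] face(6) by blast
  have "bar_face G 0 n i (y(0 := \<one>)) = act_simp h (n - 1) ((bar_face G 1 n i y)(0 := \<one>))"
  proof
    fix k
    have "y 1 \<in> carrier G" using bar_tuples_closed[OF y, of 1] face(3) by simp
    then show "bar_face G 0 n i (y(0 := \<one>)) k = act_simp h (n - 1) ((bar_face G 1 n i y)(0 := \<one>)) k"
      using face(3,4) by (cases k) (auto simp: bar_face_def act_simp_def h_def)
  qed
  moreover have "glue (E_simp G T q) (n - 1, bar_face G 0 n i (y(0 := \<one>)), t) (n, y(0 := \<one>), simplical_face i t)"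
    using glue.face[of n i "y(0 := \<one>)" "E_simp G T q" t] unit_lift_in_tuples[OF y] face
    unfolding fd topspace_level_E by blast
  ultimately have "step_function G (unit_lift v) = step_function G (map_point (act_simp h) (unit_lift u))"
    using step_function_glue unfolding u v by fastforce
  also have "\<dots> = (\<lambda>s\<in>{0..<1}. h \<otimes> step_function G (unit_lift u) s)"
    by (rule step_function_act[OF h u'])
  finally show ?thesis using ratio_function_translate[OF h u'] unfolding ratio_function_def by simp
next
  case (degen j n y t)
  then have y: "y \<in> bar_tuples G 1 q n" by (simp add: topspace_level_B)
  have fd: "degen (B_simp G T q) = bar_degen G 1" "degen (E_simp G T q) = bar_degen G 0"
    by (simp_all add: B_simp_def E_simp_def)
  have "bar_degen G 0 n j (y(0 := \<one>)) = (bar_degen G 1 n j y)(0 := \<one>)"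
    using degen(3) by (intro ext) (auto simp: bar_degen_def)
  moreover have "glue (E_simp G T q) (n + 1, bar_degen G 0 n j (y(0 := \<one>)), t) (n, y(0 := \<one>), simplex_codegen j t)"
    using glue.degen[of j n "y(0 := \<one>)" "E_simp G T q" t] unit_lift_in_tuples[OF y] degen
    unfolding fd topspace_level_E by blast
  ultimately have "glue (E_simp G T q) (unit_lift u) (unit_lift v)"
    unfolding degen(1,2) unit_lift_def prod.case fd by simp
  then have "step_function G (unit_lift u) = step_function G (unit_lift v)"
    by (rule step_function_glue)
  then show ?thesis by (simp add: ratio_function_def)
qed

lemma map_point_p_in:
  "\<lbrakk>1 \<le> q; a \<in> topspace (prerealization (E_simp G T q))\<rbrakk>
    \<Longrightarrow> map_point p_simp a \<in> topspace (prerealization (B_simp G T q))"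
  by (rule map_point_in_prerealization[OF simplicial_map_p])

lemma map_point_act_in:
  "\<lbrakk>1 \<le> q; g \<in> carrier G; a \<in> topspace (prerealization (E_simp G T q))\<rbrakk>
    \<Longrightarrow> map_point (act_simp g) a \<in> topspace (prerealization (E_simp G T q))"
  by (rule map_point_in_prerealization[OF simplicial_map_act])

lemma ratio_function_p:
  assumes a: "a \<in> topspace (prerealization (E_simp G T q))" and q: "1 \<le> q"
  shows "ratio_function (map_point p_simp a) =
    (\<lambda>s\<in>{0..<1}. inv (step_function G a 0) \<otimes> step_function G a s)"
proof -
  obtain n x t where a': "a = (n, x, t)" by (cases a)
  have x: "x \<in> bar_tuples G 0 q n" using a by (simp add: a' topspace_prerealization_E)
  have x0: "x 0 \<in> carrier G" using bar_tuples_closed[OF x] by simp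
  have "(p_simp n x)(0 := \<one>) = act_simp (inv x 0) n x"
  proof
    fix k
    show "((p_simp n x)(0 := \<one>)) k = act_simp (inv x 0) n x k"
      using x0 bar_tuples_arb[OF x, of k] by (auto simp: p_simp_def act_simp_def)
  qed
  then have "unit_lift (map_point p_simp a) = map_point (act_simp (inv x 0)) a"
    by (simp add: a' unit_lift_def)
  then have "step_function G (unit_lift (map_point p_simp a)) = (\<lambda>s\<in>{0..<1}. inv x 0 \<otimes> step_function G a s)"
    using step_function_act[OF inv_closed[OF x0] a] by simp
  then show ?thesis by (rule ratio_function_translate[OF inv_closed[OF x0] a])
qed

lemma glue_class_B_eqD:
  assumes q: "1 \<le> q" and a: "a \<in> topspace (prerealization (E_simp G T q))"
    and b: "b \<in> topspace (prerealization (E_simp G T q))"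
    and eq: "glue_class (B_simp G T q) (map_point p_simp a) = glue_class (B_simp G T q) (map_point p_simp b)"
  shows "\<exists>g\<in>carrier G. glue_class (E_simp G T q) (map_point (act_simp g) a) = glue_class (E_simp G T q) b"
proof -
  let ?f = "step_function G a" and ?h = "step_function G b"
  have "equivclp (glue (B_simp G T q)) (map_point p_simp a) (map_point p_simp b)"
    using eq glue_class_eq_iff[OF map_point_p_in[OF q a] map_point_p_in[OF q b]] by simp
  then have "ratio_function (map_point p_simp a) = ratio_function (map_point p_simp b)"
    by (rule equivclp_invariant[where F = ratio_function, rotated]) (rule ratio_function_glue[OF q])
  then have eq': "(\<lambda>s\<in>{0..<1}. inv (?f 0) \<otimes> ?f s) = (\<lambda>s\<in>{0..<1}. inv (?h 0) \<otimes> ?h s)"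
    unfolding ratio_function_p[OF a q] ratio_function_p[OF b q] .
  have r: "inv (?f 0) \<otimes> ?f s = inv (?h 0) \<otimes> ?h s" if "s \<in> {0..<1}" for s
    using fun_cong[OF eq', of s] that by simp
  define g where "g = ?h 0 \<otimes> inv ?f 0"
  have c: "?f 0 \<in> carrier G" "?h 0 \<in> carrier G"
    using step_function_closed[OF a, of 0] step_function_closed[OF b, of 0] by simp_all
  then have g: "g \<in> carrier G" by (simp add: g_def)
  have "g \<otimes> ?f s = ?h s" if s: "s \<in> {0..<1}" for s
  proof -
    have cs: "?f s \<in> carrier G" "?h s \<in> carrier G"
      using step_function_closed[OF a s] step_function_closed[OF b s] by simp_all
    have "g \<otimes> ?f s = ?h 0 \<otimes> (inv ?h 0 \<otimes> ?h s)"
      using r[OF s] c cs by (simp add: g_def m_assoc)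
    also have "\<dots> = ?h s" using c cs by (simp flip: m_assoc)
    finally show ?thesis .
  qed
  then have "step_function G (map_point (act_simp g) a) = (\<lambda>s\<in>{0..<1}. ?h s)"
    unfolding step_function_act[OF g a] by auto
  also have "\<dots> = ?h" by (auto simp: step_function_def split: prod.split)
  finally show ?thesis
    using glue_class_E_eq_iff[OF q map_point_act_in[OF q g a] b] g by blast
qed

abbreviation proj_EB :: "enat \<Rightarrow> (nat \<Rightarrow> 'a) simplex_point set \<Rightarrow> (nat \<Rightarrow> 'a) simplex_point set" where
  "proj_EB q \<equiv> realization_map (E_simp G T q) (B_simp G T q) p_simp"

abbreviation act_E :: "enat \<Rightarrow> 'a \<Rightarrow> (nat \<Rightarrow> 'a) simplex_point set \<Rightarrow> (nat \<Rightarrow> 'a) simplex_point set" where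
  "act_E q g \<equiv> realization_map (E_simp G T q) (E_simp G T q) (act_simp g)"

lemma act_E_in:
  "\<lbrakk>1 \<le> q; g \<in> carrier G; c \<in> topspace (E_space G T q)\<rbrakk> \<Longrightarrow> act_E q g c \<in> topspace (E_space G T q)"
  by (rule realization_map_in[OF simplicial_map_act])

lemma act_E_mult:
  assumes q: "1 \<le> q" and "g \<in> carrier G" "h \<in> carrier G" "c \<in> topspace (E_space G T q)"
  shows "act_E q g (act_E q h c) = act_E q (g \<otimes> h) c"
proof (rule realization_map_compose[OF simplicial_map_act[OF q assms(3)] simplicial_map_act[OF q assms(2)]
      simplicial_map_act[OF q m_closed[OF assms(2,3)]] _ assms(4)])
  fix n x assume "x \<in> topspace (level (E_simp G T q) n)"
  then have "x 0 \<in> carrier G" using bar_tuples_closed[of x G 0 q n 0] by (simp add: topspace_level_E)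
  then show "act_simp (g \<otimes> h) n x = act_simp g n (act_simp h n x)"
    using assms by (auto simp: act_simp_def m_assoc)
qed

lemma act_E_one:
  assumes q: "1 \<le> q" and "c \<in> topspace (E_space G T q)"
  shows "act_E q \<one> c = c"
proof (rule realization_map_ident[OF simplicial_map_act[OF q one_closed] _ assms(2)])
  fix n x assume "x \<in> topspace (level (E_simp G T q) n)"
  then have "x 0 \<in> carrier G" using bar_tuples_closed[of x G 0 q n 0] by (simp add: topspace_level_E)
  then show "act_simp \<one> n x = x" by (simp add: act_simp_def)
qed

lemma act_E_inv:
  assumes "1 \<le> q" "g \<in> carrier G" "c \<in> topspace (E_space G T q)"
  shows "act_E q (inv g) (act_E q g c) = c" "act_E q g (act_E q (inv g) c) = c"
  using assms act_E_mult[OF assms(1)] act_E_one[OF assms(1)] by auto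

lemma proj_act:
  assumes q: "1 \<le> q" and g: "g \<in> carrier G" and c: "c \<in> topspace (E_space G T q)"
  shows "proj_EB q (act_E q g c) = proj_EB q c"
  by (rule realization_map_compose[OF simplicial_map_act[OF q g] simplicial_map_p[OF q] simplicial_map_p[OF q] _ c])
     (auto simp: p_simp_def act_simp_def)

lemma proj_eqD:
  assumes q: "1 \<le> q" and c: "c \<in> topspace (E_space G T q)" and d: "d \<in> topspace (E_space G T q)"
    and eq: "proj_EB q c = proj_EB q d"
  shows "\<exists>g\<in>carrier G. act_E q g c = d"
proof -
  obtain a where a: "a \<in> topspace (prerealization (E_simp G T q))" "c = glue_class (E_simp G T q) a"
    using c by (auto simp: topspace_realization)
  obtain b where b: "b \<in> topspace (prerealization (E_simp G T q))" "d = glue_class (E_simp G T q) b"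
    using d by (auto simp: topspace_realization)
  have "glue_class (B_simp G T q) (map_point p_simp a) = glue_class (B_simp G T q) (map_point p_simp b)"
    using eq unfolding a(2) b(2) by (simp only: realization_map_glue_class[OF simplicial_map_p[OF q]] a(1) b(1))
  from glue_class_B_eqD[OF q a(1) b(1) this] obtain g where g: "g \<in> carrier G"
    "glue_class (E_simp G T q) (map_point (act_simp g) a) = glue_class (E_simp G T q) b" by blast
  then show ?thesis
    unfolding a(2) b(2) by (intro bexI[of _ g]) (simp_all only: realization_map_glue_class[OF simplicial_map_act[OF q g(1)] a(1)])
qed

lemma continuous_proj: "1 \<le> q \<Longrightarrow> continuous_map (E_space G T q) (B_space G T q) (proj_EB q)"
  by (rule continuous_realization_map[OF simplicial_map_p])

lemma continuous_act_E:
  "\<lbrakk>1 \<le> q; g \<in> carrier G\<rbrakk> \<Longrightarrow> continuous_map (E_space G T q) (E_space G T q) (act_E q g)"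
  by (rule continuous_realization_map[OF simplicial_map_act])

text \<open>
  Putting \<open>1\<close> in front of a tuple gives a continuous section before gluing, and the gluing map of B is a
  quotient map.
\<close>

lemma quotient_map_proj:
  assumes q: "1 \<le> q"
  shows "quotient_map (E_space G T q) (B_space G T q) (proj_EB q)"
proof (rule quotient_map_from_composition)
  let ?s = "\<lambda>b. glue_class (E_simp G T q) (unit_lift b)"
  show "continuous_map (prerealization (B_simp G T q)) (E_space G T q) ?s"
    unfolding continuous_map_prerealization
  proof
    fix n
    have "continuous_map (cell (B_simp G T q) n) (cell (E_simp G T q) n) (\<lambda>y. ((fst y)(0 := \<one>), snd y))"
    proof (rule continuous_map_pairedI)
      show "continuous_map (cell (B_simp G T q) n) (level (E_simp G T q) n) (\<lambda>y. (fst y)(0 := \<one>))"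
      proof (rule continuous_map_into_level_E)
        fix k assume "k \<le> n"
        then show "continuous_map (cell (B_simp G T q) n) T (\<lambda>y. ((fst y)(0 := \<one>)) k)"
          using continuous_map_compose[OF continuous_map_fst continuous_entry_B[of k n q]]
          by (cases "k = 0") (auto simp: topspace_eq o_def)
      next
        fix y assume "y \<in> topspace (cell (B_simp G T q) n)"
        then have "fst y \<in> bar_tuples G 1 q n" unfolding topspace_prod_topology topspace_level_B by auto
        then show "(fst y)(0 := \<one>) \<in> bar_tuples G 0 q n" by (rule unit_lift_in_tuples)
      qed
    qed (rule continuous_map_snd)
    from continuous_map_compose[OF this continuous_map_glue_class_cell]
    show "continuous_map (cell (B_simp G T q) n) (E_space G T q) (\<lambda>y. ?s (n, y))"
      by (simp add: o_def unit_lift_def case_prod_unfold)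
  qed
  show "continuous_map (E_space G T q) (B_space G T q) (proj_EB q)" by (rule continuous_proj[OF q])
  have "proj_EB q (?s b) = glue_class (B_simp G T q) b" if b: "b \<in> topspace (prerealization (B_simp G T q))" for b
  proof -
    obtain n y t where b': "b = (n, y, t)" by (cases b)
    have y: "y \<in> bar_tuples G 1 q n" using b by (simp add: b' topspace_prerealization_B)
    have "p_simp n (y(0 := \<one>)) = y"
    proof
      fix k
      show "p_simp n (y(0 := \<one>)) k = y k"
        using bar_tuples_arb[OF y, of k] by (auto simp: p_simp_def)
    qed
    then show ?thesis
      using realization_map_glue_class[OF simplicial_map_p[OF q] unit_lift_in[OF b]]
      by (simp add: b' unit_lift_def)
  qed
  then show "quotient_map (prerealization (B_simp G T q)) (B_space G T q) (proj_EB q \<circ> ?s)"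
    by (intro quotient_map_eq[OF quotient_map_glue_class]) simp
qed

lemma proj_surj: "1 \<le> q \<Longrightarrow> proj_EB q ` topspace (E_space G T q) = topspace (B_space G T q)"
  using quotient_map_proj by (simp add: quotient_map_def)

text \<open>The projection divides by a group action, so it is open.\<close>

lemma open_map_proj:
  assumes q: "1 \<le> q"
  shows "open_map (E_space G T q) (B_space G T q) (proj_EB q)"
  unfolding open_map_def
proof (intro allI impI)
  fix U assume U: "openin (E_space G T q) U"
  then have Us: "U \<subseteq> topspace (E_space G T q)" by (rule openin_subset)
  have eq: "{x \<in> topspace (E_space G T q). proj_EB q x \<in> proj_EB q ` U} =
      (\<Union>g\<in>carrier G. {x \<in> topspace (E_space G T q). act_E q g x \<in> U})"
  proof (rule subset_antisym; rule subsetI)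
    fix x assume "x \<in> {x \<in> topspace (E_space G T q). proj_EB q x \<in> proj_EB q ` U}"
    then obtain u where u: "u \<in> U" "x \<in> topspace (E_space G T q)" "proj_EB q x = proj_EB q u" by blast
    then show "x \<in> (\<Union>g\<in>carrier G. {x \<in> topspace (E_space G T q). act_E q g x \<in> U})"
      using proj_eqD[OF q u(2) _ u(3)] Us by blast
  next
    fix x assume "x \<in> (\<Union>g\<in>carrier G. {x \<in> topspace (E_space G T q). act_E q g x \<in> U})"
    then obtain g where g: "g \<in> carrier G" "x \<in> topspace (E_space G T q)" "act_E q g x \<in> U" by blast
    then have "proj_EB q x = proj_EB q (act_E q g x)" using proj_act[OF q g(1,2)] by simp
    then show "x \<in> {x \<in> topspace (E_space G T q). proj_EB q x \<in> proj_EB q ` U}" using g by blast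
  qed
  have "openin (E_space G T q) (\<Union>g\<in>carrier G. {x \<in> topspace (E_space G T q). act_E q g x \<in> U})"
    by (intro openin_Union ballI) (auto intro: openin_continuous_map_preimage[OF continuous_act_E[OF q] U])
  then have op: "openin (E_space G T q) {x \<in> topspace (E_space G T q). proj_EB q x \<in> proj_EB q ` U}"
    unfolding eq .
  have sub: "proj_EB q ` U \<subseteq> topspace (B_space G T q)" using Us proj_surj[OF q] by blast
  from quotient_map_proj[OF q]
  have "\<forall>V\<subseteq>topspace (B_space G T q). openin (E_space G T q) {x \<in> topspace (E_space G T q). proj_EB q x \<in> V} =
      openin (B_space G T q) V"
    unfolding quotient_map_def by (rule conjunct2)
  from this[rule_format, OF sub] op show "openin (B_space G T q) (proj_EB q ` U)" by simp
qed

end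

section \<open>The filtration consists of closed subspaces\<close>

lemma closedin_piece:
  assumes A: "closedin X A" and \<rho>: "continuous_map (subtopology X A) Y \<rho>"
    and Q: "closedin Y {y \<in> topspace Y. d y \<in> Q}" and eq: "\<And>x. x \<in> A \<Longrightarrow> d (\<rho> x) = c x"
  shows "closedin X {x \<in> A. c x \<in> Q}"
proof -
  have tA: "topspace (subtopology X A) = A" using closedin_subset[OF A] by auto
  have "\<rho> x \<in> topspace Y" if "x \<in> A" for x using \<rho> that unfolding continuous_map_def tA by blast
  then have "{x \<in> topspace (subtopology X A). \<rho> x \<in> {y \<in> topspace Y. d y \<in> Q}} = {x \<in> A. c x \<in> Q}"
    using eq unfolding tA by auto
  then have "closedin (subtopology X A) {x \<in> A. c x \<in> Q}"
    using closedin_continuous_map_preimage[OF \<rho> Q] by simp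
  then show ?thesis using A by (rule closedin_trans_full)
qed

context topological_group
begin

lemma partial_prod_generate:
  assumes z: "z \<in> bar_tuples G 0 q k"
  shows "j \<le> k \<Longrightarrow> \<exists>h \<in> generate G (z ` {1..k}). partial_prod G z j = z 0 \<otimes> h"
proof (induction j)
  case 0
  then show ?case using bar_tuples_closed[OF z, of 0] generate.one by (intro bexI[of _ \<one>]) (auto intro: generate.one)
next
  case (Suc j)
  have sub: "z ` {1..k} \<subseteq> carrier G" using bar_tuples_closed[OF z] by auto
  from Suc obtain h where h: "h \<in> generate G (z ` {1..k})" "partial_prod G z j = z 0 \<otimes> h" by auto
  have zj: "z (Suc j) \<in> generate G (z ` {1..k})" using Suc.prems by (intro generate.incl) auto
  have "partial_prod G z (Suc j) = z 0 \<otimes> (h \<otimes> z (Suc j))"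
    using h generate_in_carrier[OF sub h(1)] generate_in_carrier[OF sub zj] bar_tuples_closed[OF z, of 0]
    by (simp add: m_assoc)
  then show ?case using generate.eng[OF h(1) zj] by blast
qed

text \<open>
  The entries of a tuple are the quotients of consecutive values of its step function, provided that
  no interval has length zero. So the subgroup generated by the entries is contained in the one of
  any other point with the same step function.
\<close>

lemma interior_point_in_tuples:
  assumes q: "1 \<le> q" and x: "x \<in> bar_tuples G 0 r n" and t: "t \<in> standard_simplex n"
    and pos: "\<And>i. i \<le> n \<Longrightarrow> 0 < t i"
    and z: "z \<in> bar_tuples G 0 q k" and s: "s \<in> standard_simplex k"
    and eq: "step_function G (n, x, t) = step_function G (k, z, s)"
  shows "x \<in> bar_tuples G 0 q n"
proof (rule bar_tuples_subgroup[OF q zero_le z])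
  show "x \<in> {0..n} \<rightarrow>\<^sub>E carrier G" using x by (simp add: bar_tuples_def)
  have sub: "z ` {1..k} \<subseteq> carrier G" using bar_tuples_closed[OF z] by auto
  have z0: "z 0 \<in> carrier G" using bar_tuples_closed[OF z] by simp
  have val: "\<exists>h \<in> generate G (z ` {1..k}). partial_prod G x i = z 0 \<otimes> h" if i: "i \<le> n" for i
  proof -
    define a where "a = (case i of 0 \<Rightarrow> 0 | Suc k \<Rightarrow> sum t {..k})"
    have a: "a < sum t {..i}" "0 \<le> a"
      using pos[OF i] simplex_nonneg[OF t] by (auto simp: a_def sum_nonneg split: nat.split)
    have a1: "a < 1" using a(1) cumulative_le_one(1)[OF t, of i] by linarith
    have "step_index t a = i"
      using a by (intro step_index_eqI[OF t]) (auto simp: a_def)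
    then have "partial_prod G x i = step_function G (n, x, t) a"
      using a a1 by (simp add: step_function_def)
    also have "\<dots> = partial_prod G z (step_index s a)"
      using a a1 unfolding eq by (simp add: step_function_def)
    finally show ?thesis
      using partial_prod_generate[OF z step_index(2)[OF s a1]] by simp
  qed
  have "x i \<in> generate G (z ` {1..k})" if i: "i \<in> {1..n}" for i
  proof -
    obtain j where j: "i = Suc j" using i by (cases i) auto
    obtain h where h: "h \<in> generate G (z ` {1..k})" "partial_prod G x j = z 0 \<otimes> h"
      using val[of j] i j by auto
    obtain h' where h': "h' \<in> generate G (z ` {1..k})" "partial_prod G x i = z 0 \<otimes> h'"
      using val[of i] i by auto
    have c: "h \<in> carrier G" "h' \<in> carrier G" "x i \<in> carrier G"
      using generate_in_carrier[OF sub] h(1) h'(1) bar_tuples_closed[OF x, of i] i by auto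
    have "z 0 \<otimes> (h \<otimes> x i) = z 0 \<otimes> h'" using h h' j c z0 by (simp add: m_assoc)
    then have "h \<otimes> x i = h'" using c z0 by simp
    then have "x i = inv h \<otimes> h'" using c by (metis inv_solve_left)
    then show ?thesis
      using h h' generate_m_inv_closed[OF sub h(1)] generate.eng by metis
  qed
  then show "x ` {1..n} \<subseteq> generate G (z ` {1..k})" by blast
qed auto

lemma continuous_map_face_drop:
  assumes q: "1 \<le> q" and n: "1 \<le> n" "i \<le> n"
  shows "continuous_map (subtopology (cell (E_simp G T q) n) {y \<in> topspace (cell (E_simp G T q) n). snd y i = 0})
    (cell (E_simp G T q) (n - 1)) (\<lambda>y. (bar_face G 0 n i (fst y), simplex_drop i (snd y)))"
    (is "continuous_map (subtopology ?X ?A) _ _")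
proof (rule continuous_map_pairedI)
  have "continuous_map (cell (E_simp G T q) n) (level (E_simp G T q) (n - 1)) (\<lambda>y. bar_face G 0 n i (fst y))"
    using continuous_map_compose[OF continuous_map_fst continuous_bar_face[OF q zero_le n]]
    unfolding E_simp_eq_bar_simp by (simp only: o_def)
  then show "continuous_map (subtopology ?X ?A) (level (E_simp G T q) (n - 1)) (\<lambda>y. bar_face G 0 n i (fst y))"
    by (rule continuous_map_from_subtopology)
  have "continuous_map (cell (E_simp G T q) n) (powertop_real UNIV) (\<lambda>y. simplex_drop i (snd y))"
    unfolding continuous_map_componentwise_UNIV
  proof
    fix k
    have "continuous_map (cell (E_simp G T q) n) euclideanreal (\<lambda>y. snd y j)" for j
      using continuous_map_compose[OF continuous_map_snd continuous_map_from_subtopology[OF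
            continuous_map_product_projection[of j UNIV "\<lambda>_. euclideanreal"]]]
      by (simp add: o_def)
    then show "continuous_map (cell (E_simp G T q) n) euclideanreal (\<lambda>y. simplex_drop i (snd y) k)"
      unfolding simplex_drop_def by (cases "k < i") simp_all
  qed
  then show "continuous_map (subtopology ?X ?A) (simplex_space (n - 1)) (\<lambda>y. simplex_drop i (snd y))"
    unfolding continuous_map_in_subtopology
  proof (intro conjI continuous_map_from_subtopology)
    show "(\<lambda>y. simplex_drop i (snd y)) \<in> topspace (subtopology ?X ?A) \<rightarrow> standard_simplex (n - 1)"
      using simplex_drop_in_simplex[OF _ n] by auto
  qed
qed

lemma glue_class_face_drop:
  assumes q: "1 \<le> q" and n: "1 \<le> n" "i \<le> n" and x: "x \<in> bar_tuples G 0 q n" and t: "t \<in> standard_simplex n" "t i = 0"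
  shows "glue_class (E_simp G T q) (n - 1, bar_face G 0 n i x, simplex_drop i t) = glue_class (E_simp G T q) (n, x, t)"
proof -
  have u: "simplex_drop i t \<in> standard_simplex (n - 1)" by (rule simplex_drop_in_simplex[OF t(1) n t(2)])
  have fd: "face (E_simp G T q) = bar_face G 0" by (simp add: E_simp_def)
  have "glue (E_simp G T q) (n - 1, bar_face G 0 n i x, simplex_drop i t) (n, x, t)"
    using glue.face[OF n _ u, of x "E_simp G T q"] x
    unfolding simplical_face_drop[of t i, OF t(2)] fd topspace_level_E by blast
  then have "equivclp (glue (E_simp G T q)) (n - 1, bar_face G 0 n i x, simplex_drop i t) (n, x, t)"
    by (rule r_into_equivclp)
  moreover have "(n - 1, bar_face G 0 n i x, simplex_drop i t) \<in> topspace (prerealization (E_simp G T q))"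
    "(n, x, t) \<in> topspace (prerealization (E_simp G T q))"
    unfolding topspace_prerealization_E using u x t bar_face_in_tuples[OF q zero_le n x] by blast+
  ultimately show ?thesis using glue_class_eq_iff by blast
qed

lemma closedin_zero_coordinate:
  "closedin (cell X n) {y \<in> topspace (cell X n). snd y i = 0}"
proof -
  have "continuous_map (cell X n) euclideanreal (\<lambda>y. snd y i)"
    using continuous_map_compose[OF continuous_map_snd continuous_map_from_subtopology[OF
          continuous_map_product_projection[of i UNIV "\<lambda>_. euclideanreal"]]]
    by (simp add: o_def)
  from closedin_continuous_map_preimage[OF this, of "{0}"] show ?thesis by simp
qed

lemma closedin_face_preimage:
  assumes q: "1 \<le> q" and n: "1 \<le> n" "i \<le> n"
    and Q: "closedin (cell (E_simp G T q) (n - 1)) {y \<in> topspace (cell (E_simp G T q) (n - 1)). glue_class (E_simp G T q) (n - 1, y) \<in> Q}"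
  shows "closedin (cell (E_simp G T q) n) {y \<in> topspace (cell (E_simp G T q) n). snd y i = 0 \<and> glue_class (E_simp G T q) (n, y) \<in> Q}"
proof -
  have "closedin (cell (E_simp G T q) n)
    {y \<in> {y \<in> topspace (cell (E_simp G T q) n). snd y i = 0}. glue_class (E_simp G T q) (n, y) \<in> Q}"
  proof (rule closedin_piece[OF closedin_zero_coordinate continuous_map_face_drop[OF q n] Q])
    fix y assume "y \<in> {y \<in> topspace (cell (E_simp G T q) n). snd y i = 0}"
    then have y: "fst y \<in> bar_tuples G 0 q n" "snd y \<in> standard_simplex n" "snd y i = 0"
      unfolding topspace_prod_topology topspace_level_E by auto
    show "glue_class (E_simp G T q) (n - 1, bar_face G 0 n i (fst y), simplex_drop i (snd y)) = glue_class (E_simp G T q) (n, y)"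
      using glue_class_face_drop[OF q n y] by simp
  qed
  then show ?thesis by simp
qed

lemma continuous_map_word_value:
  assumes "fst ` set w \<subseteq> {1..n}" "l \<le> 1"
  shows "continuous_map (subtopology (product_topology (\<lambda>_. T) {l..n}) S) T (\<lambda>x. word_value G (restrict x {1..n}) w)"
  using assms(1)
proof (induction w)
  case Nil
  then show ?case by (simp add: topspace_eq)
next
  case (Cons a w)
  have a: "fst a \<in> {1..n}" using Cons.prems by simp
  then have "continuous_map (subtopology (product_topology (\<lambda>_. T) {l..n}) S) T (\<lambda>x. x (fst a))"
    using assms(2) by (intro continuous_map_coordinate) auto
  then have "continuous_map (subtopology (product_topology (\<lambda>_. T) {l..n}) S) T (\<lambda>x. letter_value G (restrict x {1..n}) a)"
    using a by (cases "snd a") (simp_all add: letter_value_def continuous_map_inv_pointwise)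
  moreover have "continuous_map (subtopology (product_topology (\<lambda>_. T) {l..n}) S) T (\<lambda>x. word_value G (restrict x {1..n}) w)"
    by (rule Cons.IH) (use Cons.prems in auto)
  ultimately show ?case unfolding word_value_simps by (rule continuous_map_mult_pointwise)
qed

lemma closedin_bar_tuples:
  assumes q: "1 \<le> q" "q \<le> r" and l: "l \<le> 1" and H: "Hausdorff_space T"
  shows "closedin (level (bar_simp G T l r) n) (bar_tuples G l q n)"
proof -
  let ?L = "level (bar_simp G T l r) n"
  have tL: "topspace ?L = bar_tuples G l r n" unfolding bar_simp_simps by (rule topspace_bar)
  have one: "closedin T {\<one>}" using H by (intro closedin_Hausdorff_singleton) (auto simp: topspace_eq)
  have gam: "fst ` set w \<subseteq> {1..n}" if "w \<in> free_gamma n q" for w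
    using that subgroup.subset[OF normal_imp_subgroup[OF group.lower_central_normal[OF group_free_group q(1)]]]
    by (auto simp: carrier_free_group)
  have "bar_tuples G l q n =
      topspace ?L \<inter> (\<Inter>w\<in>free_gamma n q. {x \<in> topspace ?L. word_value G (restrict x {1..n}) w \<in> {\<one>}})"
    unfolding tL
  proof (rule subset_antisym; rule subsetI)
    fix x assume "x \<in> bar_tuples G l q n"
    then show "x \<in> bar_tuples G l r n \<inter> (\<Inter>w\<in>free_gamma n q. {x \<in> bar_tuples G l r n. word_value G (restrict x {1..n}) w \<in> {\<one>}})"
      using bar_tuples_mono[OF q, of l n] hom_tuples_iff_word_value[OF q(1)] by (auto simp: bar_tuples_def)
  next
    fix x assume x: "x \<in> bar_tuples G l r n \<inter> (\<Inter>w\<in>free_gamma n q. {x \<in> bar_tuples G l r n. word_value G (restrict x {1..n}) w \<in> {\<one>}})"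
    then have xr: "x \<in> bar_tuples G l r n" by (rule IntD1)
    then have "restrict x {1..n} \<in> hom_tuples G r n" by (simp add: bar_tuples_def)
    from subsetD[OF hom_tuples_subset this] have "restrict x {1..n} \<in> {1..n} \<rightarrow>\<^sub>E carrier G" .
    moreover have "\<forall>w\<in>free_gamma n q. word_value G (restrict x {1..n}) w = \<one>"
      using x by simp
    ultimately have "restrict x {1..n} \<in> hom_tuples G q n"
      unfolding hom_tuples_iff_word_value[OF q(1)] by (rule conjI)
    then show "x \<in> bar_tuples G l q n" using xr by (simp add: bar_tuples_def)
  qed
  moreover have "closedin ?L (topspace ?L \<inter> (\<Inter>w\<in>free_gamma n q. {x \<in> topspace ?L. word_value G (restrict x {1..n}) w \<in> {\<one>}}))"
  proof (cases "free_gamma n q = {}")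
    case True
    show ?thesis unfolding True INT_empty Int_UNIV_right by (rule closedin_topspace)
  next
    case False
    then show ?thesis
      using continuous_map_word_value[OF gam l] one
      by (intro closedin_Int closedin_INT closedin_topspace closedin_continuous_map_preimage) auto
  qed
  ultimately show ?thesis by simp
qed

lemma e_map_glue_class:
  assumes "1 \<le> q" "q \<le> r" "x \<in> bar_tuples G 0 q n" "t \<in> standard_simplex n"
  shows "e_map G T q r (glue_class (E_simp G T q) (n, x, t)) = glue_class (E_simp G T r) (n, x, t)"
  using realization_map_glue_class'[OF simplicial_map_e[OF assms(1,2)], of x n t] assms e_simp_eq[OF assms(1-3)]
  by (simp add: topspace_level_E)

lemma e_map_inj:
  assumes q: "1 \<le> q" "q \<le> r"
  shows "inj_on (e_map G T q r) (topspace (E_space G T q))"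
proof (rule inj_onI)
  have r: "1 \<le> r" using q by order
  fix c d assume c: "c \<in> topspace (E_space G T q)" and d: "d \<in> topspace (E_space G T q)"
    and eq: "e_map G T q r c = e_map G T q r d"
  obtain n x t where x: "x \<in> bar_tuples G 0 q n" "t \<in> standard_simplex n" "c = glue_class (E_simp G T q) (n, x, t)"
    using c by (rule realization_cases) (simp add: topspace_level_E)
  obtain k z s where z: "z \<in> bar_tuples G 0 q k" "s \<in> standard_simplex k" "d = glue_class (E_simp G T q) (k, z, s)"
    using d by (rule realization_cases) (simp add: topspace_level_E)
  have "step_function G (n, x, t) = step_function G (k, z, s)"
    using eq glue_class_E_eq_iff[OF r, of "(n, x, t)" "(k, z, s)"] x z bar_tuples_mono[OF q]
    by (simp add: e_map_glue_class[OF q] topspace_prerealization_E subset_iff)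
  then show "c = d"
    using glue_class_E_eq_iff[OF q(1), of "(n, x, t)" "(k, z, s)"] x z by (simp add: topspace_prerealization_E)
qed

lemma interior_in_image:
  assumes q: "1 \<le> q" "q \<le> r" and x: "x \<in> bar_tuples G 0 r n" and t: "t \<in> standard_simplex n"
    and pos: "\<And>i. i \<le> n \<Longrightarrow> 0 < t i"
    and c: "c \<in> topspace (E_space G T q)" "glue_class (E_simp G T r) (n, x, t) = e_map G T q r c"
  shows "x \<in> bar_tuples G 0 q n" "glue_class (E_simp G T q) (n, x, t) = c"
proof -
  have r: "1 \<le> r" using q by order
  obtain k z s where z: "z \<in> bar_tuples G 0 q k" "s \<in> standard_simplex k" "c = glue_class (E_simp G T q) (k, z, s)"
    using c(1) by (rule realization_cases) (simp add: topspace_level_E)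
  have eq: "step_function G (n, x, t) = step_function G (k, z, s)"
    using c(2) glue_class_E_eq_iff[OF r, of "(n, x, t)" "(k, z, s)"] x t z bar_tuples_mono[OF q]
    by (simp add: e_map_glue_class[OF q] topspace_prerealization_E subset_iff)
  show xq: "x \<in> bar_tuples G 0 q n" by (rule interior_point_in_tuples[OF q(1) x t pos z(1,2) eq])
  show "glue_class (E_simp G T q) (n, x, t) = c"
    using glue_class_E_eq_iff[OF q(1), of "(n, x, t)" "(k, z, s)"] xq t z eq by (simp add: topspace_prerealization_E)
qed

lemma level_bar_subtopology:
  assumes "1 \<le> q" "q \<le> r"
  shows "level (bar_simp G T l q) n = subtopology (level (bar_simp G T l r) n) (bar_tuples G l q n)"
  using bar_tuples_mono[OF assms, of l n] by (simp add: subtopology_subtopology Int_absorb1)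

lemma closedin_cell_mono:
  assumes q: "1 \<le> q" "q \<le> r" and H: "Hausdorff_space T" and S: "closedin (cell (E_simp G T q) n) S"
  shows "closedin (cell (E_simp G T r) n) S"
proof -
  let ?K = "bar_tuples G 0 q n \<times> standard_simplex n"
  have "cell (E_simp G T q) n = subtopology (cell (E_simp G T r) n) ?K"
    unfolding E_simp_eq_bar_simp level_bar_subtopology[OF q]
    by (simp add: subtopology_Times subtopology_subtopology)
  moreover have "closedin (cell (E_simp G T r) n) ?K"
    unfolding closedin_prod_Times_iff E_simp_eq_bar_simp
    using closedin_bar_tuples[OF q zero_le H, of n] closedin_topspace[of "simplex_space n"] by simp
  ultimately show ?thesis using S closedin_trans_full by metis
qed

text \<open>
  A point of the \<open>n\<close>-cell that is interior to the simplex lies over \<open>C\<close> if and only if its tuple belongs to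
  the smaller cell and its class to \<open>C\<close>, and a point with \<open>t\<^sub>i = 0\<close> if and only if its \<open>i\<close>-th face does. So the
  preimage of \<open>C\<close> is a finite union of sets that are closed by induction on \<open>n\<close>.
\<close>

lemma closedin_image_cells:
  assumes q: "1 \<le> q" "q \<le> r" and H: "Hausdorff_space T" and C: "closedin (E_space G T q) C"
  shows "closedin (cell (E_simp G T r) n)
    {y \<in> topspace (cell (E_simp G T r) n). glue_class (E_simp G T r) (n, y) \<in> e_map G T q r ` C}"
    (is "closedin (?X n) (?P n)")
proof (induction n)
  have r: "1 \<le> r" using q by order
  have Cs: "C \<subseteq> topspace (E_space G T q)" by (rule closedin_subset[OF C])
  have tX: "topspace (?X n) = bar_tuples G 0 r n \<times> standard_simplex n" for n
    by (simp add: topspace_level_E del: topspace_bar)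
  define C0 where "C0 n = {y \<in> topspace (cell (E_simp G T q) n). glue_class (E_simp G T q) (n, y) \<in> C}" for n
  define Z where "Z n i = {y \<in> topspace (?X n). snd y i = 0 \<and> glue_class (E_simp G T r) (n, y) \<in> e_map G T q r ` C}" for n i
  have C0: "closedin (?X n) (C0 n)" for n
    unfolding C0_def using C closedin_realization_cells[OF Cs] by (intro closedin_cell_mono[OF q H]) blast
  have tC0: "topspace (cell (E_simp G T q) n) = bar_tuples G 0 q n \<times> standard_simplex n" for n
    by (simp add: topspace_level_E del: topspace_bar)
  have C0P: "C0 n \<subseteq> ?P n" for n
  proof
    fix y assume y: "y \<in> C0 n"
    obtain x t where xt: "y = (x, t)" by (cases y)
    have "x \<in> bar_tuples G 0 q n" "t \<in> standard_simplex n" "glue_class (E_simp G T q) (n, x, t) \<in> C"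
      using y unfolding C0_def tC0 xt by auto
    then show "y \<in> ?P n"
      unfolding tX xt using e_map_glue_class[OF q, of x n t] bar_tuples_mono[OF q, of 0 n] by (auto simp: image_iff)
  qed
  have interior: "(x, t) \<in> C0 n" if "(x, t) \<in> ?P n" "\<And>i. i \<le> n \<Longrightarrow> t i \<noteq> 0" for n x t
  proof -
    have x: "x \<in> bar_tuples G 0 r n" and t: "t \<in> standard_simplex n" using that(1) unfolding tX by auto
    have "glue_class (E_simp G T r) (n, x, t) \<in> e_map G T q r ` C" using that(1) by simp
    then obtain c where c: "glue_class (E_simp G T r) (n, x, t) = e_map G T q r c" "c \<in> C" by (rule imageE)
    have pos: "0 < t i" if "i \<le> n" for i
      using simplex_nonneg[OF t, of i] \<open>\<And>i. i \<le> n \<Longrightarrow> t i \<noteq> 0\<close>[OF that] by simp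
    have "c \<in> topspace (E_space G T q)" using c Cs by blast
    from interior_in_image[OF q x t pos this c(1)] show ?thesis
      unfolding C0_def tC0 using t c(2) by simp
  qed
  {
    case 0
    have "?P 0 \<subseteq> C0 0"
    proof
      fix y assume y: "y \<in> ?P 0"
      obtain x t where xt: "y = (x, t)" by (cases y)
      have "t \<in> standard_simplex 0" using y unfolding tX xt by auto
      then have "t i \<noteq> 0" if "i \<le> 0" for i using that simplex_sum[of t 0] by simp
      then show "y \<in> C0 0" using interior[of x t 0] y xt by blast
    qed
    then have "?P 0 = C0 0" using C0P by blast
    then show ?case using C0 by simp
  next
    case (Suc m)
    let ?n = "Suc m"
    have Zcl: "closedin (?X ?n) (Z ?n i)" if i: "i \<le> ?n" for i
      unfolding Z_def using closedin_face_preimage[OF r _ i] Suc.IH by simp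
    have "?P ?n = C0 ?n \<union> (\<Union>i\<in>{..?n}. Z ?n i)"
    proof (rule subset_antisym; rule subsetI)
      fix y assume y: "y \<in> ?P ?n"
      obtain x t where xt: "y = (x, t)" by (cases y)
      show "y \<in> C0 ?n \<union> (\<Union>i\<in>{..?n}. Z ?n i)"
      proof (cases "\<exists>i\<le>?n. t i = 0")
        case True
        then show ?thesis using y unfolding Z_def xt by auto
      next
        case False
        then show ?thesis using interior[of x t ?n] y xt by blast
      qed
    next
      fix y assume y: "y \<in> C0 ?n \<union> (\<Union>i\<in>{..?n}. Z ?n i)"
      then show "y \<in> ?P ?n"
      proof
        assume "y \<in> (\<Union>i\<in>{..?n}. Z ?n i)"
        then show ?thesis unfolding Z_def by blast
      qed (use C0P in blast)
    qed
    moreover have "closedin (?X ?n) (C0 ?n \<union> (\<Union>i\<in>{..?n}. Z ?n i))"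
      using C0 Zcl by (intro closedin_Un closedin_Union) auto
    ultimately show ?case by simp
  }
qed

lemma closed_map_e:
  assumes q: "1 \<le> q" "q \<le> r" and H: "Hausdorff_space T"
  shows "closed_map (E_space G T q) (E_space G T r) (e_map G T q r)"
  unfolding closed_map_def
proof (intro allI impI)
  fix C assume C: "closedin (E_space G T q) C"
  have "e_map G T q r ` C \<subseteq> topspace (E_space G T r)"
    using closedin_subset[OF C] realization_map_in[OF simplicial_map_e[OF q]] by blast
  then show "closedin (E_space G T r) (e_map G T q r ` C)"
    using closedin_realization_cells closedin_image_cells[OF q H C] by blast
qed

lemma embedding_map_e:
  assumes q: "1 \<le> q" "q \<le> r" and H: "Hausdorff_space T"
  shows "embedding_map (E_space G T q) (E_space G T r) (e_map G T q r)"
  by (rule injective_closed_imp_embedding_map[OF continuous_realization_map[OF simplicial_map_e[OF q]]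
        closed_map_e[OF q H] e_map_inj[OF q]])

lemma proj_e_map:
  assumes q: "1 \<le> q" "q \<le> r" and c: "c \<in> topspace (E_space G T q)"
  shows "proj_EB r (e_map G T q r c) = b_map G T q r (proj_EB q c)"
proof (rule realization_map_square[OF simplicial_map_e[OF q] simplicial_map_p simplicial_map_p[OF q(1)] simplicial_map_b[OF q] _ c])
  show "1 \<le> r" using q by order
  fix n x assume "x \<in> topspace (level (E_simp G T q) n)"
  then have x: "x \<in> bar_tuples G 0 q n" by (simp add: topspace_level_E)
  have "b_simp G q r n (p_simp n x) = p_simp n x"
    using b_simp_eq[OF q] p_simp_in_tuples[OF x] unfolding bar_tuples_one by blast
  then show "p_simp n (e_simp G q r n x) = b_simp G q r n (p_simp n x)"
    using e_simp_eq[OF q x] by simp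
qed

lemma act_e_map:
  assumes q: "1 \<le> q" "q \<le> r" and g: "g \<in> carrier G" and c: "c \<in> topspace (E_space G T q)"
  shows "e_map G T q r (act_E q g c) = act_E r g (e_map G T q r c)"
proof (rule realization_map_square[OF simplicial_map_act[OF q(1) g] simplicial_map_e[OF q] simplicial_map_e[OF q] simplicial_map_act[OF _ g] _ c])
  show "1 \<le> r" using q by order
  fix n x assume "x \<in> topspace (level (E_simp G T q) n)"
  then have x: "x \<in> bar_tuples G 0 q n" by (simp add: topspace_level_E)
  then show "e_simp G q r n (act_simp g n x) = act_simp g n (e_simp G q r n x)"
    using e_simp_eq[OF q] act_simp_in_tuples[OF g x] by simp
qed

text \<open>
  The image of \<open>E(q, G)\<close> in \<open>E(r, G)\<close> is invariant and the projections are quotient maps by \<open>G\<close>, so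
  the statements for B follow from those for E.
\<close>

lemma b_map_inj:
  assumes q: "1 \<le> q" "q \<le> r"
  shows "inj_on (b_map G T q r) (topspace (B_space G T q))"
proof (rule inj_onI)
  have r: "1 \<le> r" using q by order
  fix u v assume u: "u \<in> topspace (B_space G T q)" and v: "v \<in> topspace (B_space G T q)"
    and eq: "b_map G T q r u = b_map G T q r v"
  obtain c where c: "c \<in> topspace (E_space G T q)" "u = proj_EB q c" using u proj_surj[OF q(1)] by blast
  obtain d where d: "d \<in> topspace (E_space G T q)" "v = proj_EB q d" using v proj_surj[OF q(1)] by blast
  note ein = realization_map_in[OF simplicial_map_e[OF q]]
  have "proj_EB r (e_map G T q r c) = proj_EB r (e_map G T q r d)"
    using eq proj_e_map[OF q c(1)] proj_e_map[OF q d(1)] c d by simp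
  from proj_eqD[OF r ein[OF c(1)] ein[OF d(1)] this]
  obtain g where g: "g \<in> carrier G" "act_E r g (e_map G T q r c) = e_map G T q r d" by blast
  have "e_map G T q r (act_E q g c) = e_map G T q r d" using act_e_map[OF q g(1) c(1)] g(2) by simp
  then have "act_E q g c = d"
    using inj_onD[OF e_map_inj[OF q]] act_E_in[OF q(1) g(1) c(1)] d(1) by blast
  then show "u = v" using proj_act[OF q(1) g(1) c(1)] c d by simp
qed

lemma closed_map_b:
  assumes q: "1 \<le> q" "q \<le> r" and H: "Hausdorff_space T"
  shows "closed_map (B_space G T q) (B_space G T r) (b_map G T q r)"
  unfolding closed_map_def
proof (intro allI impI)
  have r: "1 \<le> r" using q by order
  fix C assume C: "closedin (B_space G T q) C"
  let ?C = "{x \<in> topspace (E_space G T q). proj_EB q x \<in> C}"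
  note ein = realization_map_in[OF simplicial_map_e[OF q]]
  have "closedin (E_space G T q) ?C" by (rule closedin_continuous_map_preimage[OF continuous_proj[OF q(1)] C])
  then have cl: "closedin (E_space G T r) (e_map G T q r ` ?C)"
    using closed_map_e[OF q H] by (simp add: closed_map_def)
  have eq: "{x \<in> topspace (E_space G T r). proj_EB r x \<in> b_map G T q r ` C} = e_map G T q r ` ?C"
  proof (rule subset_antisym; rule subsetI)
    fix y assume "y \<in> {x \<in> topspace (E_space G T r). proj_EB r x \<in> b_map G T q r ` C}"
    then obtain u where y: "y \<in> topspace (E_space G T r)" and u: "u \<in> C" "proj_EB r y = b_map G T q r u" by blast
    obtain c where c: "c \<in> topspace (E_space G T q)" "u = proj_EB q c"
      using u(1) closedin_subset[OF C] proj_surj[OF q(1)] by blast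
    have "proj_EB r (e_map G T q r c) = proj_EB r y" using proj_e_map[OF q c(1)] u c by simp
    from proj_eqD[OF r ein[OF c(1)] y this]
    obtain g where g: "g \<in> carrier G" "act_E r g (e_map G T q r c) = y" by blast
    have "y = e_map G T q r (act_E q g c)" using act_e_map[OF q g(1) c(1)] g by simp
    moreover have "act_E q g c \<in> ?C"
      using act_E_in[OF q(1) g(1) c(1)] proj_act[OF q(1) g(1) c(1)] c u by simp
    ultimately show "y \<in> e_map G T q r ` ?C" by blast
  next
    fix y assume "y \<in> e_map G T q r ` ?C"
    then obtain c where c: "c \<in> topspace (E_space G T q)" "proj_EB q c \<in> C" "y = e_map G T q r c" by blast
    then show "y \<in> {x \<in> topspace (E_space G T r). proj_EB r x \<in> b_map G T q r ` C}"
      using ein[OF c(1)] proj_e_map[OF q c(1)] by blast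
  qed
  have sub: "b_map G T q r ` C \<subseteq> topspace (B_space G T r)"
    using closedin_subset[OF C] realization_map_in[OF simplicial_map_b[OF q]] by blast
  from quotient_map_proj[OF r]
  have "\<forall>V\<subseteq>topspace (B_space G T r). closedin (E_space G T r) {x \<in> topspace (E_space G T r). proj_EB r x \<in> V} =
      closedin (B_space G T r) V"
    unfolding quotient_map_closedin by (rule conjunct2)
  from this[rule_format, OF sub] cl show "closedin (B_space G T r) (b_map G T q r ` C)" unfolding eq by simp
qed

lemma embedding_map_b:
  assumes q: "1 \<le> q" "q \<le> r" and H: "Hausdorff_space T"
  shows "embedding_map (B_space G T q) (B_space G T r) (b_map G T q r)"
  by (rule injective_closed_imp_embedding_map[OF continuous_realization_map[OF simplicial_map_b[OF q]]
        closed_map_b[OF q H] b_map_inj[OF q]])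

end

section \<open>Retracting onto the degenerate points\<close>

lemma continuous_map_Min:
  fixes f :: "'i \<Rightarrow> 'b \<Rightarrow> real"
  assumes "finite I" "I \<noteq> {}" "\<And>i. i \<in> I \<Longrightarrow> continuous_map X euclideanreal (f i)"
  shows "continuous_map X euclideanreal (\<lambda>y. Min ((\<lambda>i. f i y) ` I))"
  using assms
proof (induction rule: finite_ne_induct)
  case (insert i I)
  then have "(\<lambda>y. Min ((\<lambda>i. f i y) ` insert i I)) = (\<lambda>y. min (f i y) (Min ((\<lambda>i. f i y) ` I)))"
    by (intro ext) simp
  then show ?case using insert by (simp add: continuous_map_real_min)
qed simp

text \<open>
  Where \<open>v\<close> vanishes, \<open>\<tau>\<close> may jump: the homotopy is stationary there, and by compactness of the unit
  interval nearly stationary close by, whatever the time.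
\<close>

lemma continuous_map_homotopy_reparam:
  assumes h: "continuous_map (prod_topology (top_of_set {0..1::real}) X) Z h"
    and \<pi>: "continuous_map Y X \<pi>" and v: "continuous_map Y euclideanreal v"
    and \<tau>01: "\<And>y. y \<in> topspace Y \<Longrightarrow> \<tau> y \<in> {0..1}"
    and \<tau>: "continuous_map (subtopology Y {y. v y \<noteq> 0}) euclideanreal \<tau>"
    and stationary: "\<And>y s. \<lbrakk>y \<in> topspace Y; v y = 0; s \<in> {0..1}\<rbrakk> \<Longrightarrow> h (s, \<pi> y) = h (0, \<pi> y)"
  shows "continuous_map Y Z (\<lambda>y. h (\<tau> y, \<pi> y))"
proof -
  have \<pi>X: "\<pi> y \<in> topspace X" if "y \<in> topspace Y" for y
    using \<pi> that by (auto simp: continuous_map_def)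
  have hZ: "h (\<tau> y, \<pi> y) \<in> topspace Z" if "y \<in> topspace Y" for y
  proof -
    have "(\<tau> y, \<pi> y) \<in> topspace (prod_topology (top_of_set {0..1}) X)" using \<tau>01[OF that] \<pi>X[OF that] by simp
    then show ?thesis using h unfolding continuous_map_def by blast
  qed
  have main: "\<exists>U. openin Y U \<and> y0 \<in> U \<and> (\<forall>y\<in>U. h (\<tau> y, \<pi> y) \<in> V)"
    if y0: "y0 \<in> topspace Y" and V: "openin Z V \<and> h (\<tau> y0, \<pi> y0) \<in> V" for y0 V
  proof -
  have op: "openin (prod_topology (top_of_set {0..1}) X) {p \<in> topspace (prod_topology (top_of_set {0..1}) X). h p \<in> V}"
    by (rule openin_continuous_map_preimage[OF h conjunct1[OF V]])
  show "\<exists>U. openin Y U \<and> y0 \<in> U \<and> (\<forall>y\<in>U. h (\<tau> y, \<pi> y) \<in> V)"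
  proof (cases "v y0 = 0")
    case False
    let ?S = "{y \<in> topspace Y. v y \<noteq> 0}"
    have S: "openin Y ?S"
      using openin_continuous_map_preimage[OF v, of "- {0}"] by (simp add: open_openin[symmetric] open_Compl)
    have eqS: "subtopology Y {y. v y \<noteq> 0} = subtopology Y ?S"
      unfolding Collect_conj_eq Collect_mem_eq by (rule subtopology_restrict[symmetric])
    have "continuous_map (subtopology Y ?S) (top_of_set {0..1}) \<tau>"
      using \<tau> \<tau>01 unfolding eqS continuous_map_in_subtopology by (auto simp: Pi_iff)
    moreover have "continuous_map (subtopology Y ?S) X \<pi>" by (rule continuous_map_from_subtopology[OF \<pi>])
    ultimately have "continuous_map (subtopology Y ?S) Z (\<lambda>y. h (\<tau> y, \<pi> y))"
      using continuous_map_compose[OF continuous_map_pairedI h] by (simp add: o_def)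
    then have "openin (subtopology Y ?S) {y \<in> topspace (subtopology Y ?S). h (\<tau> y, \<pi> y) \<in> V}"
      using V openin_continuous_map_preimage by blast
    then have "openin Y {y \<in> topspace (subtopology Y ?S). h (\<tau> y, \<pi> y) \<in> V}"
      using S openin_trans_full by blast
    then show ?thesis using y0 False V by (intro exI[of _ "{y \<in> topspace (subtopology Y ?S). h (\<tau> y, \<pi> y) \<in> V}"]) auto
  next
    case True
    have "h (s, \<pi> y0) \<in> V" if "s \<in> {0..1}" for s
      using stationary[OF y0 True that] stationary[OF y0 True \<tau>01[OF y0]] V by simp
    then have sub: "{0..1} \<times> {\<pi> y0} \<subseteq> {p \<in> topspace (prod_topology (top_of_set {0..1}) X). h p \<in> V}"
      using \<pi>X[OF y0] by auto
    have "compactin (top_of_set {0..1::real}) {0..1}" by (simp add: compactin_subtopology)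
    from tube_lemma_left[OF op this \<pi>X[OF y0] sub] obtain A B where AB:
      "openin X B" "{0..1} \<subseteq> A" "\<pi> y0 \<in> B"
      "A \<times> B \<subseteq> {p \<in> topspace (prod_topology (top_of_set {0..1}) X). h p \<in> V}" by blast
    have "openin Y {y \<in> topspace Y. \<pi> y \<in> B}" by (rule openin_continuous_map_preimage[OF \<pi> AB(1)])
    moreover have "h (\<tau> y, \<pi> y) \<in> V" if "y \<in> topspace Y" "\<pi> y \<in> B" for y
      using AB(2,4) \<tau>01[OF that(1)] that(2) by blast
    ultimately show ?thesis using y0 AB(3) by (intro exI[of _ "{y \<in> topspace Y. \<pi> y \<in> B}"]) auto
  qed
  qed
  show ?thesis
    unfolding continuous_map_eq_topcontinuous_at topcontinuous_at_def using hZ main by simp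
qed

text \<open>
  A point of the simplex is pushed towards the boundary by subtracting a multiple of its smallest
  barycentric coordinate from every coordinate and rescaling. Capping that coordinate keeps the scaling factor away from infinity; it
  only matters near the barycentre.
\<close>

definition capped_min :: "nat \<Rightarrow> (nat \<Rightarrow> real) \<Rightarrow> real" where
  "capped_min n t = min (Min (t ` {..n})) (1 / (2 * (real n + 1)))"

definition push_to_boundary :: "nat \<Rightarrow> real \<times> (nat \<Rightarrow> real) \<Rightarrow> (nat \<Rightarrow> real)" where
  "push_to_boundary n = (\<lambda>(s, t) i. if i \<le> n
     then (t i - s * capped_min n t) / (1 - (real n + 1) * (s * capped_min n t)) else 0)"

lemma capped_min_bounds:
  assumes "t \<in> standard_simplex n"
  shows "0 \<le> capped_min n t" "2 * (real n + 1) * capped_min n t \<le> 1"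
    "i \<le> n \<Longrightarrow> capped_min n t \<le> t i"
proof -
  show "0 \<le> capped_min n t"
    using simplex_nonneg[OF assms] by (auto simp: capped_min_def)
  have "capped_min n t \<le> 1 / (2 * (real n + 1))" by (simp add: capped_min_def)
  then show "2 * (real n + 1) * capped_min n t \<le> 1" by (simp add: field_simps)
  show "capped_min n t \<le> t i" if "i \<le> n"
  proof -
    have "Min (t ` {..n}) \<le> t i" using that by (intro Min_le) auto
    then show ?thesis by (simp add: capped_min_def min.coboundedI1)
  qed
qed

lemma capped_min_eq_0_iff:
  assumes "t \<in> standard_simplex n"
  shows "capped_min n t = 0 \<longleftrightarrow> (\<exists>i\<le>n. t i = 0)"
proof
  assume "capped_min n t = 0"
  then have "Min (t ` {..n}) = 0" by (simp add: capped_min_def min_def split: if_splits)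
  moreover have "Min (t ` {..n}) \<in> t ` {..n}" by (rule Min_in) auto
  ultimately show "\<exists>i\<le>n. t i = 0" by auto
next
  assume "\<exists>i\<le>n. t i = 0"
  then show "capped_min n t = 0"
    using capped_min_bounds(1)[OF assms] capped_min_bounds(3)[OF assms] by force
qed

lemma push_denominator_pos:
  assumes "t \<in> standard_simplex n" "s \<in> {0..1}"
  shows "0 < 1 - (real n + 1) * (s * capped_min n t)"
proof -
  have "s * capped_min n t \<le> capped_min n t"
    using assms(2) capped_min_bounds(1)[OF assms(1)] by (simp add: mult_left_le_one_le)
  then have "(real n + 1) * (s * capped_min n t) \<le> (real n + 1) * capped_min n t"
    by (intro mult_left_mono) auto
  then show ?thesis using capped_min_bounds(2)[OF assms(1)] by linarith
qed

lemma push_to_boundary_in_simplex: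
  assumes t: "t \<in> standard_simplex n" and s: "s \<in> {0..1}"
  shows "push_to_boundary n (s, t) \<in> standard_simplex n"
proof (rule simplexI)
  let ?m = "s * capped_min n t" and ?d = "1 - (real n + 1) * (s * capped_min n t)"
  note d = push_denominator_pos[OF t s]
  have le: "?m \<le> t i" if "i \<le> n" for i
  proof -
    have "?m \<le> capped_min n t" using s capped_min_bounds(1)[OF t] by (simp add: mult_left_le_one_le)
    then show ?thesis using capped_min_bounds(3)[OF t that] by linarith
  qed
  show "0 \<le> push_to_boundary n (s, t) i" for i
    using le d by (auto simp: push_to_boundary_def)
  show "push_to_boundary n (s, t) i = 0" if "n < i" for i
    using that by (simp add: push_to_boundary_def)
  have "sum (push_to_boundary n (s, t)) {..n} = (\<Sum>i\<le>n. (t i - ?m) / ?d)"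
    by (intro sum.cong) (auto simp: push_to_boundary_def)
  also have "\<dots> = (\<Sum>i\<le>n. t i - ?m) / ?d" by (simp add: sum_divide_distrib)
  also have "(\<Sum>i\<le>n. t i - ?m) = ?d" using simplex_sum[OF t] by (simp add: sum_subtractf algebra_simps)
  finally show "sum (push_to_boundary n (s, t)) {..n} = 1" using d by simp
qed

lemma push_to_boundary_stationary:
  assumes "t \<in> standard_simplex n" "s = 0 \<or> capped_min n t = 0"
  shows "push_to_boundary n (s, t) = t"
proof
  fix i
  show "push_to_boundary n (s, t) i = t i"
    using assms simplex_zero[OF assms(1), of i] by (auto simp: push_to_boundary_def)
qed

lemma push_to_boundary_one:
  assumes t: "t \<in> standard_simplex n" and "2 * (real n + 1) * capped_min n t < 1"
  shows "\<exists>i\<le>n. push_to_boundary n (1, t) i = 0"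
proof -
  have min_left: "min a b = a" if "min a b < b" for a b :: real
    using that by (simp add: min_def split: if_splits)
  have "capped_min n t < 1 / (2 * (real n + 1))" using assms(2) by (simp add: field_simps)
  then have "capped_min n t = Min (t ` {..n})" unfolding capped_min_def by (rule min_left)
  moreover have "Min (t ` {..n}) \<in> t ` {..n}" by (rule Min_in) auto
  then obtain i where "Min (t ` {..n}) = t i" "i \<in> {..n}" by (rule imageE)
  ultimately have "i \<le> n" "t i = capped_min n t" by simp_all
  then show ?thesis by (intro exI[of _ i]) (simp add: push_to_boundary_def)
qed

lemma continuous_map_simplex_coordinate: "continuous_map (simplex_space n) euclideanreal (\<lambda>t. t i)"
  by (intro continuous_map_from_subtopology) (rule continuous_map_product_projection, simp)

lemma continuous_capped_min: "continuous_map (simplex_space n) euclideanreal (capped_min n)"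
proof -
  have "continuous_map (simplex_space n) euclideanreal (\<lambda>t. Min ((\<lambda>i. t i) ` {..n}))"
    by (rule continuous_map_Min) (auto intro: continuous_map_simplex_coordinate)
  then show ?thesis unfolding capped_min_def by (intro continuous_map_real_min) simp_all
qed

lemma continuous_push_to_boundary:
  "continuous_map (prod_topology (top_of_set {0..1}) (simplex_space n)) (simplex_space n) (push_to_boundary n)"
  unfolding continuous_map_in_subtopology
proof (intro conjI)
  let ?X = "prod_topology (top_of_set {0..1::real}) (simplex_space n)"
  have s: "continuous_map ?X euclideanreal fst"
    using continuous_map_into_fulltopology[OF continuous_map_fst] by blast
  have m: "continuous_map ?X euclideanreal (\<lambda>p. capped_min n (snd p))"
    using continuous_map_compose[OF continuous_map_snd continuous_capped_min] by (simp add: o_def)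
  have sm: "continuous_map ?X euclideanreal (\<lambda>p. fst p * capped_min n (snd p))"
    by (rule continuous_map_real_mult[OF s m])
  have t: "continuous_map ?X euclideanreal (\<lambda>p. snd p i)" for i
    using continuous_map_compose[OF continuous_map_snd continuous_map_simplex_coordinate[of n i]] by (simp add: o_def)
  show "continuous_map ?X (powertop_real UNIV) (push_to_boundary n)"
    unfolding continuous_map_componentwise_UNIV
  proof
    fix i
    have "continuous_map ?X euclideanreal
        (\<lambda>p. (snd p i - fst p * capped_min n (snd p)) / (1 - (real n + 1) * (fst p * capped_min n (snd p))))"
    proof (intro continuous_map_real_divide continuous_map_diff t sm continuous_map_real_mult_left)
      fix p assume "p \<in> topspace ?X"
      then have "0 < 1 - (real n + 1) * (fst p * capped_min n (snd p))"
        by (intro push_denominator_pos) auto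
      then show "1 - (real n + 1) * (fst p * capped_min n (snd p)) \<noteq> 0" by linarith
    qed simp
    then show "continuous_map ?X euclideanreal (\<lambda>p. push_to_boundary n p i)"
      unfolding push_to_boundary_def case_prod_unfold by (cases "i \<le> n") simp_all
  qed
  show "push_to_boundary n \<in> topspace ?X \<rightarrow> standard_simplex n"
    using push_to_boundary_in_simplex by auto
qed

context well_pointed_lch_group
begin

abbreviation cell_E :: "nat \<Rightarrow> ((nat \<Rightarrow> 'a) \<times> (nat \<Rightarrow> real)) topology" where
  "cell_E n \<equiv> cell (E_simp G T \<infinity>) n"

definition degenerate_part :: "nat \<Rightarrow> ((nat \<Rightarrow> 'a) \<times> (nat \<Rightarrow> real)) set" where
  "degenerate_part n = {y \<in> topspace (cell_E n). \<not> nondegenerate (n, y)}"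

abbreviation act_cell :: "'a \<Rightarrow> nat \<Rightarrow> (nat \<Rightarrow> 'a) \<times> (nat \<Rightarrow> real) \<Rightarrow> (nat \<Rightarrow> 'a) \<times> (nat \<Rightarrow> real)" where
  "act_cell g n y \<equiv> (act_simp g n (fst y), snd y)"

lemma topspace_cell_E: "topspace (cell_E n) = bar_tuples G 0 \<infinity> n \<times> standard_simplex n"
  by (simp add: topspace_level_E del: topspace_bar)

lemma continuous_cell_entry: "k \<le> n \<Longrightarrow> continuous_map (cell_E n) T (\<lambda>y. fst y k)"
  using continuous_map_compose[OF continuous_map_fst continuous_entry_E] by (simp add: o_def)

text \<open>
  The unit of the group and the boundary of the simplex are neighbourhood retracts, and the points in
  question are those with some coordinate in one of these subspaces. The coordinates move independently: the one
  nearest to its subspace, as measured by \<open>v\<close>, is retracted completely, while the others move only for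
  the time \<open>\<tau>\<close>, which tends to \<open>0\<close> as the nearest one reaches its subspace.
\<close>

lemma degenerate_part_retraction:
  assumes n: "1 \<le> n"
  shows "\<exists>W r. openin (cell_E n) W \<and> degenerate_part n \<subseteq> W \<and> continuous_map (cell_E n) (cell_E n) r \<and>
    r ` W \<subseteq> degenerate_part n \<and> (\<forall>y \<in> degenerate_part n. r y = y) \<and>
    (\<forall>g \<in> carrier G. \<forall>y \<in> W. act_cell g n y \<in> W \<and> r (act_cell g n y) = act_cell g n (r y))"
proof -
  let ?Y = "cell_E n"
  obtain u k where u: "continuous_map T (top_of_set {0..1::real}) u"
    and u0: "\<forall>x \<in> topspace T. u x = 0 \<longleftrightarrow> x = \<one>"
    and hk: "homotopic_with (\<lambda>f. f \<one> = \<one>) T T id k"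
    and k1: "\<forall>x \<in> topspace T. u x < 1 \<longrightarrow> k x = \<one>"
    using nondegenerate_one unfolding nondegenerate_basepoint_def by blast
  obtain h where h: "continuous_map (prod_topology (top_of_set {0..1::real}) T) T h"
    and h0: "\<And>x. h (0, x) = x" and h1: "\<And>x. h (1, x) = k x" and hone: "\<And>s. s \<in> {0..1} \<Longrightarrow> h (s, \<one>) = \<one>"
    using hk unfolding homotopic_with_def by auto
  have uc: "continuous_map T euclideanreal u" using u continuous_map_into_fulltopology by blast
  have u01: "0 \<le> u x" "u x \<le> 1" if "x \<in> carrier G" for x
    using u that by (auto simp: continuous_map_def topspace_eq)
  have u0': "u x = 0 \<longleftrightarrow> x = \<one>" if "x \<in> carrier G" for x using u0 that by (simp add: topspace_eq)
  have k1': "k x = \<one>" if "x \<in> carrier G" "u x < 1" for x using k1 that by (simp add: topspace_eq)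
  \<comment> \<open>The number \<open>0\<close> is free to stand for the simplex, since the entry \<open>x\<^sub>0\<close> is not to be moved. The factor
    normalizes the capped minimum to values in the unit interval.\<close>
  define v where "v i y = (if i = 0 then 2 * (real n + 1) * capped_min n (snd y) else u (fst y i))"
    for i and y :: "(nat \<Rightarrow> 'a) \<times> (nat \<Rightarrow> real)"
  define M where "M i y = Min ((\<lambda>j. v j y) ` ({..n} - {i}))" for i y
  define \<tau> where "\<tau> i y = min 1 (M i y / v i y)" for i y
  define r where "r y = ((\<lambda>k\<in>{0..n}. if k = 0 then fst y 0 else h (\<tau> k y, fst y k)), push_to_boundary n (\<tau> 0 y, snd y))"
    for y
  have tY: "fst y \<in> bar_tuples G 0 \<infinity> n" "snd y \<in> standard_simplex n" "\<And>i. i \<le> n \<Longrightarrow> fst y i \<in> carrier G"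
    if "y \<in> topspace ?Y" for y
    using that bar_tuples_closed[of "fst y" G 0 \<infinity> n] unfolding topspace_cell_E by auto
  have v01: "0 \<le> v i y" "v i y \<le> 1" if "y \<in> topspace ?Y" "i \<le> n" for i y
    using tY[OF that(1)] that(2) u01 capped_min_bounds(1,2)[of "snd y" n] by (auto simp: v_def)
  have vcont: "continuous_map ?Y euclideanreal (v i)" if "i \<le> n" for i
  proof (cases "i = 0")
    case True
    have "continuous_map ?Y euclideanreal (\<lambda>y. capped_min n (snd y))"
      using continuous_map_compose[OF continuous_map_snd continuous_capped_min] by (simp only: o_def)
    from continuous_map_real_mult_left[OF this, of "2 * (real n + 1)"] show ?thesis
      unfolding v_def using True by simp
  next
    case False
    then show ?thesis
      unfolding v_def using continuous_map_compose[OF continuous_cell_entry[OF that] uc] by (simp add: o_def)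
  qed
  have ne: "{..n} - {i} \<noteq> {}" for i
  proof -
    have "0 \<in> {..n} - {i} \<or> 1 \<in> {..n} - {i}" using n by auto
    then show ?thesis by blast
  qed
  have Mcont: "continuous_map ?Y euclideanreal (M i)" for i
    unfolding M_def by (rule continuous_map_Min) (use ne vcont in auto)
  have Mle: "M i y \<le> v j y" if "j \<le> n" "j \<noteq> i" for i j y
    unfolding M_def using that by (intro Min_le) auto
  have Mge: "a \<le> M i y" if "\<And>j. \<lbrakk>j \<le> n; j \<noteq> i\<rbrakk> \<Longrightarrow> a \<le> v j y" for a i y
    unfolding M_def using ne that by (subst Min_ge_iff) auto
  have \<tau>01: "\<tau> i y \<in> {0..1}" if "y \<in> topspace ?Y" "i \<le> n" for i y
    using Mge[of i 0 y] v01[OF that(1)] that(2) by (auto simp: \<tau>_def)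
  have \<tau>cont: "continuous_map (subtopology ?Y {y. v i y \<noteq> 0}) euclideanreal (\<tau> i)" if "i \<le> n" for i
    unfolding \<tau>_def
    by (intro continuous_map_real_min continuous_map_real_divide continuous_map_from_subtopology Mcont vcont[OF that]) auto
  have nd: "y \<in> degenerate_part n \<longleftrightarrow> y \<in> topspace ?Y \<and> (\<exists>i\<le>n. v i y = 0)" for y
  proof (cases "y \<in> topspace ?Y")
    case True
    note t = tY[OF True]
    have a: "v 0 y = 0 \<longleftrightarrow> (\<exists>i\<le>n. snd y i = 0)"
      using capped_min_eq_0_iff[OF t(2)] by (simp add: v_def)
    have b: "v i y = 0 \<longleftrightarrow> fst y i = \<one>" if "1 \<le> i" "i \<le> n" for i
      using u0'[OF t(3)[OF that(2)]] that(1) by (simp add: v_def)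
    have "(\<exists>i\<le>n. v i y = 0) \<longleftrightarrow> v 0 y = 0 \<or> (\<exists>i. 1 \<le> i \<and> i \<le> n \<and> v i y = 0)"
      by (metis le0 less_one not_le)
    also have "\<dots> \<longleftrightarrow> (\<exists>i\<le>n. snd y i = 0) \<or> (\<exists>i. 1 \<le> i \<and> i \<le> n \<and> fst y i = \<one>)"
      unfolding a using b by metis
    also have "\<dots> \<longleftrightarrow> \<not> nondegenerate (n, y)"
      using simplex_nonneg[OF t(2)] by (auto simp: nondegenerate_def case_prod_unfold less_le)
    finally show ?thesis using True by (simp add: degenerate_part_def)
  qed (simp add: degenerate_part_def)
  have entry: "continuous_map ?Y T (\<lambda>y. h (\<tau> j y, fst y j))" if "1 \<le> j" "j \<le> n" for j
  proof (rule continuous_map_homotopy_reparam[OF h continuous_cell_entry[OF that(2)] vcont[OF that(2)] \<tau>01 \<tau>cont[OF that(2)]])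
    fix y and s :: real assume "y \<in> topspace ?Y" "v j y = 0" "s \<in> {0..1}"
    then have "fst y j = \<one>" using that tY(3)[of y j] u0' by (simp add: v_def)
    then show "h (s, fst y j) = h (0, fst y j)" using hone[OF \<open>s \<in> {0..1}\<close>] h0 by simp
  qed (use that in auto)
  have simplex_part: "continuous_map ?Y (simplex_space n) (\<lambda>y. push_to_boundary n (\<tau> 0 y, snd y))"
  proof (rule continuous_map_homotopy_reparam[OF continuous_push_to_boundary continuous_map_snd vcont \<tau>01 \<tau>cont])
    fix y and s :: real assume "y \<in> topspace ?Y" "v 0 y = 0" "s \<in> {0..1}"
    then show "push_to_boundary n (s, snd y) = push_to_boundary n (0, snd y)"
      using push_to_boundary_stationary[OF tY(2)] by (simp add: v_def)
  qed auto
  have rcont: "continuous_map ?Y ?Y r"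
    unfolding r_def
  proof (rule continuous_map_pairedI[OF _ simplex_part])
    show "continuous_map ?Y (level (E_simp G T \<infinity>) n) (\<lambda>y. \<lambda>k\<in>{0..n}. if k = 0 then fst y 0 else h (\<tau> k y, fst y k))"
    proof (rule continuous_map_into_level_E)
      fix j assume "j \<le> n"
      then show "continuous_map ?Y T (\<lambda>y. (\<lambda>k\<in>{0..n}. if k = 0 then fst y 0 else h (\<tau> k y, fst y k)) j)"
        using continuous_cell_entry[of 0 n] entry[of j] by (cases "j = 0") simp_all
    next
      fix y assume y: "y \<in> topspace ?Y"
      have "h (\<tau> j y, fst y j) \<in> carrier G" if "1 \<le> j" "j \<le> n" for j
        using entry[OF that] y by (auto simp: continuous_map_def topspace_eq)
      then show "(\<lambda>k\<in>{0..n}. if k = 0 then fst y 0 else h (\<tau> k y, fst y k)) \<in> bar_tuples G 0 \<infinity> n"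
        using tY(3)[OF y] by (simp add: bar_tuples_infinity restrict_PiE_iff)
    qed
  qed
  have rfix: "r y = y" if y: "y \<in> degenerate_part n" for y
  proof -
    from y obtain i where i: "i \<le> n" "v i y = 0" and yY: "y \<in> topspace ?Y" unfolding nd by blast
    have stat: "\<tau> j y = 0 \<or> v j y = 0" if "j \<le> n" for j
    proof (cases "j = i")
      case False
      have "M j y \<le> 0" using Mle[of i j y] i False by simp
      moreover have "0 \<le> M j y" using Mge[of j 0 y] v01[OF yY] by simp
      ultimately show ?thesis by (simp add: \<tau>_def)
    qed (use i in simp)
    have "h (\<tau> j y, fst y j) = fst y j" if "1 \<le> j" "j \<le> n" for j
      using stat[OF that(2)] h0 hone[OF \<tau>01[OF yY that(2)]] u0'[OF tY(3)[OF yY that(2)]] that by (auto simp: v_def)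
    then have "(\<lambda>k\<in>{0..n}. if k = 0 then fst y 0 else h (\<tau> k y, fst y k)) = fst y"
      using bar_tuples_arb[OF tY(1)[OF yY]] by (intro ext) auto
    moreover have "push_to_boundary n (\<tau> 0 y, snd y) = snd y"
      using stat[of 0] by (intro push_to_boundary_stationary[OF tY(2)[OF yY]]) (auto simp: v_def)
    ultimately show ?thesis by (simp add: r_def)
  qed
  define W where "W = (\<Union>i\<in>{..n}. {y \<in> topspace ?Y. v i y \<in> {..<1}})"
  have "openin ?Y {y \<in> topspace ?Y. v i y \<in> {..<1}}" if "i \<le> n" for i
    by (rule openin_continuous_map_preimage[OF vcont[OF that]]) (simp add: open_openin[symmetric])
  then have Wopen: "openin ?Y W" unfolding W_def by (intro openin_Union) auto
  have WD: "degenerate_part n \<subseteq> W"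
  proof
    fix y assume "y \<in> degenerate_part n"
    then obtain i where "y \<in> topspace ?Y" "i \<le> n" "v i y = 0" unfolding nd by blast
    then have "i \<in> {..n}" "y \<in> {y \<in> topspace ?Y. v i y \<in> {..<1}}" by simp_all
    then show "y \<in> W" unfolding W_def by (rule UN_I)
  qed
  have rW: "r y \<in> degenerate_part n" if y: "y \<in> W" for y
  proof -
    have yY: "y \<in> topspace ?Y" using y by (auto simp: W_def)
    have rY: "r y \<in> topspace ?Y" using rcont yY by (auto simp: continuous_map_def)
    obtain i where i: "i \<le> n" "\<And>j. j \<le> n \<Longrightarrow> v i y \<le> v j y"
    proof -
      have "Min ((\<lambda>j. v j y) ` {..n}) \<in> (\<lambda>j. v j y) ` {..n}" by (rule Min_in) auto
      then obtain i where i: "Min ((\<lambda>j. v j y) ` {..n}) = v i y" "i \<in> {..n}" by (rule imageE)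
      have "v i y \<le> v j y" if "j \<le> n" for j
        unfolding i(1)[symmetric] using that by (intro Min_le) auto
      then show ?thesis using that i(2) by simp
    qed
    have vi1: "v i y < 1" using y i(2) unfolding W_def by (auto intro: le_less_trans)
    show ?thesis
    proof (cases "v i y = 0")
      case True
      then have "y \<in> degenerate_part n" using nd yY i by blast
      then show ?thesis using rfix by simp
    next
      case False
      then have "0 < v i y" using v01[OF yY i(1)] by simp
      moreover have "v i y \<le> M i y" by (rule Mge) (use i(2) in auto)
      ultimately have t1: "\<tau> i y = 1" by (simp add: \<tau>_def min_def field_simps)
      have "v i (r y) = 0"
      proof (cases "i = 0")
        case True
        have "\<exists>j\<le>n. push_to_boundary n (1, snd y) j = 0"
          using vi1 True by (intro push_to_boundary_one[OF tY(2)[OF yY]]) (simp add: v_def)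
        then have "capped_min n (snd (r y)) = 0"
          using capped_min_eq_0_iff[OF tY(2)[OF rY]] t1 True by (simp add: r_def)
        then show ?thesis using True by (simp add: v_def)
      next
        case False
        have "fst (r y) i = k (fst y i)" using False i(1) t1 h1 by (simp add: r_def)
        also have "\<dots> = \<one>" using vi1 False by (intro k1' tY(3)[OF yY i(1)]) (simp add: v_def)
        finally show ?thesis using False u0'[OF one_closed] by (simp add: v_def)
      qed
      then show ?thesis using nd rY i(1) by blast
    qed
  qed
  have equiv: "act_cell g n y \<in> W \<and> r (act_cell g n y) = act_cell g n (r y)" if g: "g \<in> carrier G" and y: "y \<in> W" for g y
  proof -
    have yY: "y \<in> topspace ?Y" using y by (auto simp: W_def)
    have aY: "act_cell g n y \<in> topspace ?Y"
      using tY(1,2)[OF yY] act_simp_in_tuples[OF g] unfolding topspace_cell_E by simp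
    have va: "v i (act_cell g n y) = v i y" for i by (simp add: v_def act_simp_def)
    have \<tau>a: "\<tau> i (act_cell g n y) = \<tau> i y" for i by (simp add: \<tau>_def M_def va)
    have "act_cell g n y \<in> W" using y aY unfolding W_def by (simp add: va)
    moreover have "r (act_cell g n y) = act_cell g n (r y)"
      unfolding r_def \<tau>a by (auto simp: act_simp_def)
    ultimately show ?thesis by blast
  qed
  show ?thesis
    using Wopen WD rcont rW rfix equiv by (intro exI[of _ W] exI[of _ r]) blast
qed

end

section \<open>Local triviality over the skeleta of EG\<close>

context well_pointed_lch_group
begin

abbreviation class_E :: "nat \<Rightarrow> (nat \<Rightarrow> 'a) \<times> (nat \<Rightarrow> real) \<Rightarrow> (nat \<Rightarrow> 'a) simplex_point set" where
  "class_E n y \<equiv> glue_class (E_simp G T \<infinity>) (n, y)"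

definition skeleton :: "nat \<Rightarrow> (nat \<Rightarrow> 'a) simplex_point set set" where
  "skeleton n = class_E n ` topspace (cell_E n)"

lemma prerealization_cell_iff:
  "(n, y) \<in> topspace (prerealization (E_simp G T \<infinity>)) \<longleftrightarrow> y \<in> topspace (cell_E n)"
  by (cases y) (simp add: topspace_prerealization)

lemma class_E_eqD:
  assumes "y \<in> topspace (cell_E n)" "y' \<in> topspace (cell_E n)" "nondegenerate (n, y)" "class_E n y = class_E n y'"
  shows "y' = y"
proof -
  have a: "(n, y) \<in> topspace (prerealization (E_simp G T \<infinity>))" "(n, y') \<in> topspace (prerealization (E_simp G T \<infinity>))"
    using assms(1,2) prerealization_cell_iff by blast+
  have "step_function G (n, y') = step_function G (n, y)"
    using glue_class_E_eq_iff[OF _ a] assms(4) by simp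
  then have "(n, y') = (n, y)"
    using nondegenerate_minimal[OF _ a(2,1) _ assms(3)] by simp
  then show ?thesis by simp
qed

text \<open>
  The last degeneracy carries a cell to the degenerate part of the next one without changing the
  barycentric coordinates or the point of EG.
\<close>

definition pad_cell :: "nat \<Rightarrow> (nat \<Rightarrow> 'a) \<times> (nat \<Rightarrow> real) \<Rightarrow> (nat \<Rightarrow> 'a) \<times> (nat \<Rightarrow> real)" where
  "pad_cell n y = (bar_degen G 0 n n (fst y), snd y)"

lemma pad_cell:
  assumes y: "y \<in> topspace (cell_E n)"
  shows "pad_cell n y \<in> degenerate_part (Suc n)" "class_E (Suc n) (pad_cell n y) = class_E n y"
proof -
  obtain x t where xt: "y = (x, t)" by (cases y)
  have x: "x \<in> bar_tuples G 0 \<infinity> n" and t: "t \<in> standard_simplex n" using y unfolding xt topspace_cell_E by auto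
  have t': "t \<in> standard_simplex (n + 1)" using standard_simplex_mono[of n "n + 1"] t by auto
  have x': "bar_degen G 0 n n x \<in> bar_tuples G 0 \<infinity> (n + 1)" by (rule bar_degen_in_tuples[OF _ _ _ x]) auto
  have p: "pad_cell n y \<in> topspace (cell_E (Suc n))" using t' x' by (simp add: pad_cell_def xt topspace_level_E)
  have tS: "t (Suc n) = 0" using simplex_zero[OF t] by simp
  then show "pad_cell n y \<in> degenerate_part (Suc n)"
    using p unfolding degenerate_part_def by (auto simp: pad_cell_def xt nondegenerate_def)
  have "simplex_codegen n t = t"
    using simplex_zero[OF t] by (intro ext) (auto simp: simplex_codegen_def)
  moreover have fd: "degen (E_simp G T \<infinity>) = bar_degen G 0" by (simp add: E_simp_def)
  ultimately have "glue (E_simp G T \<infinity>) (n + 1, bar_degen G 0 n n x, t) (n, x, t)"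
    using glue.degen[of n n x "E_simp G T \<infinity>" t] x t' unfolding topspace_level_E by simp
  then have "equivclp (glue (E_simp G T \<infinity>)) (Suc n, pad_cell n y) (n, y)"
    unfolding pad_cell_def xt by (simp add: r_into_equivclp)
  then show "class_E (Suc n) (pad_cell n y) = class_E n y"
    using glue_class_eq_iff p y prerealization_cell_iff by blast
qed

lemma continuous_pad_cell: "continuous_map (cell_E n) (cell_E (Suc n)) (pad_cell n)"
  unfolding pad_cell_def
proof (rule continuous_map_pairedI)
  show "continuous_map (cell_E n) (level (E_simp G T \<infinity>) (Suc n)) (\<lambda>y. bar_degen G 0 n n (fst y))"
    using continuous_map_compose[OF continuous_map_fst continuous_bar_degen[of \<infinity> 0 n n]]
    unfolding E_simp_eq_bar_simp by (simp only: o_def Suc_eq_plus1) simp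
  show "continuous_map (cell_E n) (simplex_space (Suc n)) snd"
    unfolding continuous_map_in_subtopology
    using continuous_map_into_fulltopology[OF continuous_map_snd] standard_simplex_mono[of n "Suc n"] by auto
qed

lemma class_E_degenerate:
  assumes "y \<in> degenerate_part n" "y' \<in> topspace (cell_E n)" "class_E n y = class_E n y'"
  shows "y' \<in> degenerate_part n"
  using assms class_E_eqD[of y' n y] unfolding degenerate_part_def by auto

lemma skeleton_Suc: "skeleton n \<subseteq> skeleton (Suc n)"
proof
  fix z assume "z \<in> skeleton n"
  then obtain y where y: "y \<in> topspace (cell_E n)" "z = class_E n y" by (auto simp: skeleton_def)
  then have "pad_cell n y \<in> topspace (cell_E (Suc n))" using pad_cell(1) by (simp add: degenerate_part_def)
  then show "z \<in> skeleton (Suc n)" using imageI[of "pad_cell n y" "topspace (cell_E (Suc n))" "class_E (Suc n)"] pad_cell(2)[OF y(1)] y(2)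
    unfolding skeleton_def by (simp only:)
qed

lemma skeleton_mono: "m \<le> n \<Longrightarrow> skeleton m \<subseteq> skeleton n"
  by (rule lift_Suc_mono_le) (rule skeleton_Suc)

lemma openin_lower_cell:
  assumes "openin (cell_E (m + d)) {y \<in> topspace (cell_E (m + d)). class_E (m + d) y \<in> S}"
  shows "openin (cell_E m) {y \<in> topspace (cell_E m). class_E m y \<in> S}"
  using assms
proof (induction d)
  case (Suc d)
  let ?l = "m + d"
  have "openin (cell_E (Suc ?l)) {y \<in> topspace (cell_E (Suc ?l)). class_E (Suc ?l) y \<in> S}"
    using Suc.prems by (simp only: add_Suc_right)
  then have "openin (cell_E ?l) {y \<in> topspace (cell_E ?l). pad_cell ?l y \<in>
      {y \<in> topspace (cell_E (Suc ?l)). class_E (Suc ?l) y \<in> S}}"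
    by (rule openin_continuous_map_preimage[OF continuous_pad_cell])
  moreover have "{y \<in> topspace (cell_E ?l). pad_cell ?l y \<in> {y \<in> topspace (cell_E (Suc ?l)). class_E (Suc ?l) y \<in> S}} =
      {y \<in> topspace (cell_E ?l). class_E ?l y \<in> S}"
  proof (rule Collect_cong, rule conj_cong[OF refl])
    fix y assume y: "y \<in> topspace (cell_E ?l)"
    have "pad_cell ?l y \<in> topspace (cell_E (Suc ?l))" using pad_cell(1)[OF y] by (simp add: degenerate_part_def)
    then show "pad_cell ?l y \<in> {y \<in> topspace (cell_E (Suc ?l)). class_E (Suc ?l) y \<in> S} \<longleftrightarrow> class_E ?l y \<in> S"
      using pad_cell(2)[OF y] by simp
  qed
  ultimately show ?case using Suc.IH by (simp only:)
qed simp

lemma continuous_map_face_codegen: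
  assumes "i \<le> Suc n" "1 \<le> i"
  shows "continuous_map (cell_E (Suc n)) (cell_E n) (\<lambda>y. (bar_face G 0 (Suc n) i (fst y), simplex_codegen (i - 1) (snd y)))"
proof (rule continuous_map_pairedI)
  show "continuous_map (cell_E (Suc n)) (level (E_simp G T \<infinity>) n) (\<lambda>y. bar_face G 0 (Suc n) i (fst y))"
    using continuous_map_compose[OF continuous_map_fst continuous_bar_face[of \<infinity> 0 "Suc n" i]] assms
    unfolding E_simp_eq_bar_simp by (simp add: o_def)
  have coord: "continuous_map (cell_E (Suc n)) euclideanreal (\<lambda>y. snd y j)" for j
    using continuous_map_compose[OF continuous_map_snd continuous_map_simplex_coordinate[of "Suc n" j]] by (simp only: o_def)
  have "continuous_map (cell_E (Suc n)) (powertop_real UNIV) (\<lambda>y. simplex_codegen (i - 1) (snd y))"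
    unfolding continuous_map_componentwise_UNIV
  proof
    fix k
    show "continuous_map (cell_E (Suc n)) euclideanreal (\<lambda>y. simplex_codegen (i - 1) (snd y) k)"
      unfolding simplex_codegen_def
      by (cases "k < i - 1"; cases "k = i - 1") (simp_all add: coord continuous_map_add)
  qed
  then show "continuous_map (cell_E (Suc n)) (simplex_space n) (\<lambda>y. simplex_codegen (i - 1) (snd y))"
    unfolding continuous_map_in_subtopology
  proof
    show "(\<lambda>y. simplex_codegen (i - 1) (snd y)) \<in> topspace (cell_E (Suc n)) \<rightarrow> standard_simplex n"
      using simplex_codegen_in_simplex[of _ n "i - 1"] assms unfolding topspace_cell_E by auto
  qed
qed

lemma class_E_face_codegen:
  assumes x: "x \<in> bar_tuples G 0 \<infinity> (Suc n)" and t: "t \<in> standard_simplex (Suc n)"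
    and i: "1 \<le> i" "i \<le> Suc n" "x i = \<one>"
  shows "class_E n (bar_face G 0 (Suc n) i x, simplex_codegen (i - 1) t) = class_E (Suc n) (x, t)"
proof -
  let ?y = "bar_face G 0 (Suc n) i x"
  have y: "?y \<in> bar_tuples G 0 \<infinity> n" using bar_face_in_tuples[OF _ _ _ i(2) x] by simp
  have fd: "degen (E_simp G T \<infinity>) = bar_degen G 0" by (simp add: E_simp_def)
  have i1: "i - 1 \<le> n" using i by simp
  have "glue (E_simp G T \<infinity>) (Suc n, x, t) (n, ?y, simplex_codegen (i - 1) t)"
    using glue.degen[of "i - 1" n ?y "E_simp G T \<infinity>" t] i1 y t bar_degen_face_one[OF x i]
    unfolding topspace_level_E fd by simp
  then have "equivclp (glue (E_simp G T \<infinity>)) (n, ?y, simplex_codegen (i - 1) t) (Suc n, x, t)"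
    by (intro equivclp_sym[OF r_into_equivclp])
  moreover have "(n, ?y, simplex_codegen (i - 1) t) \<in> topspace (prerealization (E_simp G T \<infinity>))"
    "(Suc n, x, t) \<in> topspace (prerealization (E_simp G T \<infinity>))"
    unfolding topspace_prerealization_E using x y t simplex_codegen_in_simplex[of t n "i - 1"] i1 by simp_all
  ultimately show ?thesis using glue_class_eq_iff by blast
qed

text \<open>
  The degenerate part of a cell is a finite union of closed pieces, each of which maps continuously
  to the cell of one dimension less without changing the point of EG.
\<close>

lemma closedin_degenerate_preimage:
  assumes Q: "closedin (cell_E n) {y \<in> topspace (cell_E n). class_E n y \<in> Q}"
  shows "closedin (cell_E (Suc n)) {y \<in> degenerate_part (Suc n). class_E (Suc n) y \<in> Q}"
proof -
  let ?X = "cell_E (Suc n)"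
  define Z where "Z i = {y \<in> topspace ?X. snd y i = 0 \<and> class_E (Suc n) y \<in> Q}" for i
  define Y where "Y i = {y \<in> topspace ?X. fst y i = \<one> \<and> class_E (Suc n) y \<in> Q}" for i
  have inf: "(1::enat) \<le> \<infinity>" by simp
  have Z: "closedin ?X (Z i)" if i: "i \<le> Suc n" for i
    unfolding Z_def using closedin_face_preimage[OF inf _ i] Q by simp
  have Y: "closedin ?X (Y i)" if i: "1 \<le> i" "i \<le> Suc n" for i
  proof -
    have "closedin T {\<one>}" using Hausdorff by (intro closedin_Hausdorff_singleton) (auto simp: topspace_eq)
    then have A: "closedin ?X {y \<in> topspace ?X. fst y i \<in> {\<one>}}"
      by (rule closedin_continuous_map_preimage[OF continuous_cell_entry[OF i(2)]])
    have "closedin ?X {y \<in> {y \<in> topspace ?X. fst y i \<in> {\<one>}}. class_E (Suc n) y \<in> Q}"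
    proof (rule closedin_piece[OF A continuous_map_from_subtopology[OF continuous_map_face_codegen[OF i(2,1)]] Q])
      fix y assume "y \<in> {y \<in> topspace ?X. fst y i \<in> {\<one>}}"
      then have "fst y \<in> bar_tuples G 0 \<infinity> (Suc n)" "snd y \<in> standard_simplex (Suc n)" "fst y i = \<one>"
        unfolding topspace_cell_E by auto
      then show "class_E n (bar_face G 0 (Suc n) i (fst y), simplex_codegen (i - 1) (snd y)) = class_E (Suc n) y"
        using class_E_face_codegen[OF _ _ i] by simp
    qed
    then show ?thesis unfolding Y_def by simp
  qed
  have "{y \<in> degenerate_part (Suc n). class_E (Suc n) y \<in> Q} = (\<Union>i\<in>{..Suc n}. Z i) \<union> (\<Union>i\<in>{1..Suc n}. Y i)"
  proof (rule subset_antisym; rule subsetI)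
    fix y assume y: "y \<in> {y \<in> degenerate_part (Suc n). class_E (Suc n) y \<in> Q}"
    then have yX: "y \<in> topspace ?X" "\<not> nondegenerate (Suc n, y)" by (auto simp: degenerate_part_def)
    then have "0 \<le> snd y i" for i using simplex_nonneg unfolding topspace_cell_E by auto
    then have "(\<exists>i\<le>Suc n. snd y i = 0) \<or> (\<exists>i. 1 \<le> i \<and> i \<le> Suc n \<and> fst y i = \<one>)"
      using yX(2) unfolding nondegenerate_def case_prod_unfold fst_conv snd_conv less_le by metis
    then show "y \<in> (\<Union>i\<in>{..Suc n}. Z i) \<union> (\<Union>i\<in>{1..Suc n}. Y i)"
      using y yX(1) unfolding Z_def Y_def by auto
  next
    fix y assume "y \<in> (\<Union>i\<in>{..Suc n}. Z i) \<union> (\<Union>i\<in>{1..Suc n}. Y i)"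
    then show "y \<in> {y \<in> degenerate_part (Suc n). class_E (Suc n) y \<in> Q}"
      unfolding Z_def Y_def degenerate_part_def nondegenerate_def case_prod_unfold fst_conv snd_conv by force
  qed
  moreover have "closedin ?X ((\<Union>i\<in>{..Suc n}. Z i) \<union> (\<Union>i\<in>{1..Suc n}. Y i))"
    using Z Y by (intro closedin_Un closedin_Union) auto
  ultimately show ?thesis by simp
qed

lemma closedin_degenerate_part: "closedin (cell_E n) (degenerate_part n)"
proof (cases n)
  case 0
  have "nondegenerate (0, y)" if "y \<in> topspace (cell_E 0)" for y
  proof -
    have "snd y \<in> standard_simplex 0" using that unfolding topspace_cell_E by auto
    then have "snd y 0 = 1" using simplex_sum[of "snd y" 0] by simp
    then show ?thesis by (simp add: nondegenerate_def case_prod_unfold)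
  qed
  then have "degenerate_part 0 = {}" unfolding degenerate_part_def by blast
  then show ?thesis using 0 by simp
next
  case (Suc m)
  then show ?thesis using closedin_degenerate_preimage[of m UNIV] closedin_topspace[of "cell_E m"] by simp
qed

lemma class_E_act:
  assumes "g \<in> carrier G" "y \<in> topspace (cell_E n)"
  shows "act_E \<infinity> g (class_E n y) = class_E n (act_cell g n y)" "act_cell g n y \<in> topspace (cell_E n)"
proof -
  obtain x t where xt: "y = (x, t)" by (cases y)
  show "act_E \<infinity> g (class_E n y) = class_E n (act_cell g n y)"
    using realization_map_glue_class'[OF simplicial_map_act[OF _ assms(1)], of \<infinity> x n t] assms(2) by (simp add: xt)
  show "act_cell g n y \<in> topspace (cell_E n)"
    using assms act_simp_in_tuples[OF assms(1), of x \<infinity> n] unfolding topspace_cell_E xt by simp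
qed

text \<open>
  A partial trivialization over the \<open>n\<close>-skeleton: a continuous equivariant map to \<open>G\<close> on an open
  invariant set. The last condition expresses continuity on the \<open>n\<close>-skeleton and, for the set of all elements
  of \<open>G\<close>, openness of the domain.
\<close>

definition partial_trivialization ::
  "nat \<Rightarrow> (nat \<Rightarrow> 'a) simplex_point set set \<Rightarrow> ((nat \<Rightarrow> 'a) simplex_point set \<Rightarrow> 'a) \<Rightarrow> bool" where
  "partial_trivialization n V h \<longleftrightarrow>
     V \<subseteq> skeleton n \<and> (\<forall>z\<in>V. h z \<in> carrier G) \<and>
     (\<forall>g\<in>carrier G. \<forall>z\<in>V. act_E \<infinity> g z \<in> V \<and> h (act_E \<infinity> g z) = g \<otimes> h z) \<and>
     (\<forall>S. openin T S \<longrightarrow> openin (cell_E n) {y \<in> topspace (cell_E n). class_E n y \<in> V \<and> h (class_E n y) \<in> S})"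

lemma partial_trivialization_base:
  assumes "z \<in> topspace (EG G T)"
  shows "\<exists>n V h. partial_trivialization n V h \<and> z \<in> V"
proof -
  obtain a where a: "a \<in> topspace (prerealization (E_simp G T \<infinity>))" "z = glue_class (E_simp G T \<infinity>) a"
    using assms by (auto simp: topspace_realization)
  obtain b where b: "b \<in> topspace (prerealization (E_simp G T \<infinity>))" "nondegenerate b"
      "equivclp (glue (E_simp G T \<infinity>)) a b"
    using normal_form_exists[OF _ a(1)] by auto
  obtain n y where ny: "b = (n, y)" by (cases b)
  have y: "y \<in> topspace (cell_E n)" "nondegenerate (n, y)" "z = class_E n y"
    using b glue_class_eq_iff[OF a(1) b(1)] a(2) prerealization_cell_iff unfolding ny by auto
  let ?N = "{y \<in> topspace (cell_E n). nondegenerate (n, y)}"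
  define V where "V = class_E n ` ?N"
  define h where "h z = fst (SOME y. y \<in> ?N \<and> class_E n y = z) 0" for z
  have h: "h (class_E n y) = fst y 0" if "y \<in> ?N" for y
  proof -
    have ex: "y \<in> ?N \<and> class_E n y = class_E n y" using that by blast
    have "(SOME y'. y' \<in> ?N \<and> class_E n y' = class_E n y) \<in> ?N \<and>
        class_E n (SOME y'. y' \<in> ?N \<and> class_E n y' = class_E n y) = class_E n y"
      by (rule someI[of "\<lambda>y'. y' \<in> ?N \<and> class_E n y' = class_E n y", OF ex])
    then have "(SOME y'. y' \<in> ?N \<and> class_E n y' = class_E n y) = y"
      using class_E_eqD[of y n] that by auto
    then show ?thesis by (simp add: h_def)
  qed
  have V_iff: "class_E n y \<in> V \<longleftrightarrow> y \<in> ?N" if "y \<in> topspace (cell_E n)" for y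
    using that class_E_eqD[of _ n y] unfolding V_def by auto
  have "partial_trivialization n V h"
    unfolding partial_trivialization_def
  proof (intro conjI ballI allI impI)
    show "V \<subseteq> skeleton n" unfolding V_def skeleton_def by auto
  next
    fix z assume "z \<in> V"
    then obtain y where y: "y \<in> ?N" "z = class_E n y" unfolding V_def by blast
    then show "h z \<in> carrier G"
      using h[OF y(1)] bar_tuples_closed[of "fst y" G 0 \<infinity> n 0] unfolding topspace_cell_E by auto
    fix g assume g: "g \<in> carrier G"
    have yn: "y \<in> topspace (cell_E n)" using y(1) by blast
    have "act_cell g n y \<in> ?N"
      using class_E_act(2)[OF g yn] y(1) by (auto simp: nondegenerate_def act_simp_def case_prod_unfold)
    then show "act_E \<infinity> g z \<in> V" "h (act_E \<infinity> g z) = g \<otimes> h z"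
      using class_E_act(1)[OF g yn] h[of "act_cell g n y"] h[OF y(1)] y(2) unfolding V_def
      by (auto simp: act_simp_def)
  next
    fix S assume S: "openin T S"
    have "{y \<in> topspace (cell_E n). class_E n y \<in> V \<and> h (class_E n y) \<in> S} =
        (topspace (cell_E n) - degenerate_part n) \<inter> {y \<in> topspace (cell_E n). fst y 0 \<in> S}"
    proof (rule subset_antisym; rule subsetI)
      fix y assume "y \<in> {y \<in> topspace (cell_E n). class_E n y \<in> V \<and> h (class_E n y) \<in> S}"
      then show "y \<in> (topspace (cell_E n) - degenerate_part n) \<inter> {y \<in> topspace (cell_E n). fst y 0 \<in> S}"
        using V_iff[of y] h[of y] by (simp add: degenerate_part_def)
    next
      fix y assume "y \<in> (topspace (cell_E n) - degenerate_part n) \<inter> {y \<in> topspace (cell_E n). fst y 0 \<in> S}"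
      then show "y \<in> {y \<in> topspace (cell_E n). class_E n y \<in> V \<and> h (class_E n y) \<in> S}"
        using V_iff[of y] h[of y] by (simp add: degenerate_part_def)
    qed
    moreover have "openin (cell_E n) ((topspace (cell_E n) - degenerate_part n) \<inter> {y \<in> topspace (cell_E n). fst y 0 \<in> S})"
      using closedin_degenerate_part openin_continuous_map_preimage[OF continuous_cell_entry[of 0 n] S]
      by (intro openin_Int openin_diff openin_topspace) auto
    ultimately show "openin (cell_E n) {y \<in> topspace (cell_E n). class_E n y \<in> V \<and> h (class_E n y) \<in> S}" by simp
  qed
  moreover have "z \<in> V" using y unfolding V_def by blast
  ultimately show ?thesis by blast
qed

text \<open>
  Composing with the retraction onto the degenerate points, which lie over the lower skeleton,
  extends a partial trivialization to a neighbourhood in the next skeleton.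
\<close>

lemma partial_trivialization_extend:
  assumes pt: "partial_trivialization n V h"
  shows "\<exists>V' h'. partial_trivialization (Suc n) V' h' \<and> V \<subseteq> V' \<and> V' \<inter> skeleton n \<subseteq> V \<and> (\<forall>z\<in>V. h' z = h z)"
proof -
  let ?X = "cell_E (Suc n)" and ?D = "degenerate_part (Suc n)" and ?q = "class_E (Suc n)"
  have Vs: "V \<subseteq> skeleton n" and hc: "\<And>z. z \<in> V \<Longrightarrow> h z \<in> carrier G"
    and hact: "\<And>g z. \<lbrakk>g \<in> carrier G; z \<in> V\<rbrakk> \<Longrightarrow> act_E \<infinity> g z \<in> V \<and> h (act_E \<infinity> g z) = g \<otimes> h z"
    and hopen: "\<And>S. openin T S \<Longrightarrow> openin (cell_E n) {y \<in> topspace (cell_E n). class_E n y \<in> V \<and> h (class_E n y) \<in> S}"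
    using pt unfolding partial_trivialization_def by blast+
  have "1 \<le> Suc n" by simp
  from degenerate_part_retraction[OF this] obtain W r where Wr: "openin ?X W \<and> ?D \<subseteq> W \<and> continuous_map ?X ?X r \<and>
      r ` W \<subseteq> ?D \<and> (\<forall>y \<in> ?D. r y = y) \<and>
      (\<forall>g \<in> carrier G. \<forall>y \<in> W. act_cell g (Suc n) y \<in> W \<and> r (act_cell g (Suc n) y) = act_cell g (Suc n) (r y))"
    by (elim exE)
  then have W: "openin ?X W" "?D \<subseteq> W" and rc: "continuous_map ?X ?X r" and rW: "r ` W \<subseteq> ?D"
    and rfix: "\<And>y. y \<in> ?D \<Longrightarrow> r y = y"
    and ract: "\<And>g y. \<lbrakk>g \<in> carrier G; y \<in> W\<rbrakk> \<Longrightarrow> act_cell g (Suc n) y \<in> W \<and> r (act_cell g (Suc n) y) = act_cell g (Suc n) (r y)"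
    by blast+
  have WX: "W \<subseteq> topspace ?X" by (rule openin_subset[OF W(1)])
  have rX: "r y \<in> topspace ?X" if "y \<in> W" for y using rc WX that by (auto simp: continuous_map_def)
  have key: "y2 \<in> W \<and> ?q (r y2) = ?q (r y1)" if "y1 \<in> W" "y2 \<in> topspace ?X" "?q y1 = ?q y2" for y1 y2
  proof (cases "nondegenerate (Suc n, y1)")
    case True
    then have "y2 = y1" using class_E_eqD[of y1 "Suc n" y2] that WX by blast
    then show ?thesis using that by simp
  next
    case False
    then have d1: "y1 \<in> ?D" using that(1) WX by (auto simp: degenerate_part_def)
    then have d2: "y2 \<in> ?D" using class_E_degenerate that by blast
    then show ?thesis using rfix[OF d1] rfix[OF d2] W(2) that(3) by auto
  qed
  define V' where "V' = ?q ` {y \<in> W. ?q (r y) \<in> V}"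
  \<comment> \<open>By \<open>key\<close> the value does not depend on the chosen representative.\<close>
  define h' where "h' z = h (?q (r (SOME y. y \<in> W \<and> ?q y = z)))" for z
  have V'_iff: "?q y \<in> V' \<longleftrightarrow> y \<in> W \<and> ?q (r y) \<in> V" if "y \<in> topspace ?X" for y
  proof
    assume "?q y \<in> V'"
    then obtain y1 where "y1 \<in> W" "?q (r y1) \<in> V" "?q y = ?q y1" unfolding V'_def by blast
    then show "y \<in> W \<and> ?q (r y) \<in> V" using key[of y1 y] that by simp
  qed (auto simp: V'_def)
  have h'_eq: "h' (?q y) = h (?q (r y))" if "y \<in> W" for y
  proof -
    let ?s = "SOME y'. y' \<in> W \<and> ?q y' = ?q y"
    have "?s \<in> W \<and> ?q ?s = ?q y" by (rule someI[of _ y]) (use that in blast)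
    then have s: "?s \<in> W" "?q y = ?q ?s" by (rule conjunct1, simp only:)
    have "?q (r ?s) = ?q (r y)" by (rule conjunct2[OF key[OF that subsetD[OF WX s(1)] s(2)]])
    then show ?thesis unfolding h'_def by (simp only:)
  qed
  have pad: "pad_cell n y \<in> ?D" "?q (pad_cell n y) = class_E n y" "r (pad_cell n y) = pad_cell n y"
    "pad_cell n y \<in> W" "pad_cell n y \<in> topspace ?X" if "y \<in> topspace (cell_E n)" for y
  proof -
    show D: "pad_cell n y \<in> ?D" and "?q (pad_cell n y) = class_E n y" by (rule pad_cell[OF that])+
    show "r (pad_cell n y) = pad_cell n y" by (rule rfix[OF D])
    show "pad_cell n y \<in> W" by (rule subsetD[OF W(2) D])
    then show "pad_cell n y \<in> topspace ?X" by (rule subsetD[OF WX])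
  qed
  have ext: "z \<in> V' \<and> h' z = h z" if z: "z \<in> V" for z
  proof -
    obtain y where y: "y \<in> topspace (cell_E n)" "z = class_E n y" using z Vs unfolding skeleton_def by blast
    then show ?thesis using V'_iff[OF pad(5)[OF y(1)]] h'_eq[OF pad(4)[OF y(1)]] pad[OF y(1)] z by simp
  qed
  have restr: "V' \<inter> skeleton n \<subseteq> V"
  proof
    fix z assume z: "z \<in> V' \<inter> skeleton n"
    then obtain y where y: "y \<in> topspace (cell_E n)" "z = class_E n y" unfolding skeleton_def by blast
    then show "z \<in> V" using V'_iff[OF pad(5)[OF y(1)]] pad[OF y(1)] z by simp
  qed
  have "partial_trivialization (Suc n) V' h'"
    unfolding partial_trivialization_def
  proof (intro conjI ballI allI impI)
    show "V' \<subseteq> skeleton (Suc n)" unfolding V'_def skeleton_def using WX by blast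
  next
    fix z assume "z \<in> V'"
    then obtain y where y: "y \<in> W" "?q (r y) \<in> V" "z = ?q y" unfolding V'_def by blast
    then show "h' z \<in> carrier G" using h'_eq[OF y(1)] hc by simp
    fix g assume g: "g \<in> carrier G"
    have yX: "y \<in> topspace ?X" using y(1) WX by blast
    have a: "act_E \<infinity> g z = ?q (act_cell g (Suc n) y)" using class_E_act(1)[OF g yX] y(3) by simp
    have "?q (r (act_cell g (Suc n) y)) = act_E \<infinity> g (?q (r y))"
      using ract[OF g y(1)] class_E_act(1)[OF g rX[OF y(1)]] by simp
    then have "?q (r (act_cell g (Suc n) y)) \<in> V \<and> h (?q (r (act_cell g (Suc n) y))) = g \<otimes> h (?q (r y))"
      using hact[OF g y(2)] by simp
    then show "act_E \<infinity> g z \<in> V'" "h' (act_E \<infinity> g z) = g \<otimes> h' z"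
      using ract[OF g y(1)] h'_eq[OF y(1)] h'_eq[of "act_cell g (Suc n) y"] y(3)
      unfolding a V'_def by auto
  next
    fix S assume S: "openin T S"
    let ?Q = "{z. \<not> (z \<in> V \<and> h z \<in> S)}"
    let ?B = "{y \<in> ?D. ?q y \<in> ?Q}"
    have "{y \<in> topspace (cell_E n). class_E n y \<in> ?Q} =
        topspace (cell_E n) - {y \<in> topspace (cell_E n). class_E n y \<in> V \<and> h (class_E n y) \<in> S}" by blast
    then have "closedin (cell_E n) {y \<in> topspace (cell_E n). class_E n y \<in> ?Q}"
      using closedin_diff[OF closedin_topspace hopen[OF S]] by simp
    then have B: "closedin ?X ?B" by (rule closedin_degenerate_preimage)
    have "{y \<in> topspace ?X. ?q y \<in> V' \<and> h' (?q y) \<in> S} = W \<inter> {y \<in> topspace ?X. r y \<in> topspace ?X - ?B}"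
    proof (rule subset_antisym; rule subsetI)
      fix y assume "y \<in> {y \<in> topspace ?X. ?q y \<in> V' \<and> h' (?q y) \<in> S}"
      then have y: "y \<in> topspace ?X" "?q y \<in> V'" "h' (?q y) \<in> S" by blast+
      then have "y \<in> W" "?q (r y) \<in> V" "h (?q (r y)) \<in> S" using V'_iff[OF y(1)] h'_eq[of y] by auto
      then show "y \<in> W \<inter> {y \<in> topspace ?X. r y \<in> topspace ?X - ?B}" using y(1) rX by simp
    next
      fix y assume y: "y \<in> W \<inter> {y \<in> topspace ?X. r y \<in> topspace ?X - ?B}"
      then have "r y \<in> ?D" using rW by blast
      then have "?q (r y) \<in> V" "h (?q (r y)) \<in> S" using y by auto
      then show "y \<in> {y \<in> topspace ?X. ?q y \<in> V' \<and> h' (?q y) \<in> S}"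
        using y V'_iff[of y] h'_eq[of y] by simp
    qed
    moreover have "openin ?X (W \<inter> {y \<in> topspace ?X. r y \<in> topspace ?X - ?B})"
      using openin_continuous_map_preimage[OF rc openin_diff[OF openin_topspace B]] W(1) by (rule openin_Int[rotated])
    ultimately show "openin ?X {y \<in> topspace ?X. ?q y \<in> V' \<and> h' (?q y) \<in> S}" by simp
  qed
  then show ?thesis using ext restr by blast
qed

text \<open>
  The successive extensions agree on the lower skeleta, and openness in the realization is checked on
  each cell separately, where finitely many steps suffice.
\<close>

lemma local_equivariant_map_EG:
  assumes z: "z \<in> topspace (EG G T)"
  shows "\<exists>V h. openin (EG G T) V \<and> z \<in> V \<and> continuous_map (subtopology (EG G T) V) T h \<and>
    (\<forall>g\<in>carrier G. \<forall>w\<in>V. act_E \<infinity> g w \<in> V \<and> h (act_E \<infinity> g w) = g \<otimes> h w)"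
proof -
  obtain n V0 h0 where pt0: "partial_trivialization n V0 h0" and z0: "z \<in> V0"
    using partial_trivialization_base[OF z] by blast
  let ?P = "\<lambda>k p. partial_trivialization (n + k) (fst p) (snd p) \<and> (k = 0 \<longrightarrow> p = (V0, h0))"
  let ?Q = "\<lambda>k p p'. fst p \<subseteq> fst p' \<and> fst p' \<inter> skeleton (n + k) \<subseteq> fst p \<and> (\<forall>z\<in>fst p. snd p' z = snd p z)"
  have "\<exists>f. \<forall>k. ?P k (f k) \<and> ?Q k (f k) (f (Suc k))"
  proof (rule dependent_nat_choice)
    show "\<exists>p. ?P 0 p" using pt0 by (intro exI[of _ "(V0, h0)"]) simp
  next
    fix p k assume "?P k p"
    then obtain V' h' where "partial_trivialization (Suc (n + k)) V' h'" "fst p \<subseteq> V'" "V' \<inter> skeleton (n + k) \<subseteq> fst p"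
      "\<forall>z\<in>fst p. h' z = snd p z"
      using partial_trivialization_extend by blast
    then show "\<exists>p'. ?P (Suc k) p' \<and> ?Q k p p'" by (intro exI[of _ "(V', h')"]) simp
  qed
  then obtain f where f: "\<And>k. ?P k (f k)" "\<And>k. ?Q k (f k) (f (Suc k))" by blast
  have mono: "fst (f j) \<subseteq> fst (f k) \<and> fst (f k) \<inter> skeleton (n + j) \<subseteq> fst (f j) \<and> (\<forall>z\<in>fst (f j). snd (f k) z = snd (f j) z)"
    if "j \<le> k" for j k
    using that
  proof (induction rule: dec_induct)
    case (step k)
    have "skeleton (n + j) \<subseteq> skeleton (n + k)" using step.hyps by (intro skeleton_mono) simp
    then have "fst (f (Suc k)) \<inter> skeleton (n + j) \<subseteq> fst (f j)" using f(2)[of k] step.IH by blast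
    moreover have "snd (f (Suc k)) z = snd (f j) z" if "z \<in> fst (f j)" for z
      using f(2)[of k] step.IH that by auto
    ultimately show ?case using f(2)[of k] step.IH by blast
  qed simp
  define V where "V = (\<Union>k. fst (f k))"
  define h where "h z = snd (f (LEAST k. z \<in> fst (f k))) z" for z
  have h: "h z = snd (f k) z" if "z \<in> fst (f k)" for z k
  proof -
    have "z \<in> fst (f (LEAST k. z \<in> fst (f k)))" by (rule LeastI[of "\<lambda>k. z \<in> fst (f k)", OF that])
    moreover have "(LEAST k. z \<in> fst (f k)) \<le> k" by (rule Least_le[of "\<lambda>k. z \<in> fst (f k)", OF that])
    ultimately show ?thesis using mono unfolding h_def by metis
  qed
  have V_skel: "z \<in> V \<longleftrightarrow> z \<in> fst (f m)" if "z \<in> skeleton (n + m)" for z m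
  proof
    assume "z \<in> V"
    then obtain j where j: "z \<in> fst (f j)" unfolding V_def by blast
    show "z \<in> fst (f m)"
    proof (cases "j \<le> m")
      case True
      then show ?thesis using mono[OF True] j by blast
    next
      case False
      then show ?thesis using mono[of m j] j that by auto
    qed
  qed (auto simp: V_def)
  have Vact: "act_E \<infinity> g w \<in> V \<and> h (act_E \<infinity> g w) = g \<otimes> h w" if g: "g \<in> carrier G" and w: "w \<in> V" for g w
  proof -
    obtain k where k: "w \<in> fst (f k)" using w unfolding V_def by blast
    then have "act_E \<infinity> g w \<in> fst (f k) \<and> snd (f k) (act_E \<infinity> g w) = g \<otimes> snd (f k) w"
      using f(1)[of k] g unfolding partial_trivialization_def by blast
    then show ?thesis using h[OF k] h[of "act_E \<infinity> g w" k] unfolding V_def by auto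
  qed
  have Vtop: "V \<subseteq> topspace (EG G T)"
  proof
    fix w assume "w \<in> V"
    then obtain k where "w \<in> fst (f k)" unfolding V_def by blast
    then have "w \<in> skeleton (n + k)" using f(1)[of k] unfolding partial_trivialization_def by blast
    then show "w \<in> topspace (EG G T)"
      unfolding skeleton_def using glue_class_in_realization prerealization_cell_iff by blast
  qed
  have op: "openin (EG G T) {w \<in> V. h w \<in> S}" if S: "openin T S" for S
  proof -
    have sub: "{w \<in> V. h w \<in> S} \<subseteq> topspace (EG G T)" using Vtop by blast
    have "openin (cell_E m) {y \<in> topspace (cell_E m). class_E m y \<in> {w \<in> V. h w \<in> S}}" for m
    proof -
      have "openin (cell_E (m + n)) {y \<in> topspace (cell_E (m + n)). class_E (m + n) y \<in> fst (f m) \<and> snd (f m) (class_E (m + n) y) \<in> S}"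
        using f(1)[of m] S unfolding partial_trivialization_def by (simp add: add.commute)
      then have "openin (cell_E (m + n)) {y \<in> topspace (cell_E (m + n)). class_E (m + n) y \<in> {w. w \<in> fst (f m) \<and> snd (f m) w \<in> S}}"
        by (simp only: mem_Collect_eq)
      then have "openin (cell_E m) {y \<in> topspace (cell_E m). class_E m y \<in> {w. w \<in> fst (f m) \<and> snd (f m) w \<in> S}}"
        by (rule openin_lower_cell)
      moreover have "class_E m y \<in> {w \<in> V. h w \<in> S} \<longleftrightarrow> class_E m y \<in> {w. w \<in> fst (f m) \<and> snd (f m) w \<in> S}"
        if "y \<in> topspace (cell_E m)" for y
      proof -
        have "class_E m y \<in> skeleton (n + m)"
          using skeleton_mono[of m "n + m"] that unfolding skeleton_def[of m] by auto
        from V_skel[OF this] h show ?thesis by auto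
      qed
      then have "{y \<in> topspace (cell_E m). class_E m y \<in> {w \<in> V. h w \<in> S}} =
          {y \<in> topspace (cell_E m). class_E m y \<in> {w. w \<in> fst (f m) \<and> snd (f m) w \<in> S}}"
        by (intro Collect_cong conj_cong refl)
      ultimately show ?thesis by (simp only:)
    qed
    then show ?thesis using openin_realization_cells[OF sub] by blast
  qed
  have hcar: "h w \<in> carrier G" if w: "w \<in> V" for w
  proof -
    obtain k where k: "w \<in> fst (f k)" using w unfolding V_def by blast
    then show ?thesis using h[OF k] f(1)[of k] unfolding partial_trivialization_def by auto
  qed
  have "{w \<in> V. h w \<in> carrier G} = V" using hcar by blast
  then have Vopen: "openin (EG G T) V" using op[of "carrier G"] openin_topspace[of T] topspace_eq by simp
  have "continuous_map (subtopology (EG G T) V) T h"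
    unfolding continuous_map_def
  proof (intro conjI allI impI)
    show "h \<in> topspace (subtopology (EG G T) V) \<rightarrow> topspace T" using hcar by (auto simp: topspace_eq)
    fix S assume S: "openin T S"
    have "{w \<in> topspace (subtopology (EG G T) V). h w \<in> S} = {w \<in> V. h w \<in> S}" using Vtop by auto
    then show "openin (subtopology (EG G T) V) {w \<in> topspace (subtopology (EG G T) V). h w \<in> S}"
      using op[OF S] Vopen by (simp add: openin_open_subtopology)
  qed
  moreover have "z \<in> V" using z0 f(1)[of 0] unfolding V_def by (auto intro: exI[of _ 0])
  ultimately show ?thesis using Vopen Vact by blast
qed

end

section \<open>The principal bundles\<close>

lemma continuous_map_prod_prerealization:
  assumes "\<And>n. continuous_map (prod_topology T (cell X n)) Z (\<lambda>p. f (fst p, n, snd p))"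
  shows "continuous_map (prod_topology T (prerealization X)) Z f"
  unfolding continuous_map_def
proof (intro conjI allI impI)
  show "f \<in> topspace (prod_topology T (prerealization X)) \<rightarrow> topspace Z"
  proof
    fix p assume "p \<in> topspace (prod_topology T (prerealization X))"
    then obtain g n y where p: "p = (g, n, y)" "(g, y) \<in> topspace (prod_topology T (cell X n))"
      by (auto simp: topspace_prerealization)
    then have "f (fst (g, y), n, snd (g, y)) \<in> topspace Z" using assms[of n] unfolding continuous_map_def by blast
    then show "f p \<in> topspace Z" by (simp add: p)
  qed
next
  fix U assume U: "openin Z U"
  let ?P = "{p \<in> topspace (prod_topology T (prerealization X)). f p \<in> U}"
  show "openin (prod_topology T (prerealization X)) ?P"
    unfolding openin_prod_topology_alt
  proof (intro allI impI)
    fix g a assume ga: "(g, a) \<in> ?P"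
    obtain n y where a: "a = (n, y)" by (cases a)
    let ?Q = "{p \<in> topspace (prod_topology T (cell X n)). f (fst p, n, snd p) \<in> U}"
    have Q: "openin (prod_topology T (cell X n)) ?Q" by (rule openin_continuous_map_preimage[OF assms U])
    have "(g, y) \<in> ?Q" using ga unfolding a by (cases y) (auto simp: topspace_prerealization)
    from iffD1[OF openin_prod_topology_alt Q, rule_format, OF this]
    obtain A B where AB: "openin T A" "openin (cell X n) B" "g \<in> A" "y \<in> B" "A \<times> B \<subseteq> ?Q"
      by (elim exE conjE)
    have "openin (prerealization X) (Pair n ` B)"
      using open_map_component_injection[of n UNIV "cell X"] AB(2) unfolding open_map_def prerealization_def by simp
    moreover have "A \<times> Pair n ` B \<subseteq> ?P"
    proof
      fix p assume "p \<in> A \<times> Pair n ` B"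
      then obtain g' y' where p: "p = (g', n, y')" "(g', y') \<in> ?Q" using AB(5) by blast
      then show "p \<in> ?P" by (cases y') (auto simp: topspace_prerealization)
    qed
    ultimately show "\<exists>A B. openin T A \<and> openin (prerealization X) B \<and> g \<in> A \<and> a \<in> B \<and> A \<times> B \<subseteq> ?P"
      using AB(1,3,4) a by blast
  qed
qed

context well_pointed_lch_group
begin

text \<open>
  Local compactness of \<open>G\<close> enters here: it makes the product of \<open>G\<close> with the quotient map onto the
  realization a quotient map.
\<close>

lemma continuous_act:
  assumes q: "1 \<le> q"
  shows "continuous_map (prod_topology T (E_space G T q)) (E_space G T q) (\<lambda>p. act_E q (fst p) (snd p))"
proof (rule continuous_compose_quotient_map)
  show "quotient_map (prod_topology T (prerealization (E_simp G T q))) (prod_topology T (E_space G T q))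
      (\<lambda>(x, y). (x, glue_class (E_simp G T q) y))"
    by (rule quotient_map_prod_right[OF locally_compact disjI1[OF Hausdorff] quotient_map_glue_class])
  show "continuous_map (prod_topology T (prerealization (E_simp G T q))) (E_space G T q)
      ((\<lambda>p. act_E q (fst p) (snd p)) \<circ> (\<lambda>(x, y). (x, glue_class (E_simp G T q) y)))"
  proof (rule continuous_map_prod_prerealization)
    fix n
    let ?P = "prod_topology T (cell (E_simp G T q) n)"
    have "continuous_map ?P (cell (E_simp G T q) n) (\<lambda>p. (act_simp (fst p) n (fst (snd p)), snd (snd p)))"
    proof (rule continuous_map_pairedI)
      show "continuous_map ?P (level (E_simp G T q) n) (\<lambda>p. act_simp (fst p) n (fst (snd p)))"
      proof (rule continuous_map_into_level_E)
        fix k assume k: "k \<le> n"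
        have c: "continuous_map ?P T (\<lambda>p. fst (snd p) j)" if "j \<le> n" for j
          using continuous_map_compose[OF continuous_map_snd continuous_map_compose[OF continuous_map_fst continuous_entry_E[OF that]]]
          by (simp add: o_def)
        show "continuous_map ?P T (\<lambda>p. act_simp (fst p) n (fst (snd p)) k)"
          using continuous_map_mult_pointwise[OF continuous_map_fst c[of 0]] c[OF k]
          by (cases "k = 0") (simp_all add: act_simp_def)
      next
        fix p assume "p \<in> topspace ?P"
        then have "fst p \<in> carrier G" "fst (snd p) \<in> bar_tuples G 0 q n"
          unfolding topspace_prod_topology topspace_level_E topspace_eq by auto
        then show "act_simp (fst p) n (fst (snd p)) \<in> bar_tuples G 0 q n" by (rule act_simp_in_tuples)
      qed
      show "continuous_map ?P (simplex_space n) (\<lambda>p. snd (snd p))"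
        using continuous_map_compose[OF continuous_map_snd continuous_map_snd] by (simp only: o_def)
    qed
    from continuous_map_compose[OF this continuous_map_glue_class_cell]
    have c: "continuous_map ?P (E_space G T q) (\<lambda>p. glue_class (E_simp G T q) (n, act_simp (fst p) n (fst (snd p)), snd (snd p)))"
      by (simp only: o_def)
    show "continuous_map ?P (E_space G T q)
        (\<lambda>p. ((\<lambda>p. act_E q (fst p) (snd p)) \<circ> (\<lambda>(x, y). (x, glue_class (E_simp G T q) y))) (fst p, n, snd p))"
    proof (rule continuous_map_eq[OF c])
      fix p assume p: "p \<in> topspace ?P"
      obtain g x t where gxt: "p = (g, x, t)" by (cases p)
      have "g \<in> carrier G" "x \<in> topspace (level (E_simp G T q) n)" "t \<in> standard_simplex n"
        using p unfolding gxt topspace_prod_topology topspace_eq by auto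
      then show "glue_class (E_simp G T q) (n, act_simp (fst p) n (fst (snd p)), snd (snd p)) =
          ((\<lambda>p. act_E q (fst p) (snd p)) \<circ> (\<lambda>(x, y). (x, glue_class (E_simp G T q) y))) (fst p, n, snd p)"
        using realization_map_glue_class'[OF simplicial_map_act[OF q]] by (simp add: gxt)
    qed
  qed
qed

text \<open>
  The retractions used for EG do not preserve homomorphisms that are trivial on a term of the lower
  central series, so the map for EG is pulled back instead.
\<close>

lemma local_equivariant_map:
  assumes q: "1 \<le> q" and c: "c \<in> topspace (E_space G T q)"
  shows "\<exists>V h. openin (E_space G T q) V \<and> c \<in> V \<and> continuous_map (subtopology (E_space G T q) V) T h \<and>
    (\<forall>g\<in>carrier G. \<forall>w\<in>V. act_E q g w \<in> V \<and> h (act_E q g w) = g \<otimes> h w)"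
proof -
  let ?e = "e_map G T q \<infinity>"
  have qi: "q \<le> \<infinity>" by simp
  have ec: "continuous_map (E_space G T q) (EG G T) ?e"
    by (rule continuous_realization_map[OF simplicial_map_e[OF q qi]])
  have ein: "?e w \<in> topspace (EG G T)" if "w \<in> topspace (E_space G T q)" for w
    by (rule realization_map_in[OF simplicial_map_e[OF q qi] that])
  obtain V h where V: "openin (EG G T) V" "?e c \<in> V" "continuous_map (subtopology (EG G T) V) T h"
    "\<forall>g\<in>carrier G. \<forall>w\<in>V. act_E \<infinity> g w \<in> V \<and> h (act_E \<infinity> g w) = g \<otimes> h w"
    using local_equivariant_map_EG[OF ein[OF c]] by blast
  let ?V = "{w \<in> topspace (E_space G T q). ?e w \<in> V}"
  have "openin (E_space G T q) ?V" by (rule openin_continuous_map_preimage[OF ec V(1)])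
  moreover have "continuous_map (subtopology (E_space G T q) ?V) T (\<lambda>w. h (?e w))"
  proof -
    have "continuous_map (subtopology (E_space G T q) ?V) (subtopology (EG G T) V) ?e"
      unfolding continuous_map_in_subtopology using continuous_map_from_subtopology[OF ec] by auto
    from continuous_map_compose[OF this V(3)] show ?thesis by (simp only: o_def)
  qed
  moreover have "act_E q g w \<in> ?V \<and> h (?e (act_E q g w)) = g \<otimes> h (?e w)" if "g \<in> carrier G" "w \<in> ?V" for g w
  proof -
    have w: "w \<in> topspace (E_space G T q)" "?e w \<in> V" using that(2) by blast+
    have "?e (act_E q g w) = act_E \<infinity> g (?e w)" by (rule act_e_map[OF q qi that(1) w(1)])
    then show ?thesis using V(4) that(1) w act_E_in[OF q that(1) w(1)] by simp
  qed
  ultimately show ?thesis using c V(2) by (intro exI[of _ ?V] exI[of _ "\<lambda>w. h (?e w)"]) blast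
qed

lemma act_simp_eq: "(\<lambda>n x. x(0 := g \<otimes> x 0)) = act_simp g"
  by (intro ext) (simp add: act_simp_def)

lemma EB_bundle_simps:
  "total (EB_bundle G T q) = E_space G T q" "base (EB_bundle G T q) = B_space G T q"
  "proj (EB_bundle G T q) = proj_EB q" "act (EB_bundle G T q) = act_E q"
  by (simp_all add: EB_bundle_def act_simp_eq)

lemma group_action_E:
  assumes q: "1 \<le> q"
  shows "group_action G (topspace (E_space G T q)) (act_E q)"
proof -
  let ?S = "topspace (E_space G T q)"
  have bij: "act_E q g \<in> Bij ?S" if g: "g \<in> carrier G" for g
  proof -
    have "bij_betw (act_E q g) ?S ?S"
      by (rule bij_betw_byWitness[of _ "act_E q (inv g)"])
         (use act_E_inv[OF q g] act_E_in[OF q] g in auto)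
    moreover have "act_E q g \<in> extensional ?S" by (simp add: realization_map_def)
    ultimately show ?thesis by (simp add: Bij_def)
  qed
  have "act_E q \<in> hom G (BijGroup ?S)"
  proof (rule homI)
    show "act_E q g \<in> carrier (BijGroup ?S)" if "g \<in> carrier G" for g
      using bij[OF that] by (simp add: BijGroup_def)
    show "act_E q (g \<otimes> h) = act_E q g \<otimes>\<^bsub>BijGroup ?S\<^esub> act_E q h" if gh: "g \<in> carrier G" "h \<in> carrier G" for g h
    proof
      fix c
      show "act_E q (g \<otimes> h) c = (act_E q g \<otimes>\<^bsub>BijGroup ?S\<^esub> act_E q h) c"
      proof (cases "c \<in> ?S")
        case True
        then show ?thesis using bij[OF gh(1)] bij[OF gh(2)] act_E_mult[OF q gh] by (simp add: BijGroup_def compose_def)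
      next
        case False
        then show ?thesis using bij[OF gh(1)] bij[OF gh(2)] by (simp add: BijGroup_def compose_def realization_map_def)
      qed
    qed
  qed
  then show ?thesis unfolding group_action_def by (intro group_homI is_group group_BijGroup)
qed

text \<open>
  A local equivariant map to \<open>G\<close> together with the projection is a local trivialization: dividing by
  it gives a local section, which is continuous because the projection is a quotient map.
\<close>

lemma local_trivialization:
  assumes q: "1 \<le> q" and b: "b \<in> topspace (B_space G T q)"
  shows "\<exists>U \<theta>. openin (B_space G T q) U \<and> b \<in> U \<and>
    homeomorphic_map (subtopology (E_space G T q) {x \<in> topspace (E_space G T q). proj_EB q x \<in> U})
      (prod_topology T (subtopology (B_space G T q) U)) \<theta> \<and>
    (\<forall>x \<in> topspace (E_space G T q). proj_EB q x \<in> U \<longrightarrow>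
      snd (\<theta> x) = proj_EB q x \<and> (\<forall>g \<in> carrier G. fst (\<theta> (act_E q g x)) = g \<otimes> fst (\<theta> x)))"
proof -
  let ?E = "E_space G T q" and ?B = "B_space G T q" and ?p = "proj_EB q"
  obtain c where c: "c \<in> topspace ?E" "b = ?p c" using b proj_surj[OF q] by blast
  obtain V h where V: "openin ?E V" "c \<in> V" and h: "continuous_map (subtopology ?E V) T h"
    and ha: "\<And>g w. \<lbrakk>g \<in> carrier G; w \<in> V\<rbrakk> \<Longrightarrow> act_E q g w \<in> V \<and> h (act_E q g w) = g \<otimes> h w"
    using local_equivariant_map[OF q c(1)] by blast
  have VE: "V \<subseteq> topspace ?E" by (rule openin_subset[OF V(1)])
  have tV: "topspace (subtopology ?E V) = V" using VE by auto
  have hc: "h w \<in> carrier G" if "w \<in> V" for w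
    using h that unfolding continuous_map_def tV topspace_eq by blast
  let ?U = "?p ` V"
  have U: "openin ?B ?U" using open_map_proj[OF q] V(1) unfolding open_map_def by blast
  have UB: "?U \<subseteq> topspace ?B" by (rule openin_subset[OF U])
  have tU: "topspace (subtopology ?B ?U) = ?U" using UB by auto
  have pre: "{x \<in> topspace ?E. ?p x \<in> ?U} = V"
  proof (rule subset_antisym; rule subsetI)
    fix x assume "x \<in> {x \<in> topspace ?E. ?p x \<in> ?U}"
    then obtain w where w: "x \<in> topspace ?E" "w \<in> V" "?p w = ?p x" by force
    then obtain g where "g \<in> carrier G" "act_E q g w = x" using proj_eqD[OF q _ w(1,3)] VE by blast
    then show "x \<in> V" using ha[of g w] w(2) by simp
  next
    fix x assume "x \<in> V"
    then show "x \<in> {x \<in> topspace ?E. ?p x \<in> ?U}" using VE by blast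
  qed
  define s where "s b = (let x = (SOME x. x \<in> V \<and> ?p x = b) in act_E q (inv (h x)) x)" for b
  have s: "s (?p x) = act_E q (inv (h x)) x" if x: "x \<in> V" for x
  proof -
    let ?x = "SOME x'. x' \<in> V \<and> ?p x' = ?p x"
    have "?x \<in> V \<and> ?p ?x = ?p x" by (rule someI[of _ x]) (use x in blast)
    then have x': "?x \<in> V" "?p x = ?p ?x" by simp_all
    have xE: "x \<in> topspace ?E" "?x \<in> topspace ?E" using x x'(1) VE by blast+
    obtain g where g: "g \<in> carrier G" "act_E q g x = ?x" using proj_eqD[OF q xE x'(2)] by blast
    have hx': "h ?x = g \<otimes> h x" using ha[OF g(1) x] g(2) by simp
    have "act_E q (inv (h ?x)) ?x = act_E q (inv (g \<otimes> h x) \<otimes> g) x"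
      using act_E_mult[OF q _ g(1) xE(1), of "inv (g \<otimes> h x)"] g hc[OF x] hx' by simp
    also have "inv (g \<otimes> h x) \<otimes> g = inv (h x)" using g(1) hc[OF x] by (simp add: inv_mult_group m_assoc)
    finally show ?thesis unfolding s_def Let_def .
  qed
  have sV: "s (?p x) \<in> V" "?p (s (?p x)) = ?p x" "h (s (?p x)) = \<one>" if x: "x \<in> V" for x
    using ha[OF inv_closed[OF hc[OF x]] x] proj_act[OF q inv_closed[OF hc[OF x]], of x] hc[OF x] x VE
    unfolding s[OF x] by auto
  have scont: "continuous_map (subtopology ?B ?U) ?E s"
  proof (rule continuous_compose_quotient_map)
    show "quotient_map (subtopology ?E V) (subtopology ?B ?U) ?p"
      by (rule quotient_map_restriction[OF quotient_map_proj[OF q] pre disjI1[OF U]])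
    have "continuous_map (subtopology ?E V) (prod_topology T ?E) (\<lambda>x. (inv (h x), x))"
      by (intro continuous_map_pairedI continuous_map_inv_pointwise h continuous_map_from_subtopology) simp
    from continuous_map_compose[OF this continuous_act[OF q]]
    have "continuous_map (subtopology ?E V) ?E (\<lambda>x. act_E q (inv (h x)) x)" by (simp add: o_def)
    then show "continuous_map (subtopology ?E V) ?E (s \<circ> ?p)"
      by (rule continuous_map_eq) (simp add: s)
  qed
  let ?\<theta> = "\<lambda>x. (h x, ?p x)" and ?\<psi> = "\<lambda>p. act_E q (fst p) (s (snd p))"
  have "homeomorphic_maps (subtopology ?E V) (prod_topology T (subtopology ?B ?U)) ?\<theta> ?\<psi>"
    unfolding homeomorphic_maps_def
  proof (intro conjI ballI)
    show "continuous_map (subtopology ?E V) (prod_topology T (subtopology ?B ?U)) ?\<theta>"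
    proof (rule continuous_map_pairedI[OF h])
      show "continuous_map (subtopology ?E V) (subtopology ?B ?U) ?p"
        unfolding continuous_map_in_subtopology using continuous_map_from_subtopology[OF continuous_proj[OF q]] by auto
    qed
    have \<psi>V: "?\<psi> p \<in> V" if "p \<in> topspace (prod_topology T (subtopology ?B ?U))" for p
    proof -
      have "fst p \<in> carrier G" "snd p \<in> ?U" using that unfolding topspace_prod_topology tU topspace_eq by auto
      then obtain x where "x \<in> V" "snd p = ?p x" by blast
      then show ?thesis using ha[OF \<open>fst p \<in> carrier G\<close> sV(1)] by simp
    qed
    have "continuous_map (prod_topology T (subtopology ?B ?U)) (prod_topology T ?E) (\<lambda>p. (fst p, s (snd p)))"
      using continuous_map_compose[OF continuous_map_snd scont]
      by (intro continuous_map_pairedI continuous_map_fst) (simp only: o_def)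
    from continuous_map_compose[OF this continuous_act[OF q]]
    have "continuous_map (prod_topology T (subtopology ?B ?U)) ?E ?\<psi>" by (simp add: o_def)
    then show "continuous_map (prod_topology T (subtopology ?B ?U)) (subtopology ?E V) ?\<psi>"
      unfolding continuous_map_in_subtopology using \<psi>V by blast
  next
    fix x assume "x \<in> topspace (subtopology ?E V)"
    then have x: "x \<in> V" unfolding tV .
    then show "?\<psi> (?\<theta> x) = x" using s[OF x] act_E_inv(2)[OF q hc[OF x]] VE by auto
  next
    fix p assume "p \<in> topspace (prod_topology T (subtopology ?B ?U))"
    then have p: "fst p \<in> carrier G" "snd p \<in> ?U" unfolding topspace_prod_topology tU topspace_eq by auto
    then obtain x where x: "x \<in> V" "snd p = ?p x" by blast
    have "h (?\<psi> p) = fst p" using ha[OF p(1) sV(1)[OF x(1)]] sV(3)[OF x(1)] p(1) x(2) by simp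
    moreover have "?p (?\<psi> p) = snd p"
      using proj_act[OF q p(1), of "s (?p x)"] sV[OF x(1)] VE x(2) by auto
    ultimately show "?\<theta> (?\<psi> p) = p" by simp
  qed
  then have "homeomorphic_map (subtopology ?E V) (prod_topology T (subtopology ?B ?U)) ?\<theta>"
    using homeomorphic_map_maps by blast
  moreover have "snd (?\<theta> x) = ?p x \<and> (\<forall>g\<in>carrier G. fst (?\<theta> (act_E q g x)) = g \<otimes> fst (?\<theta> x))"
    if "x \<in> topspace ?E" "?p x \<in> ?U" for x
  proof -
    have "x \<in> V" using that pre by blast
    then show ?thesis using ha by simp
  qed
  moreover have "b \<in> ?U" using c V(2) by blast
  ultimately show ?thesis using U pre by (intro exI[of _ ?U] exI[of _ ?\<theta>]) simp
qed

lemma principal_bundle_EB: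
  assumes q: "1 \<le> q"
  shows "principal_bundle G T (EB_bundle G T q)"
  unfolding principal_bundle_def EB_bundle_simps
  using group_action_E[OF q] continuous_act[OF q] continuous_proj[OF q] proj_act[OF q] local_trivialization[OF q]
  by (simp add: case_prod_unfold)

lemma principal_bundle_morphism_EB:
  assumes q: "1 \<le> q" "q \<le> r"
  shows "principal_bundle_morphism G T (EB_bundle G T q) (EB_bundle G T r) (e_map G T q r) (b_map G T q r)"
proof -
  have r: "1 \<le> r" using q by order
  show ?thesis
    unfolding principal_bundle_morphism_def EB_bundle_simps
    using principal_bundle_EB[OF q(1)] principal_bundle_EB[OF r]
      continuous_realization_map[OF simplicial_map_e[OF q]] continuous_realization_map[OF simplicial_map_b[OF q]]
      proj_e_map[OF q] act_e_map[OF q] by blast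
qed


section \<open>Nilpotency and finiteness of the filtration\<close>

lemma e_map_compose:
  assumes "1 \<le> q" "q \<le> r" "r \<le> r'" "c \<in> topspace (E_space G T q)"
  shows "e_map G T r r' (e_map G T q r c) = e_map G T q r' c"
proof (rule realization_map_compose[OF simplicial_map_e[OF assms(1,2)] simplicial_map_e[OF _ assms(3)] simplicial_map_e[OF assms(1)] _ assms(4)])
  show r: "1 \<le> r" "q \<le> r'" using assms by order+
  fix n x assume "x \<in> topspace (level (E_simp G T q) n)"
  then have x: "x \<in> bar_tuples G 0 q n" by (simp add: topspace_level_E)
  then have "x \<in> bar_tuples G 0 r n" using bar_tuples_mono[OF assms(1,2)] by blast
  then show "e_simp G q r' n x = e_simp G r r' n (e_simp G q r n x)"
    using e_simp_eq[OF assms(1) r(2) x] e_simp_eq[OF assms(1,2) x] e_simp_eq[OF r(1) assms(3)] by simp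
qed

lemma b_map_compose:
  assumes q: "1 \<le> q" "q \<le> r" "r \<le> r'" and b: "b \<in> topspace (B_space G T q)"
  shows "b_map G T r r' (b_map G T q r b) = b_map G T q r' b"
proof -
  have r: "1 \<le> r" "q \<le> r'" using q by order+
  obtain c where c: "c \<in> topspace (E_space G T q)" "b = proj_EB q c" using b proj_surj[OF q(1)] by blast
  have "e_map G T q r c \<in> topspace (E_space G T r)" by (rule realization_map_in[OF simplicial_map_e[OF q(1,2)] c(1)])
  then show ?thesis
    using proj_e_map[OF q(1,2) c(1)] proj_e_map[OF r(1) q(3)] proj_e_map[OF q(1) r(2) c(1)] e_map_compose[OF q c(1)] c(2)
    by metis
qed

lemma bar_tuples_nilpotent:
  assumes "lower_central G q = {\<one>}" "1 \<le> q" "l \<le> 1"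
  shows "bar_tuples G l q n = bar_tuples G l \<infinity> n"
proof -
  have "{1..n} \<rightarrow>\<^sub>E carrier G \<subseteq> hom_tuples G q n"
  proof
    fix x assume x: "x \<in> {1..n} \<rightarrow>\<^sub>E carrier G"
    then have x': "x \<in> {1..n} \<rightarrow> carrier G" by (simp add: PiE_def)
    interpret f: group_hom "free_group n" G "word_value G x"
      by (rule group_homI[OF group_free_group is_group word_value_hom[OF x']])
    have "\<forall>w\<in>free_gamma n q. word_value G x w = \<one>" using f.lower_central_image(1)[of q] assms(1) by blast
    then show "x \<in> hom_tuples G q n" using x hom_tuples_iff_word_value[OF assms(2)] by blast
  qed
  then have "hom_tuples G q n = hom_tuples G \<infinity> n"
    using hom_tuples_subset[of q n] hom_tuples_infinity[of n] by (simp add: subset_antisym)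
  then show ?thesis by (simp add: bar_tuples_def)
qed

lemma stages_nilpotent:
  assumes "lower_central G (enat q) = {\<one>}" "1 \<le> q"
  shows "E_space G T (enat q) = EG G T" "B_space G T (enat q) = BG G T"
    "E_stage G T q = topspace (EG G T)" "B_stage G T q = topspace (BG G T)"
proof -
  have q: "1 \<le> enat q" "enat q \<le> \<infinity>" using assms(2) by (simp_all add: one_enat_def)
  have "bar_simp G T l (enat q) = bar_simp G T l \<infinity>" if "l \<le> 1" for l
    unfolding bar_simp_def using bar_tuples_nilpotent[OF assms(1) q(1) that] by simp
  then show eq: "E_space G T (enat q) = EG G T" "B_space G T (enat q) = BG G T"
    unfolding E_simp_eq_bar_simp B_simp_eq_bar_simp by simp_all
  have "c \<in> E_stage G T q" if "c \<in> topspace (EG G T)" for c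
  proof -
    obtain n x t where x: "x \<in> bar_tuples G 0 \<infinity> n" "t \<in> standard_simplex n" "c = glue_class (E_simp G T \<infinity>) (n, x, t)"
      using \<open>c \<in> topspace (EG G T)\<close> by (rule realization_cases) (simp add: topspace_level_E)
    have xq: "x \<in> bar_tuples G 0 (enat q) n" using x(1) bar_tuples_nilpotent[OF assms(1) q(1), of 0 n] by simp
    have "glue_class (E_simp G T (enat q)) (n, x, t) \<in> topspace (E_space G T (enat q))"
      using xq x(2) by (intro glue_class_in_realization) (simp add: topspace_prerealization_E)
    then show ?thesis using e_map_glue_class[OF q xq x(2)] x(3) unfolding E_stage_def by (metis image_eqI)
  qed
  moreover have "E_stage G T q \<subseteq> topspace (EG G T)"
    unfolding E_stage_def using realization_map_in[OF simplicial_map_e[OF q]] by blast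
  ultimately show E: "E_stage G T q = topspace (EG G T)" by blast
  have "b \<in> B_stage G T q" if b: "b \<in> topspace (BG G T)" for b
  proof -
    obtain c where c: "b = proj_EB \<infinity> c" "c \<in> topspace (EG G T)"
      using b unfolding proj_surj[of \<infinity>, simplified, symmetric] by (rule imageE)
    from c(2) obtain d where d: "c = e_map G T (enat q) \<infinity> d" "d \<in> topspace (E_space G T (enat q))"
      unfolding E[symmetric] E_stage_def by (rule imageE)
    have "proj_EB (enat q) d \<in> topspace (B_space G T (enat q))"
      using proj_surj[OF q(1)] d(2) by blast
    moreover have "b = b_map G T (enat q) \<infinity> (proj_EB (enat q) d)"
      using proj_e_map[OF q d(2)] c(1) d(1) by simp
    ultimately show ?thesis unfolding B_stage_def by (rule rev_image_eqI)
  qed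
  moreover have "B_stage G T q \<subseteq> topspace (BG G T)"
    unfolding B_stage_def using realization_map_in[OF simplicial_map_b[OF q]] by blast
  ultimately show "B_stage G T q = topspace (BG G T)" by blast
qed

text \<open>
  A generating tuple, placed at an interior point of its simplex, lies in a stage of the filtration
  only if the corresponding term of the lower central series of \<open>G\<close> is trivial.
\<close>

lemma filtration_finite_imp_nilpotent:
  assumes fg: "finitely_generated_group G" and ff: "filtration_finite G T"
  shows "nilpotent_group G"
proof -
  obtain q where q: "1 \<le> q" "E_stage G T q = topspace (EG G T)" using ff unfolding filtration_finite_def by blast
  have q': "1 \<le> enat q" "enat q \<le> \<infinity>" using q(1) by (simp_all add: one_enat_def)
  obtain S where S: "finite S" "S \<subseteq> carrier G" "generate G S = carrier G"
    using fg unfolding finitely_generated_group_def by blast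
  let ?n = "card S"
  obtain f where f: "bij_betw f {1..?n} S" using ex_bij_betw_nat_finite_1[OF S(1)] by blast
  define x where "x = (\<lambda>k\<in>{0..?n}. if k = 0 then \<one> else f k)"
  define t where "t i = (if i \<le> ?n then 1 / (real ?n + 1) else 0)" for i
  have fS: "f ` {1..?n} = S" using f by (simp add: bij_betw_def)
  have xS: "x ` {1..?n} = S"
  proof -
    have "x ` {1..?n} = f ` {1..?n}" by (intro image_cong) (auto simp: x_def)
    then show ?thesis using fS by simp
  qed
  have xk: "x k \<in> carrier G" if "k \<in> {0..?n}" for k
  proof (cases "k = 0")
    case False
    then have "x k \<in> x ` {1..?n}" using that by auto
    then show ?thesis using xS S(2) by auto
  qed (simp add: x_def)
  have xE: "x \<in> {0..?n} \<rightarrow>\<^sub>E carrier G"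
    by (rule PiE_I[OF xk]) (auto simp: x_def)
  then have x: "x \<in> bar_tuples G 0 \<infinity> ?n" by (simp add: bar_tuples_infinity)
  have t: "t \<in> standard_simplex ?n" by (rule simplexI) (auto simp: t_def)
  have "glue_class (E_simp G T \<infinity>) (?n, x, t) \<in> topspace (EG G T)"
    using x t by (intro glue_class_in_realization) (simp add: topspace_prerealization_E)
  then obtain c where c: "c \<in> topspace (E_space G T (enat q))" "glue_class (E_simp G T \<infinity>) (?n, x, t) = e_map G T (enat q) \<infinity> c"
    unfolding q(2)[symmetric] E_stage_def by blast
  have "x \<in> bar_tuples G 0 (enat q) ?n"
    by (rule interior_in_image(1)[OF q' x t _ c]) (simp add: t_def)
  then have "restrict x {1..?n} \<in> hom_tuples G (enat q) ?n" by (simp add: bar_tuples_def)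
  then have "lower_central (subgroup_generated G (restrict x {1..?n} ` {1..?n})) (enat q) = {\<one>}"
    using hom_tuples_iff[OF q'(1)] by blast
  moreover have "subgroup_generated G (restrict x {1..?n} ` {1..?n}) = G"
    using xS S(2,3) by (simp add: subgroup_generated_def Int_absorb1)
  ultimately have "lower_central G (enat (q - 1 + 1)) = {\<one>}" using q(1) by simp
  then show ?thesis unfolding nilpotent_group_def by blast
qed

lemma nilpotency_class_works:
  assumes "nilpotent_group G"
  shows "lower_central G (enat (nilpotency_class G + 1)) = {\<one>}"
  using assms unfolding nilpotent_group_def nilpotency_class_def by (rule LeastI_ex)

end

section \<open>Naturality\<close>

lemma E_ind_eq: "E_ind \<phi> = (\<lambda>n x. \<lambda>k\<in>{0..n}. \<phi> (x k))" and B_ind_eq: "B_ind \<phi> = (\<lambda>n x. \<lambda>k\<in>{1..n}. \<phi> (x k))"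
  by (intro ext; simp add: E_ind_def B_ind_def)+

locale bar_homomorphism = G: well_pointed_lch_group G T + H: well_pointed_lch_group H S
  for G :: "('a, 'm) monoid_scheme" and T and H :: "('b, 'n) monoid_scheme" and S +
  fixes \<phi>
  assumes \<phi>: "\<phi> \<in> continuous_hom G T H S"
begin

lemma hom: "\<phi> \<in> hom G H"
  using \<phi> by (simp add: continuous_hom_def)

lemma simplicial_map_E_ind:
  assumes "1 \<le> q" shows "simplicial_map (E_simp G T q) (E_simp H S q) (E_ind \<phi>)"
  unfolding E_simp_eq_bar_simp E_ind_eq
  by (rule simplicial_map_bar_ind[OF G.topological_group_axioms H.topological_group_axioms \<phi> assms zero_le])

lemma simplicial_map_B_ind:
  assumes "1 \<le> q" shows "simplicial_map (B_simp G T q) (B_simp H S q) (B_ind \<phi>)"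
  unfolding G.B_simp_eq_bar_simp H.B_simp_eq_bar_simp B_ind_eq
  by (rule simplicial_map_bar_ind[OF G.topological_group_axioms H.topological_group_axioms \<phi> assms le_refl])

lemma E_ind_in_tuples:
  "\<lbrakk>1 \<le> q; x \<in> bar_tuples G 0 q n\<rbrakk> \<Longrightarrow> E_ind \<phi> n x \<in> bar_tuples H 0 q n"
  unfolding E_ind_eq by (rule bar_ind_in_tuples[OF G.is_group H.is_group hom]) auto

lemma proj_E_ind:
  assumes q: "1 \<le> q" and c: "c \<in> topspace (E_space G T q)"
  shows "H.proj_EB q (E_ind_map G T H S \<phi> q c) = B_ind_map G T H S \<phi> q (G.proj_EB q c)"
  by (rule realization_map_square[OF simplicial_map_E_ind[OF q] H.simplicial_map_p[OF q]
        G.simplicial_map_p[OF q] simplicial_map_B_ind[OF q] _ c])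
     (auto simp: p_simp_def E_ind_def B_ind_def)

lemma act_E_ind:
  assumes q: "1 \<le> q" and g: "g \<in> carrier G" and c: "c \<in> topspace (E_space G T q)"
  shows "E_ind_map G T H S \<phi> q (G.act_E q g c) = H.act_E q (\<phi> g) (E_ind_map G T H S \<phi> q c)"
proof (rule realization_map_square[OF G.simplicial_map_act[OF q g] simplicial_map_E_ind[OF q]
      simplicial_map_E_ind[OF q] H.simplicial_map_act[OF q] _ c])
  show "\<phi> g \<in> carrier H" using hom g by (auto simp: hom_def)
  fix n x assume "x \<in> topspace (level (E_simp G T q) n)"
  then have "x 0 \<in> carrier G" using bar_tuples_closed[of x G 0 q n 0] by (simp add: G.topspace_level_E)
  then show "E_ind \<phi> n (G.act_simp g n x) = H.act_simp (\<phi> g) n (E_ind \<phi> n x)"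
    using hom_mult[OF hom g] by (intro ext) (auto simp: E_ind_def G.act_simp_def H.act_simp_def)
qed

lemma e_map_E_ind:
  assumes q: "1 \<le> q" "q \<le> r" and c: "c \<in> topspace (E_space G T q)"
  shows "E_ind_map G T H S \<phi> r (e_map G T q r c) = e_map H S q r (E_ind_map G T H S \<phi> q c)"
proof (rule realization_map_square[OF G.simplicial_map_e[OF q] simplicial_map_E_ind
      simplicial_map_E_ind[OF q(1)] H.simplicial_map_e[OF q] _ c])
  show "1 \<le> r" using q by order
  fix n x assume "x \<in> topspace (level (E_simp G T q) n)"
  then have x: "x \<in> bar_tuples G 0 q n" by (simp add: G.topspace_level_E)
  show "E_ind \<phi> n (e_simp G q r n x) = e_simp H q r n (E_ind \<phi> n x)"
    using G.e_simp_eq[OF q x] H.e_simp_eq[OF q E_ind_in_tuples[OF q(1) x]] by simp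
qed

lemma b_map_B_ind:
  assumes q: "1 \<le> q" "q \<le> r" and b: "b \<in> topspace (B_space G T q)"
  shows "B_ind_map G T H S \<phi> r (b_map G T q r b) = b_map H S q r (B_ind_map G T H S \<phi> q b)"
proof -
  have r: "1 \<le> r" using q by order
  obtain c where c: "c \<in> topspace (E_space G T q)" "b = G.proj_EB q c" using b G.proj_surj[OF q(1)] by blast
  have e: "e_map G T q r c \<in> topspace (E_space G T r)" by (rule realization_map_in[OF G.simplicial_map_e[OF q] c(1)])
  have i: "E_ind_map G T H S \<phi> q c \<in> topspace (E_space H S q)" by (rule realization_map_in[OF simplicial_map_E_ind[OF q(1)] c(1)])
  have "B_ind_map G T H S \<phi> r (b_map G T q r b) = H.proj_EB r (E_ind_map G T H S \<phi> r (e_map G T q r c))"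
    using G.proj_e_map[OF q c(1)] proj_E_ind[OF r e] c(2) by simp
  also have "\<dots> = H.proj_EB r (e_map H S q r (E_ind_map G T H S \<phi> q c))" using e_map_E_ind[OF q c(1)] by simp
  also have "\<dots> = b_map H S q r (B_ind_map G T H S \<phi> q b)"
    using H.proj_e_map[OF q i] proj_E_ind[OF q(1) c(1)] c(2) by simp
  finally show ?thesis .
qed

lemma stages_natural:
  assumes "1 \<le> r"
  shows "E_ind_map G T H S \<phi> \<infinity> ` E_stage G T r \<subseteq> E_stage H S r"
    "B_ind_map G T H S \<phi> \<infinity> ` B_stage G T r \<subseteq> B_stage H S r"
proof -
  have r: "1 \<le> enat r" "enat r \<le> \<infinity>" using assms by (simp_all add: one_enat_def)
  show "E_ind_map G T H S \<phi> \<infinity> ` E_stage G T r \<subseteq> E_stage H S r"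
    unfolding E_stage_def
    using e_map_E_ind[OF r] realization_map_in[OF simplicial_map_E_ind[OF r(1)]] by auto
  show "B_ind_map G T H S \<phi> \<infinity> ` B_stage G T r \<subseteq> B_stage H S r"
    unfolding B_stage_def
    using b_map_B_ind[OF r] realization_map_in[OF simplicial_map_B_ind[OF r(1)]] by auto
qed

end

theorem proposition2p10:
  fixes G :: "('a, 'm) monoid_scheme" and T :: "'a topology" and q :: nat
  assumes G: "well_pointed_lch_group G T"
    and q: "1 \<le> q"
  shows
   "\<comment> \<open>(1)\<close>
    ((\<forall>n. free_surj n (q + 1) q \<in> epi (free_quotient n (q + 1)) (free_quotient n q) \<and>
          (\<forall>w \<in> carrier (free_group n).
             free_surj n (q + 1) q (free_proj n (q + 1) w) = free_proj n q w) \<and>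
          (\<forall>x \<in> topspace (level (B_simp G T q) n).
             \<exists>f \<in> hom (free_quotient n q) G.
               x = gen_images n (f \<circ> free_proj n q) \<and>
               b_simp G q (q + 1) n x =
                 gen_images n (f \<circ> free_surj n (q + 1) q \<circ> free_proj n (q + 1)))) \<and>
     simplicial_map (E_simp G T q) (E_simp G T (q + 1)) (e_simp G q (q + 1)) \<and>
     simplicial_map (B_simp G T q) (B_simp G T (q + 1)) (b_simp G q (q + 1)) \<and>
     simplicial_map (E_simp G T q) (B_simp G T q) p_simp \<and>
     simplicial_map (E_simp G T (q + 1)) (B_simp G T (q + 1)) p_simp \<and>
     (\<forall>n. \<forall>x \<in> topspace (level (E_simp G T q) n).
        p_simp n (e_simp G q (q + 1) n x) = b_simp G q (q + 1) n (p_simp n x)))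
    \<and>
    \<comment> \<open>(2)\<close>
    (principal_bundle_morphism G T (EB_bundle G T q) (EB_bundle G T (q + 1))
       (e_map G T q (q + 1)) (b_map G T q (q + 1)) \<and>
     principal_bundle_morphism G T (EB_bundle G T (q + 1)) (EB_bundle G T \<infinity>)
       (e_map G T (q + 1) \<infinity>) (b_map G T (q + 1) \<infinity>) \<and>
     (\<forall>(H :: ('b, 'n) monoid_scheme) S \<phi>.
        well_pointed_lch_group H S \<and> \<phi> \<in> continuous_hom G T H S \<longrightarrow>
        (\<forall>r \<in> {enat q, enat (q + 1), \<infinity>}.
           simplicial_map (E_simp G T r) (E_simp H S r) (E_ind \<phi>) \<and>
           simplicial_map (B_simp G T r) (B_simp H S r) (B_ind \<phi>) \<and>
           (\<forall>x \<in> topspace (E_space G T r).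
              proj (EB_bundle H S r) (E_ind_map G T H S \<phi> r x) =
              B_ind_map G T H S \<phi> r (proj (EB_bundle G T r) x) \<and>
              (\<forall>g \<in> carrier G.
                 E_ind_map G T H S \<phi> r (act (EB_bundle G T r) g x) =
                 act (EB_bundle H S r) (\<phi> g) (E_ind_map G T H S \<phi> r x)))) \<and>
        (\<forall>x \<in> topspace (E_space G T q).
           E_ind_map G T H S \<phi> (q + 1) (e_map G T q (q + 1) x) =
           e_map H S q (q + 1) (E_ind_map G T H S \<phi> q x)) \<and>
        (\<forall>y \<in> topspace (B_space G T q).
           B_ind_map G T H S \<phi> (q + 1) (b_map G T q (q + 1) y) =
           b_map H S q (q + 1) (B_ind_map G T H S \<phi> q y)) \<and>
        (\<forall>x \<in> topspace (E_space G T (q + 1)).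
           E_ind_map G T H S \<phi> \<infinity> (e_map G T (q + 1) \<infinity> x) =
           e_map H S (q + 1) \<infinity> (E_ind_map G T H S \<phi> (q + 1) x)) \<and>
        (\<forall>y \<in> topspace (B_space G T (q + 1)).
           B_ind_map G T H S \<phi> \<infinity> (b_map G T (q + 1) \<infinity> y) =
           b_map H S (q + 1) \<infinity> (B_ind_map G T H S \<phi> (q + 1) y))))
    \<and>
    \<comment> \<open>(3)\<close>
    ((\<forall>r::nat. 1 \<le> r \<longrightarrow>
        embedding_map (E_space G T (enat r)) (E_space G T (enat (r + 1))) (e_map G T (enat r) (enat (r + 1))) \<and>
        embedding_map (B_space G T (enat r)) (B_space G T (enat (r + 1))) (b_map G T (enat r) (enat (r + 1))) \<and>
        embedding_map (E_space G T (enat r)) (EG G T) (e_map G T (enat r) \<infinity>) \<and>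
        embedding_map (B_space G T (enat r)) (BG G T) (b_map G T (enat r) \<infinity>) \<and>
        (\<forall>x \<in> topspace (E_space G T (enat r)).
           e_map G T (enat (r + 1)) \<infinity> (e_map G T (enat r) (enat (r + 1)) x) = e_map G T (enat r) \<infinity> x) \<and>
        (\<forall>y \<in> topspace (B_space G T (enat r)).
           b_map G T (enat (r + 1)) \<infinity> (b_map G T (enat r) (enat (r + 1)) y) = b_map G T (enat r) \<infinity> y)) \<and>
     subspace_filtration (EG G T) (E_stage G T) \<and>
     subspace_filtration (BG G T) (B_stage G T) \<and>
     (\<forall>(H :: ('b, 'n) monoid_scheme) S \<phi>.
        well_pointed_lch_group H S \<and> \<phi> \<in> continuous_hom G T H S \<longrightarrow>
        (\<forall>r\<ge>1. E_ind_map G T H S \<phi> \<infinity> ` E_stage G T r \<subseteq> E_stage H S r \<and>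
                B_ind_map G T H S \<phi> \<infinity> ` B_stage G T r \<subseteq> B_stage H S r)))
    \<and>
    \<comment> \<open>(4)\<close>
    ((\<forall>c. nilpotent_group G \<and> nilpotency_class G = c \<longrightarrow>
        E_space G T (c + 1) = EG G T \<and> B_space G T (c + 1) = BG G T \<and>
        E_stage G T (c + 1) = topspace (EG G T) \<and> B_stage G T (c + 1) = topspace (BG G T) \<and>
        filtration_finite G T) \<and>
     (finitely_generated_group G \<longrightarrow> (filtration_finite G T \<longleftrightarrow> nilpotent_group G)))"
proof -
  interpret well_pointed_lch_group G T by (rule G)
  have q1: "1 \<le> enat q" using q by (simp add: one_enat_def)
  have q2: "1 \<le> enat (q + 1)" by (simp add: one_enat_def)
  have qq: "enat q \<le> enat (q + 1)" by simp
  have qi: "enat (q + 1) \<le> \<infinity>" by simp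
  have step: "1 \<le> enat r" "1 \<le> enat (r + 1)" "enat r \<le> enat (r + 1)" "enat r \<le> \<infinity>" "enat (r + 1) \<le> \<infinity>" if "1 \<le> r" for r
    using that by (simp_all add: one_enat_def)
  have coerce: "enat q + 1 = enat (q + 1)" "enat c + 1 = enat (c + 1)" for c
    by (simp_all add: one_enat_def)
  show ?thesis
    unfolding coerce
  proof (intro conjI, goal_cases)
    case 1
    show ?case
    proof (intro allI conjI ballI)
      fix n
      show "free_surj n (enat (q + 1)) (enat q) \<in> epi (free_quotient n (enat (q + 1))) (free_quotient n (enat q))"
        by (rule free_surj_epi[OF q1 qq])
      show "free_surj n (enat (q + 1)) (enat q) (free_proj n (enat (q + 1)) w) = free_proj n (enat q) w"
        if "w \<in> carrier (free_group n)" for w by (rule free_surj_proj[OF q1 qq that])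
      fix x assume "x \<in> topspace (level (B_simp G T (enat q)) n)"
      then have x: "x \<in> hom_tuples G (enat q) n" unfolding topspace_level_B bar_tuples_one .
      then obtain f where f: "f \<in> hom (free_quotient n (enat q)) G" "gen_images n (f \<circ> free_proj n (enat q)) = x"
        using hom_tuples_factor[OF q1] by blast
      have "gen_images n (f \<circ> free_surj n (enat (q + 1)) (enat q) \<circ> free_proj n (enat (q + 1))) = x"
        using gen_images_free_surj[OF q1 qq, of n f] f(2) by (simp only:)
      then show "\<exists>f\<in>hom (free_quotient n (enat q)) G. x = gen_images n (f \<circ> free_proj n (enat q)) \<and>
          b_simp G (enat q) (enat (q + 1)) n x =
            gen_images n (f \<circ> free_surj n (enat (q + 1)) (enat q) \<circ> free_proj n (enat (q + 1)))"
        using f b_simp_eq[OF q1 qq x] by (intro bexI[OF _ f(1)]) (simp only:)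
    qed
  next
    case 2
    show ?case by (rule simplicial_map_e[OF q1 qq])
  next
    case 3
    show ?case by (rule simplicial_map_b[OF q1 qq])
  next
    case 4
    show ?case by (rule simplicial_map_p[OF q1])
  next
    case 5
    show ?case by (rule simplicial_map_p[OF q2])
  next
    case 6
    show ?case
    proof (intro allI ballI)
      fix n x assume "x \<in> topspace (level (E_simp G T (enat q)) n)"
      then have x: "x \<in> bar_tuples G 0 (enat q) n" unfolding topspace_level_E .
      have "b_simp G (enat q) (enat (q + 1)) n (p_simp n x) = p_simp n x"
        using b_simp_eq[OF q1 qq] p_simp_in_tuples[OF x] unfolding bar_tuples_one by blast
      then show "p_simp n (e_simp G (enat q) (enat (q + 1)) n x) = b_simp G (enat q) (enat (q + 1)) n (p_simp n x)"
        using e_simp_eq[OF q1 qq x] by simp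
    qed
  next
    case 7
    show ?case by (rule principal_bundle_morphism_EB[OF q1 qq])
  next
    case 8
    show ?case by (rule principal_bundle_morphism_EB[OF q2 qi])
  next
    case 9
    show ?case
    proof (intro allI impI, goal_cases)
      case (1 H S \<phi>)
      interpret h: bar_homomorphism G T H S \<phi>
        using 1 G by (simp add: bar_homomorphism_def bar_homomorphism_axioms_def)
      have r1: "1 \<le> r" if "r \<in> {enat q, enat (q + 1), \<infinity>}" for r using that q1 q2 by auto
      show ?case
        unfolding EB_bundle_simps h.H.EB_bundle_simps
        by (intro conjI ballI h.simplicial_map_E_ind[OF r1] h.simplicial_map_B_ind[OF r1]
            h.proj_E_ind[OF r1] h.act_E_ind[OF r1] h.e_map_E_ind[OF q1 qq] h.e_map_E_ind[OF q2 qi]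
            h.b_map_B_ind[OF q1 qq] h.b_map_B_ind[OF q2 qi])
    qed
  next
    case 10
    show ?case
      by (intro allI impI conjI ballI embedding_map_e embedding_map_b e_map_compose b_map_compose Hausdorff step)
  next
    case 11
    show ?case
      unfolding subspace_filtration_def
    proof (intro allI impI conjI subsetI)
      fix r :: nat and z assume r: "1 \<le> r" and "z \<in> E_stage G T r"
      then obtain c where c: "z = e_map G T (enat r) \<infinity> c" "c \<in> topspace (E_space G T (enat r))"
        unfolding E_stage_def by (elim imageE)
      have "e_map G T (enat r) (enat (r + 1)) c \<in> topspace (E_space G T (enat (r + 1)))"
        by (rule realization_map_in[OF simplicial_map_e[OF step(1,3)[OF r]] c(2)])
      then show "z \<in> E_stage G T (r + 1)"
        unfolding E_stage_def c(1) e_map_compose[OF step(1,3,5)[OF r] c(2), symmetric] by (rule imageI)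
      show "z \<in> topspace (EG G T)"
        unfolding c(1) by (rule realization_map_in[OF simplicial_map_e[OF step(1,4)[OF r]] c(2)])
    qed
  next
    case 12
    show ?case
      unfolding subspace_filtration_def
    proof (intro allI impI conjI subsetI)
      fix r :: nat and z assume r: "1 \<le> r" and "z \<in> B_stage G T r"
      then obtain c where c: "z = b_map G T (enat r) \<infinity> c" "c \<in> topspace (B_space G T (enat r))"
        unfolding B_stage_def by (elim imageE)
      have "b_map G T (enat r) (enat (r + 1)) c \<in> topspace (B_space G T (enat (r + 1)))"
        by (rule realization_map_in[OF simplicial_map_b[OF step(1,3)[OF r]] c(2)])
      then show "z \<in> B_stage G T (r + 1)"
        unfolding B_stage_def c(1) b_map_compose[OF step(1,3,5)[OF r] c(2), symmetric] by (rule imageI)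
      show "z \<in> topspace (BG G T)"
        unfolding c(1) by (rule realization_map_in[OF simplicial_map_b[OF step(1,4)[OF r]] c(2)])
    qed
  next
    case 13
    show ?case
    proof (intro allI impI)
      fix H :: "('b, 'n) monoid_scheme" and S \<phi> and r :: nat
      assume H: "well_pointed_lch_group H S \<and> \<phi> \<in> continuous_hom G T H S" and r: "1 \<le> r"
      interpret h: bar_homomorphism G T H S \<phi>
        using H G by (simp add: bar_homomorphism_def bar_homomorphism_axioms_def)
      show "E_ind_map G T H S \<phi> \<infinity> ` E_stage G T r \<subseteq> E_stage H S r \<and>
          B_ind_map G T H S \<phi> \<infinity> ` B_stage G T r \<subseteq> B_stage H S r"
        using h.stages_natural[OF r] by blast
    qed
  next
    case 14
    show ?case
    proof (intro allI impI)
      fix c assume "nilpotent_group G \<and> nilpotency_class G = c"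
      then have lc: "lower_central G (enat (c + 1)) = {\<one>\<^bsub>G\<^esub>}" using nilpotency_class_works by blast
      note st = stages_nilpotent[OF lc]
      have "filtration_finite G T" unfolding filtration_finite_def using st(3,4) by (intro exI[of _ "c + 1"]) simp
      then show "E_space G T (enat (c + 1)) = EG G T \<and> B_space G T (enat (c + 1)) = BG G T \<and>
          E_stage G T (c + 1) = topspace (EG G T) \<and> B_stage G T (c + 1) = topspace (BG G T) \<and> filtration_finite G T"
        using st by simp
    qed
  next
    case 15
    show ?case
    proof (intro impI iffI)
      assume "finitely_generated_group G" "filtration_finite G T"
      then show "nilpotent_group G" by (rule filtration_finite_imp_nilpotent)
    next
      assume "nilpotent_group G"
      from stages_nilpotent(3,4)[OF nilpotency_class_works[OF this]] show "filtration_finite G T"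
        unfolding filtration_finite_def by (intro exI[of _ "nilpotency_class G + 1"]) simp
    qed
  qed
qed

end
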